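(* For each integer $k \ge 2$ there is a positive constant $C$ such that the following holds. Suppose that for some real $\gamma=\gamma(n)$ and positive integer $d=d(n)$, \[ C \left( \left(\frac{d}{n^{k-1}} + \frac{\log n}{d}\right)^{1/3} +\frac1n\right) \le \gamma < 1, \] and $m = (1-\gamma) nd/k$ is an integer. Then there is a joint distribution (coupling) of $\mathbb{G}^{(k)}(n,m)$ and $\mathbb{R}^{(k)}(n,d)$ such that \[ \lim_{n\to\infty}\Pr\left(\mathbb{G}^{(k)}(n,m) \subseteq \mathbb{R}^{(k)}(n,d)\right) = 1. \]
   Context: A $k$-uniform hypergraph ($k$-graph) on vertex set $[n]=\{1,\dots,n\}$ is a pair $([n],E)$ with $E$ a family of $k$-element subsets of $[n]$. The degree of a vertex $v$ is the number of edges containing it; a $k$-graph is $d$-regular if every vertex has degree $d$. It is tacitly assumed that $k$ divides $nd$. $\mathbb{R}^{(k)}(n,d)$ denotes a $k$-graph chosen uniformly at random from all $d$-regular $k$-graphs on $[n]$. $\mathbb{G}^{(k)}(n,m)$ denotes a $k$-graph chosen uniformly at random among all $\binom{\binom nk}{m}$ $k$-graphs on $[n]$ with exactly $m$ edges. Asymptotics are as $n\to\infty$, with $d,m,\gamma$ functions of $n$. *)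

theory Defs
  imports "HOL-Probability.Probability"
begin

text \<open>k-uniform hypergraphs on [n] = {1..n}, represented by their edge sets.\<close>
definition kgraphs :: "nat \<Rightarrow> nat \<Rightarrow> nat set set set" where
  "kgraphs k n = {E. E \<subseteq> {e. e \<subseteq> {1..n} \<and> card e = k}}"

definition hdegree :: "nat set set \<Rightarrow> nat \<Rightarrow> nat" where
  "hdegree E v = card {e \<in> E. v \<in> e}"

definition regular_kgraphs :: "nat \<Rightarrow> nat \<Rightarrow> nat \<Rightarrow> nat set set set" where
  "regular_kgraphs k n d = {E \<in> kgraphs k n. \<forall>v \<in> {1..n}. hdegree E v = d}"

definition G_nm :: "nat \<Rightarrow> nat \<Rightarrow> nat \<Rightarrow> nat set set pmf" where
  "G_nm k n m = pmf_of_set {E \<in> kgraphs k n. card E = m}"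

definition R_nd :: "nat \<Rightarrow> nat \<Rightarrow> nat \<Rightarrow> nat set set pmf" where
  "R_nd k n d = pmf_of_set (regular_kgraphs k n d)"

end

theory Submission
  imports Defs
begin

text \<open>
  Reveal a uniformly random \<open>d\<close>-regular graph edge by edge, in uniformly random order. Given that the
  edge set \<open>B\<close> has been revealed, the next edge is \<open>e\<close> with probability proportional to the number of
  \<open>d\<close>-regular graphs containing \<open>B\<close> and \<open>e\<close>. If every residual degree \<open>d - deg\<^sub>B(v)\<close> is within a factor
  \<open>1 - \<delta>\<close> to \<open>1 + \<delta>\<close> of its mean, a switching argument shows that these probabilities are at least
  \<open>1 - \<epsilon>\<close> times the uniform one. The next edge can then be coupled with a uniformly random edge
  that is accepted with probability \<open>1 - \<epsilon>\<close>, independently of which edge it is; the accepted edges form a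
  uniformly random graph, and with \<open>\<epsilon> = \<gamma>/8\<close> there are more than \<open>m\<close> of them by the time a
  fraction \<open>1 - \<gamma>/4\<close> of the regular graph has been revealed.

  Up to that time the mean residual degree is at least \<open>\<gamma> d / 4\<close>, so a Chernoff bound with \<open>\<delta>\<close> of order
  \<open>\<gamma>\<close> works if \<open>\<gamma>\<^sup>3 d\<close> is a large multiple of \<open>log n\<close>; this is the origin of the cube root.

  The switching moves one unit of degree from \<open>v\<close> to \<open>a\<close>: take an edge through \<open>v\<close> and \<open>k - 1\<close> further
  edges as the rows of a \<open>k \<times> k\<close> array, put \<open>a\<close> in place of \<open>v\<close>, and replace the rows by the columns.
  As each new edge takes at most one vertex from each old edge, the arrays with an unusable column are few
  in every graph with nearly equal degrees, and no bound on codegrees is needed.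
\<close>

section \<open>Ordered edges\<close>

text \<open>Revealing e or f after \<open>B\<close> leaves residual degree sequences that differ
  only on e and f; if the two edges are disjoint, k moves of one unit lead from one sequence to the
  other. Edges that meet e are never compared with it: they make up a fraction O(k^2/n) of what is
  still hidden and are given up. This loss, together with arrays having a repeated vertex, accounts
  for the term 1/n of the hypothesis; d/n^(k-1) is the chance that a column is already an edge. All
  estimates are one-sided. The coupling asks only that no edge be much less likely than under the
  uniform law, so the switching is an injection from good arrays into all arrays of the target
  graph. Both marginals of the coupling must be exact. Hence every step, good or bad, has the right
  marginals, and both sets are completed at the end to uniform objects; a bad state can cost only
  the containment. Regular graphs must also be shown to exist, since \<open>R_nd\<close> is
  meaningful only for a nonempty family.\<close>

definition ksets :: "nat \<Rightarrow> nat \<Rightarrow> nat set set" where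
  "ksets k n = {e. e \<subseteq> {1..n} \<and> card e = k}"

lemma finite_ksets [simp]: "finite (ksets k n)"
proof -
  have "ksets k n \<subseteq> Pow {1..n}" by (auto simp: ksets_def)
  thus ?thesis by (rule finite_subset) auto
qed

lemma card_ksets: "card (ksets k n) = n choose k"
  using n_subsets[of "{1..n}" k] by (simp add: ksets_def)

lemma finite_mem_ksets: "e \<in> ksets k n \<Longrightarrow> finite e"
  by (auto simp: ksets_def intro: finite_subset)

lemma hdegree_sum: "finite F \<Longrightarrow> hdegree F u = (\<Sum>e\<in>F. of_bool (u \<in> e))"
  by (simp add: hdegree_def sum.If_cases Int_def of_bool_def)

lemma hdegree_mono: "finite F' \<Longrightarrow> F \<subseteq> F' \<Longrightarrow> hdegree F u \<le> hdegree F' u"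
  unfolding hdegree_def by (rule card_mono) auto

lemma hdegree_Un_disjoint:
  "finite F \<Longrightarrow> finite F' \<Longrightarrow> F \<inter> F' = {} \<Longrightarrow> hdegree (F \<union> F') u = hdegree F u + hdegree F' u"
  by (subst (1 2 3) hdegree_sum) (simp_all del: sum_of_bool_eq add: sum.union_disjoint)

lemma hdegree_Un_le:
  "finite F \<Longrightarrow> finite F' \<Longrightarrow> hdegree (F \<union> F') u \<le> hdegree F u + hdegree F' u"
  using hdegree_Un_disjoint[of F "F' - F" u] hdegree_mono[of F' "F' - F" u]
  by (metis Diff_disjoint Diff_subset Un_Diff_cancel add_left_mono finite_Diff)

lemma hdegree_le_card: "finite F \<Longrightarrow> hdegree F u \<le> card F"
  unfolding hdegree_def by (rule card_mono) auto

lemma handshake: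
  assumes "F \<subseteq> ksets k n"
  shows "(\<Sum>u\<in>{1..n}. hdegree F u) = k * card F"
proof -
  have fin: "finite F" using assms finite_subset by fastforce
  have "(\<Sum>u\<in>{1..n}. hdegree F u) = (\<Sum>e\<in>F. \<Sum>u\<in>{1..n}. of_bool (u \<in> e))"
    unfolding hdegree_sum[OF fin] by (rule sum.swap)
  also have "\<dots> = (\<Sum>e\<in>F. k)"
  proof (rule sum.cong[OF refl])
    fix e assume "e \<in> F"
    hence "e \<subseteq> {1..n}" "card e = k" using assms by (auto simp: ksets_def)
    moreover have "(\<Sum>u\<in>{1..n}. of_bool (u \<in> e)) = card ({1..n} \<inter> e)"
      by (simp add: of_bool_def sum.If_cases)
    ultimately show "(\<Sum>u\<in>{1..n}. of_bool (u \<in> e)) = k" by (simp add: Int_absorb1)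
  qed
  finally show ?thesis by simp
qed

text \<open>Rows and columns of an array are edges whose vertices have positions. A vertex
  prescribed at one position selects a share 1/k of the orderings of each edge through it, so all
  counts stay exact.\<close>

definition ordered_edges :: "nat set set \<Rightarrow> nat list set" where
  "ordered_edges F = (\<Union>e\<in>F. permutations_of_set e)"

lemma mem_ordered_edges: "xs \<in> ordered_edges F \<longleftrightarrow> set xs \<in> F \<and> distinct xs"
  by (auto simp: ordered_edges_def permutations_of_set_def)

text \<open>Deleting position \<open>j\<close> is a bijection onto the orderings of
  \<open>e - {z}\<close>.\<close>

lemma card_permutations_of_set_nth:
  assumes "finite e" "z \<in> e" "j < card e"
  shows "card {xs \<in> permutations_of_set e. xs ! j = z} = fact (card e - 1)"
proof -
  have "bij_betw (\<lambda>ys. take j ys @ z # drop j ys) (permutations_of_set (e - {z}))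
          {xs \<in> permutations_of_set e. xs ! j = z}"
  proof (rule bij_betw_byWitness[where f' = "\<lambda>xs. take j xs @ drop (Suc j) xs"])
    have len: "length ys = card e - 1" if "ys \<in> permutations_of_set (e - {z})" for ys
      using length_finite_permutations_of_set[OF that] assms by simp
    show "\<forall>ys\<in>permutations_of_set (e - {z}).
       take j (take j ys @ z # drop j ys) @ drop (Suc j) (take j ys @ z # drop j ys) = ys"
    proof
      fix ys assume "ys \<in> permutations_of_set (e - {z})"
      with len assms(3) have "j \<le> length ys" by auto
      thus "take j (take j ys @ z # drop j ys) @ drop (Suc j) (take j ys @ z # drop j ys) = ys"
        by (simp add: min_def)
    qed
    have len2: "length xs = card e" if "xs \<in> permutations_of_set e" for xs
      using length_finite_permutations_of_set[OF that] .
    have split: "xs = take j xs @ z # drop (Suc j) xs"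
      if "xs \<in> permutations_of_set e" "xs ! j = z" for xs
      using id_take_nth_drop[of j xs] len2[OF that(1)] that assms(3) by simp
    show "\<forall>xs\<in>{xs \<in> permutations_of_set e. xs ! j = z}.
       take j (take j xs @ drop (Suc j) xs) @ z # drop j (take j xs @ drop (Suc j) xs) = xs"
    proof
      fix xs assume xs: "xs\<in>{xs \<in> permutations_of_set e. xs ! j = z}"
      hence "j < length xs" using len2 assms(3) by auto
      thus "take j (take j xs @ drop (Suc j) xs) @ z # drop j (take j xs @ drop (Suc j) xs) = xs"
        using split xs by (auto simp: min_def)
    qed
    show "(\<lambda>ys. take j ys @ z # drop j ys) ` permutations_of_set (e - {z})
       \<subseteq> {xs \<in> permutations_of_set e. xs ! j = z}"
    proof (rule image_subsetI)
      fix ys assume ys: "ys \<in> permutations_of_set (e - {z})"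
      have j: "j \<le> length ys" using len[OF ys] assms(3) by auto
      have "distinct (take j ys @ drop j ys)" "set (take j ys @ drop j ys) = e - {z}"
        using ys by (auto simp: permutations_of_set_def)
      hence "distinct (take j ys @ z # drop j ys)" "set (take j ys @ z # drop j ys) = e"
        using assms(2) unfolding distinct_append set_append by auto
      thus "take j ys @ z # drop j ys \<in> {xs \<in> permutations_of_set e. xs ! j = z}"
        using j by (simp add: permutations_of_set_def nth_append)
    qed
    show "(\<lambda>xs. take j xs @ drop (Suc j) xs) ` {xs \<in> permutations_of_set e. xs ! j = z}
       \<subseteq> permutations_of_set (e - {z})"
    proof (rule image_subsetI)
      fix xs assume "xs \<in> {xs \<in> permutations_of_set e. xs ! j = z}"
      hence xs: "xs \<in> permutations_of_set e" "xs ! j = z" by auto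
      have "distinct (take j xs @ z # drop (Suc j) xs)" "set (take j xs @ z # drop (Suc j) xs) = e"
        using split[OF xs] xs(1) by (auto simp: permutations_of_set_def)
      thus "take j xs @ drop (Suc j) xs \<in> permutations_of_set (e - {z})"
        by (auto simp: permutations_of_set_def)
    qed
  qed
  hence "card {xs \<in> permutations_of_set e. xs ! j = z} = card (permutations_of_set (e - {z}))"
    by (simp add: bij_betw_same_card)
  also have "\<dots> = fact (card e - 1)" using assms by simp
  finally show ?thesis .
qed

lemma finite_ordered_edges: "finite F \<Longrightarrow> finite (ordered_edges F)"
  by (simp add: ordered_edges_def)

lemma card_ordered_edges:
  assumes "F \<subseteq> ksets k n"
  shows "card (ordered_edges F) = card F * fact k"
proof -
  have fin: "finite F" using assms finite_subset by fastforce
  have "card (ordered_edges F) = (\<Sum>e\<in>F. card (permutations_of_set e))"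
    unfolding ordered_edges_def
    by (rule card_UN_disjoint) (use fin in \<open>simp, simp, fastforce simp: permutations_of_set_def\<close>)
  also have "\<dots> = (\<Sum>e\<in>F. fact k)"
    by (rule sum.cong) (use assms in \<open>auto simp: ksets_def finite_subset\<close>)
  finally show ?thesis by simp
qed

lemma card_ordered_edges_nth:
  assumes "F \<subseteq> ksets k n" "j < k"
  shows "card {xs \<in> ordered_edges F. xs ! j = z} = hdegree F z * fact (k - 1)"
proof -
  have fin: "finite F" using assms finite_subset by fastforce
  have "{xs \<in> ordered_edges F. xs ! j = z} = (\<Union>e\<in>{e\<in>F. z \<in> e}. {xs \<in> permutations_of_set e. xs ! j = z})"
  proof -
    have "z \<in> set xs" if "xs \<in> ordered_edges F" "xs ! j = z" for xs
    proof -
      have "length xs = k" using that assms(1)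
        by (auto simp: mem_ordered_edges ksets_def distinct_card)
      thus ?thesis using assms(2) that(2) by auto
    qed
    thus ?thesis by (auto simp: ordered_edges_def permutations_of_set_def)
  qed
  also have "card \<dots> = (\<Sum>e\<in>{e\<in>F. z \<in> e}. card {xs \<in> permutations_of_set e. xs ! j = z})"
    by (rule card_UN_disjoint) (use fin in \<open>simp, simp, fastforce simp: permutations_of_set_def\<close>)
  also have "\<dots> = (\<Sum>e\<in>{e\<in>F. z \<in> e}. fact (k - 1))"
  proof (rule sum.cong[OF refl])
    fix e assume "e \<in> {e\<in>F. z \<in> e}"
    hence "finite e" "z \<in> e" "card e = k"
      using assms(1) by (auto simp: ksets_def finite_subset)
    thus "card {xs \<in> permutations_of_set e. xs ! j = z} = fact (k - 1)"
      using card_permutations_of_set_nth[of e z j] assms(2) by simp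
  qed
  finally show ?thesis by (simp add: hdegree_def)
qed

lemma card_ordered_edges_meet:
  assumes "F \<subseteq> ksets k n" "finite Z" "\<And>z. z \<in> Z \<Longrightarrow> hdegree F z \<le> \<Delta>"
  shows "card {xs \<in> ordered_edges F. set xs \<inter> Z \<noteq> {}} \<le> card Z * \<Delta> * fact k"
proof -
  have fin: "finite F" using assms(1) finite_subset by fastforce
  have "{xs \<in> ordered_edges F. set xs \<inter> Z \<noteq> {}} = (\<Union>z\<in>Z. ordered_edges {e\<in>F. z \<in> e})"
    by (auto simp: mem_ordered_edges)
  also have "card \<dots> \<le> (\<Sum>z\<in>Z. card (ordered_edges {e\<in>F. z \<in> e}))"
    by (rule card_UN_le[OF assms(2)])
  also have "\<dots> = (\<Sum>z\<in>Z. hdegree F z * fact k)"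
    by (rule sum.cong[OF refl], subst card_ordered_edges[of _ k n]) (use assms in \<open>auto simp: hdegree_def\<close>)
  also have "\<dots> \<le> (\<Sum>z\<in>Z. \<Delta> * fact k)" by (rule sum_mono) (simp add: assms(3))
  finally show ?thesis by simp
qed

text \<open>All coordinates except \<open>i\<close> are fixed first. They determine the value at
  \<open>i'\<close>, so the set \<open>T (h i')\<close> is known and leaves at most \<open>b\<close>
  values at \<open>i\<close>.\<close>

lemma card_PiE_dependent_le:
  assumes "finite I" "i \<in> I" "i' \<noteq> i" "\<And>l. l \<in> I \<Longrightarrow> finite (S l)"
    and b: "\<And>x. card (S i \<inter> T x) \<le> b"
  shows "card {h \<in> PiE I S. h i \<in> T (h i')} \<le> b * (\<Prod>l\<in>I - {i}. card (S l))"
proof -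
  let ?J = "I - {i}"
  have inj: "inj_on (\<lambda>h. (restrict h ?J, h i)) {h \<in> PiE I S. h i \<in> T (h i')}"
  proof (rule inj_onI)
    fix h g assume h: "h \<in> {h \<in> PiE I S. h i \<in> T (h i')}" and g: "g \<in> {h \<in> PiE I S. h i \<in> T (h i')}"
      and eq: "(restrict h ?J, h i) = (restrict g ?J, g i)"
    show "h = g"
    proof (rule PiE_ext[of _ I S])
      fix x assume "x \<in> I"
      thus "h x = g x" using eq by (cases "x = i") (auto dest: fun_cong[of _ _ x])
    qed (use h g in auto)
  qed
  have sub: "(\<lambda>h. (restrict h ?J, h i)) ` {h \<in> PiE I S. h i \<in> T (h i')}
      \<subseteq> (SIGMA r : PiE ?J S. S i \<inter> T (r i'))"
  proof (rule image_subsetI)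
    fix h assume h: "h \<in> {h \<in> PiE I S. h i \<in> T (h i')}"
    \<comment> \<open>This also holds for \<open>i'\<close> outside \<open>I\<close>, where both
      functions take the value \<open>undefined\<close>.\<close>
    have "restrict h ?J i' = h i'"
      using h assms(3) by (auto simp: restrict_def PiE_def extensional_def)
    thus "(restrict h ?J, h i) \<in> (SIGMA r : PiE ?J S. S i \<inter> T (r i'))"
      using h assms(2) by (auto simp: PiE_def extensional_def)
  qed
  have finP: "finite (PiE ?J S)" using assms by (intro finite_PiE) auto
  have "card {h \<in> PiE I S. h i \<in> T (h i')} \<le> card (SIGMA r : PiE ?J S. S i \<inter> T (r i'))"
    by (rule card_inj_on_le[OF inj sub]) (use finP assms in auto)
  also have "\<dots> = (\<Sum>r\<in>PiE ?J S. card (S i \<inter> T (r i')))"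
    by (rule card_SigmaI) (use finP assms in auto)
  also have "\<dots> \<le> (\<Sum>r\<in>PiE ?J S. b)" by (rule sum_mono) (rule b)
  also have "\<dots> = b * (\<Prod>l\<in>?J. card (S l))" using assms by (simp add: card_PiE)
  finally show ?thesis .
qed

section \<open>Switchings\<close>

text \<open>Column \<open>j\<close> of the array with rows \<open>h 0, \<dots>, h (k - 1)\<close>, with \<open>a\<close> in the corner \<open>(0, 0)\<close>. The operation
  is its own inverse once the corner is restored.\<close>

definition switch_column :: "nat \<Rightarrow> nat \<Rightarrow> (nat \<Rightarrow> nat list) \<Rightarrow> nat \<Rightarrow> nat list" where
  "switch_column k a h j = (if j = 0 then a else h 0 ! j) # map (\<lambda>i. h i ! j) [1..<k]"

lemma length_switch_column [simp]: "k \<ge> 1 \<Longrightarrow> length (switch_column k a h j) = k"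
  by (simp add: switch_column_def)

lemma nth_switch_column:
  "i < k \<Longrightarrow> switch_column k a h j ! i = (if i = 0 \<and> j = 0 then a else h i ! j)"
  by (cases i) (auto simp: switch_column_def)

lemma switch_column_0 [simp]: "switch_column k a h j ! 0 = (if j = 0 then a else h 0 ! j)"
  by (simp add: switch_column_def)

definition dgraphs :: "nat \<Rightarrow> nat set set \<Rightarrow> (nat \<Rightarrow> nat) \<Rightarrow> nat set set set" where
  "dgraphs n K s = {F. F \<subseteq> K \<and> (\<forall>u\<in>{1..n}. hdegree F u = s u)}"

text \<open>Rows may repeat or meet here. As a full product the set has an exact size that depends
  on the graph only through the degree of \<open>v\<close> and the number of edges; degenerate
  arrays are removed later by a union bound.\<close>

definition configs :: "nat \<Rightarrow> nat set set \<Rightarrow> nat \<Rightarrow> (nat \<Rightarrow> nat list) set" where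
  "configs k F v = PiE {..<k} (\<lambda>i. {xs \<in> ordered_edges F. i = 0 \<longrightarrow> xs ! 0 = v})"

text \<open>Row \<open>0\<close> may contain \<open>a\<close>; excluding this would require a bound on the codegree of \<open>v\<close> and \<open>a\<close>.\<close>

definition good_configs :: "nat \<Rightarrow> nat set set \<Rightarrow> nat set set \<Rightarrow> nat \<Rightarrow> nat \<Rightarrow> (nat \<Rightarrow> nat list) set" where
  "good_configs k F X v a = {h \<in> configs k F v.
     (\<forall>i<k. \<forall>i'<k. i \<noteq> i' \<longrightarrow> set (h i) \<inter> set (h i') = {}) \<and>
     (\<forall>i<k. 0 < i \<longrightarrow> a \<notin> set (h i)) \<and>
     (\<forall>j<k. set (switch_column k a h j) \<notin> F \<union> X)}"

definition switch :: "nat \<Rightarrow> nat set set \<Rightarrow> nat \<Rightarrow> (nat \<Rightarrow> nat list) \<Rightarrow> nat set set" where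
  "switch k F a h = (F - (\<lambda>i. set (h i)) ` {..<k}) \<union> (\<lambda>j. set (switch_column k a h j)) ` {..<k}"

lemma finite_configs: "finite F \<Longrightarrow> finite (configs k F v)"
  unfolding configs_def by (intro finite_PiE) (auto simp: finite_ordered_edges)

lemma lessThan_remove0: "k \<ge> 1 \<Longrightarrow> {..<k} - {0} = {1..<k::nat}" by auto

lemma card_configs:
  assumes "F \<subseteq> ksets k n" "k \<ge> 1"
  shows "card (configs k F v) = hdegree F v * fact (k - 1) * (card F * fact k) ^ (k - 1)"
proof -
  have "card (configs k F v) = (\<Prod>i<k. card {xs \<in> ordered_edges F. i = 0 \<longrightarrow> xs ! 0 = v})"
    unfolding configs_def by (simp add: card_PiE)
  also have "\<dots> = card {xs \<in> ordered_edges F. xs ! 0 = v} *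
      (\<Prod>i\<in>{1..<k}. card {xs \<in> ordered_edges F. i = 0 \<longrightarrow> xs ! 0 = v})"
    using assms(2) by (simp add: prod.remove[of "{..<k}" 0] lessThan_remove0)
  also have "(\<Prod>i\<in>{1..<k}. card {xs \<in> ordered_edges F. i = 0 \<longrightarrow> xs ! 0 = v}) = (\<Prod>i\<in>{1..<k}. card F * fact k)"
    by (rule prod.cong) (auto simp: card_ordered_edges[OF assms(1)])
  also have "card {xs \<in> ordered_edges F. xs ! 0 = v} = hdegree F v * fact (k - 1)"
    using assms by (intro card_ordered_edges_nth) auto
  finally show ?thesis by simp
qed

section \<open>The effect of one switching\<close>

context
  fixes k n a v :: nat and F X :: "nat set set" and h
  assumes F: "F \<subseteq> ksets k n" and k: "k \<ge> 2" and a: "a \<in> {1..n}" and v: "v \<in> {1..n}"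
    and h: "h \<in> good_configs k F X v a"
begin

lemma good_config_finite: "finite F" using F finite_subset by fastforce

lemma good_row: assumes "i < k" shows "set (h i) \<in> F" "distinct (h i)" "length (h i) = k"
proof -
  have "h \<in> configs k F v" using h by (simp add: good_configs_def)
  hence "h i \<in> ordered_edges F" using PiE_mem[of h "{..<k}" _ i] assms unfolding configs_def by fastforce
  thus "set (h i) \<in> F" "distinct (h i)" by (auto simp: mem_ordered_edges)
  thus "length (h i) = k" using F by (auto simp: ksets_def distinct_card)
qed

lemma good_corner: "h 0 ! 0 = v"
proof -
  have "0 \<in> {..<k}" using k by simp
  moreover have "h \<in> configs k F v" using h by (simp add: good_configs_def)
  ultimately have "h 0 \<in> {xs \<in> ordered_edges F. 0 = (0::nat) \<longrightarrow> xs ! 0 = v}"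
    unfolding configs_def by (rule PiE_mem[rotated])
  thus ?thesis by simp
qed

lemma good_disjoint: "i < k \<Longrightarrow> i' < k \<Longrightarrow> i \<noteq> i' \<Longrightarrow> set (h i) \<inter> set (h i') = {}"
  using h by (simp add: good_configs_def)

lemma good_nth_mem: "i < k \<Longrightarrow> j < k \<Longrightarrow> h i ! j \<in> set (h i)"
  using good_row(3)[of i] by auto

lemma good_entry_inj:
  assumes "i < k" "i' < k" "j < k" "j' < k" "h i ! j = h i' ! j'"
  shows "i = i' \<and> j = j'"
proof -
  have "h i ! j \<in> set (h i) \<inter> set (h i')"
    using good_nth_mem[of i j] good_nth_mem[of i' j'] assms(1-4) unfolding assms(5) by simp
  hence "i = i'" using good_disjoint[OF assms(1,2)] by blast
  moreover have "j = j'"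
    using nth_eq_iff_index_eq[OF good_row(2)[OF assms(1)], of j j'] good_row(3)[OF assms(1)] assms(3-5)
    unfolding \<open>i = i'\<close> by simp
  ultimately show ?thesis by simp
qed

lemma good_entry_ne: "0 < i \<Longrightarrow> i < k \<Longrightarrow> j < k \<Longrightarrow> h i ! j \<noteq> a"
  using h good_nth_mem[of i j] by (auto simp: good_configs_def)

lemma good_column_distinct: assumes "j < k" shows "distinct (switch_column k a h j)"
  unfolding distinct_conv_nth
proof (intro allI impI)
  fix i i' assume "i < length (switch_column k a h j)" "i' < length (switch_column k a h j)" "i \<noteq> i'"
  hence i: "i < k" "i' < k" "i \<noteq> i'" using k by auto
  have "h i ! j \<noteq> h i' ! j" using good_entry_inj[OF i(1,2) assms assms] i(3) by blast
  moreover have "h i ! j \<noteq> a" if "0 < i" using good_entry_ne[OF that i(1) assms] .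
  moreover have "h i' ! j \<noteq> a" if "0 < i'" using good_entry_ne[OF that i(2) assms] .
  ultimately show "switch_column k a h j ! i \<noteq> switch_column k a h j ! i'"
    using i by (auto simp: nth_switch_column)
qed

lemma good_column_notin: "j < k \<Longrightarrow> set (switch_column k a h j) \<notin> F \<union> X"
  using h by (simp add: good_configs_def)

lemma good_column_kset: assumes "j < k" shows "set (switch_column k a h j) \<in> ksets k n"
proof -
  have "card (set (switch_column k a h j)) = k"
    using distinct_card[OF good_column_distinct[OF assms]] k by simp
  moreover have "x \<in> {1..n}" if x: "x \<in> set (switch_column k a h j)" for x
  proof -
    obtain i where i: "i < k" "x = switch_column k a h j ! i"
      using x k by (auto simp: in_set_conv_nth)
    have "set (h i) \<subseteq> {1..n}" using good_row(1)[OF i(1)] F by (auto simp: ksets_def)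
    hence "h i ! j \<in> {1..n}" using good_nth_mem[OF i(1) assms] by blast
    thus ?thesis using i a by (simp add: nth_switch_column del: atLeastAtMost_iff)
  qed
  ultimately show ?thesis by (auto simp: ksets_def)
qed

lemma row_sets_inj: "inj_on (\<lambda>i. set (h i)) {..<k}"
proof (rule inj_onI)
  fix i i' assume *: "i \<in> {..<k}" "i' \<in> {..<k}" "set (h i) = set (h i')"
  show "i = i'"
  proof (rule ccontr)
    assume "i \<noteq> i'"
    hence "set (h i) = {}" using good_disjoint[of i i'] * by auto
    thus False using good_nth_mem[of i 0] * k by auto
  qed
qed

text \<open>Entry 1 identifies the column: row 1 exists since \<open>k \<ge> 2\<close>, keeps its
  entries and avoids \<open>a\<close>. The top entries would not do, because \<open>a\<close> may
  also occur in row 0.\<close>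

lemma column_sets_inj: "inj_on (\<lambda>j. set (switch_column k a h j)) {..<k}"
proof (rule inj_onI)
  fix j j' assume *: "j \<in> {..<k}" "j' \<in> {..<k}" "set (switch_column k a h j) = set (switch_column k a h j')"
  have "switch_column k a h j ! 1 \<in> set (switch_column k a h j')"
    using * k by (metis length_switch_column nth_mem One_nat_def Suc_1 Suc_le_lessD Suc_leD)
  then obtain i where i: "i < k" "switch_column k a h j ! 1 = switch_column k a h j' ! i"
    using k by (auto simp: in_set_conv_nth)
  have 1: "switch_column k a h j ! 1 = h 1 ! j" using k by (subst nth_switch_column) auto
  have "h 1 ! j \<noteq> a" using good_entry_ne[of 1 j] * k by auto
  hence "h 1 ! j = h i ! j'" using i 1 by (auto simp: nth_switch_column split: if_splits)
  thus "j = j'" using good_entry_inj[of 1 i j j'] * i k by auto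
qed

lemma sum_of_bool_nth:
  assumes "distinct xs" "length xs = l"
  shows "of_bool (u \<in> set xs) = (\<Sum>j<l. of_bool (xs ! j = u) :: nat)"
proof (cases "u \<in> set xs")
  case True
  then obtain j where j: "j < l" "xs ! j = u" using assms by (auto simp: in_set_conv_nth)
  have "(\<Sum>j'<l. of_bool (xs ! j' = u)) = (\<Sum>j'<l. of_bool (j' = j) :: nat)"
    by (rule sum.cong[OF refl]) (use j assms in \<open>auto simp: nth_eq_iff_index_eq\<close>)
  thus ?thesis using True j by (simp add: of_bool_def)
next
  case False
  hence "(\<Sum>j<l. of_bool (xs ! j = u)) = (\<Sum>j<l. 0 :: nat)"
    using assms by (intro sum.cong) auto
  thus ?thesis using False by simp
qed

lemma hdegree_image:
  fixes l :: nat assumes "inj_on f {..<l}"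
  shows "hdegree (f ` {..<l}) u = (\<Sum>i<l. of_bool (u \<in> f i))"
  unfolding hdegree_sum[OF finite_imageI[OF finite_lessThan]] sum.reindex[OF assms] o_def ..

text \<open>Rows and columns run over the same cells, except that \<open>a\<close> replaces
  \<open>v\<close> in the corner. No row and no column repeats a vertex, and distinct indices give
  distinct sets, so degrees can be counted by cells, even if \<open>a\<close> occurs in row 0 as
  well.\<close>

lemma switch_degree: "hdegree (switch k F a h) u + of_bool (u = v) = hdegree F u + of_bool (u = a)"
proof -
  let ?R = "(\<lambda>i. set (h i)) ` {..<k}" and ?C = "(\<lambda>j. set (switch_column k a h j)) ` {..<k}"
  have sub: "?R \<subseteq> F" using good_row by auto
  have dis: "(F - ?R) \<inter> ?C = {}" using good_column_notin by auto
  have dF: "hdegree F u = hdegree (F - ?R) u + hdegree ?R u"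
    using hdegree_Un_disjoint[of "F - ?R" ?R u] sub good_config_finite by (simp add: Un_absorb2 Diff_Int_distrib2)
  have dF': "hdegree (switch k F a h) u = hdegree (F - ?R) u + hdegree ?C u"
    unfolding switch_def using dis good_config_finite by (intro hdegree_Un_disjoint) auto
  have dR: "hdegree ?R u = (\<Sum>i<k. \<Sum>j<k. of_bool (h i ! j = u))"
    unfolding hdegree_image[OF row_sets_inj]
    by (rule sum.cong[OF refl], rule sum_of_bool_nth) (auto simp: good_row)
  have "hdegree ?C u = (\<Sum>j<k. \<Sum>i<k. of_bool (switch_column k a h j ! i = u))"
    unfolding hdegree_image[OF column_sets_inj]
    by (rule sum.cong[OF refl], rule sum_of_bool_nth) (use k in \<open>auto simp: good_column_distinct\<close>)
  also have "\<dots> = (\<Sum>i<k. \<Sum>j<k. of_bool (switch_column k a h j ! i = u))" by (rule sum.swap)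
  finally have dC: "hdegree ?C u = \<dots>" .
  have "0 < k" using k by simp
  have row: "(\<Sum>j<k. of_bool (switch_column k a h j ! i = u)) + of_bool (i = 0 \<and> u = v)
      = (\<Sum>j<k. of_bool (h i ! j = u) :: nat) + of_bool (i = 0 \<and> u = a)" if "i < k" for i
  proof (cases "i = 0")
    case True
    have "(\<Sum>j<k. of_bool (switch_column k a h j ! 0 = u)) = of_bool (a = u) + (\<Sum>j\<in>{..<k}-{0}. of_bool (h 0 ! j = u) :: nat)"
      using \<open>0 < k\<close> by (subst sum.remove[of _ 0]) (auto intro!: sum.cong)
    moreover have "(\<Sum>j<k. of_bool (h 0 ! j = u)) = of_bool (v = u) + (\<Sum>j\<in>{..<k}-{0}. of_bool (h 0 ! j = u) :: nat)"
      using \<open>0 < k\<close> good_corner by (subst sum.remove[of _ 0]) auto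
    ultimately show ?thesis using True by (auto simp: eq_commute[of u])
  next
    case False
    thus ?thesis using that by (simp add: nth_switch_column)
  qed
  have "(\<Sum>i<k. (\<Sum>j<k. of_bool (switch_column k a h j ! i = u)) + of_bool (i = 0 \<and> u = v))
      = (\<Sum>i<k. (\<Sum>j<k. of_bool (h i ! j = u) :: nat) + of_bool (i = 0 \<and> u = a))"
    by (rule sum.cong[OF refl]) (use row in auto)
  moreover have "(\<Sum>i<k. of_bool (i = 0 \<and> u = w) :: nat) = of_bool (u = w)" for w
    using \<open>0 < k\<close> by (subst sum.remove[of _ 0]) auto
  ultimately have "hdegree ?C u + of_bool (u = v) = hdegree ?R u + of_bool (u = a)"
    unfolding dC dR sum.distrib by simp
  thus ?thesis using dF dF' by simp
qed

lemma switch_subset: assumes "F \<subseteq> ksets k n - X" shows "switch k F a h \<subseteq> ksets k n - X"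
  using assms good_column_kset good_column_notin unfolding switch_def by blast

lemma switch_inverse: "(switch k F a h - (\<lambda>j. set (switch_column k a h j)) ` {..<k}) \<union> (\<lambda>i. set (h i)) ` {..<k} = F"
proof -
  have "(\<lambda>i. set (h i)) ` {..<k} \<subseteq> F" using good_row by auto
  moreover have "(\<lambda>j. set (switch_column k a h j)) ` {..<k} \<inter> F = {}" using good_column_notin by auto
  ultimately show ?thesis unfolding switch_def by blast
qed

lemma switch_column_switch_column: assumes "i < k" shows "switch_column k v (\<lambda>j\<in>{..<k}. switch_column k a h j) i = h i"
proof (rule nth_equalityI)
  show "length (switch_column k v (\<lambda>j\<in>{..<k}. switch_column k a h j) i) = length (h i)"
    using assms k good_row by simp
  fix j assume "j < length (switch_column k v (\<lambda>j\<in>{..<k}. switch_column k a h j) i)"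
  hence "j < k" using k by simp
  thus "switch_column k v (\<lambda>j\<in>{..<k}. switch_column k a h j) i ! j = h i ! j"
    using assms good_corner by (auto simp: nth_switch_column)
qed

lemma switch_config: "(\<lambda>j\<in>{..<k}. switch_column k a h j) \<in> configs k (switch k F a h) a"
  unfolding configs_def using k
  by (auto simp: mem_ordered_edges good_column_distinct switch_def)

end

text \<open>Transposing the columns and restoring \<open>v\<close> in the corner gives back the
  rows; exchanging columns for rows then gives back the graph, as the rows were all in it and the
  columns were not.\<close>

lemma switch_inj:
  assumes "F \<subseteq> ksets k n" "F' \<subseteq> ksets k n" "k \<ge> 2" "a \<in> {1..n}" "v \<in> {1..n}"
    "h \<in> good_configs k F X v a" "h' \<in> good_configs k F' X v a"
    "switch k F a h = switch k F' a h'" "(\<lambda>j\<in>{..<k}. switch_column k a h j) = (\<lambda>j\<in>{..<k}. switch_column k a h' j)"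
  shows "F = F' \<and> h = h'"
proof -
  have rows: "h i = h' i" if "i < k" for i
    using switch_column_switch_column[OF assms(1,3,4,5,6) that] switch_column_switch_column[OF assms(2,3,4,5,7) that] assms(9) by simp
  have "h = h'"
    by (rule PiE_ext[of _ "{..<k}" "\<lambda>_. UNIV"]) (use assms(6,7) rows in \<open>auto simp: good_configs_def configs_def PiE_def\<close>)
  moreover have "F = F'"
    using switch_inverse[OF assms(1,3,4,5,6)] switch_inverse[OF assms(2,3,4,5,7)]
    unfolding \<open>h = h'\<close> assms(8)[unfolded \<open>h = h'\<close>] by (rule trans[OF sym])
  ultimately show ?thesis by blast
qed

text \<open>Double counting along the injection that sends a graph with a good array to the switched
  graph with the transposed array, whose corner is \<open>a\<close>. The image need not be good,
  hence all of \<open>configs\<close> on the right.\<close>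

lemma sum_good_configs_le:
  assumes "k \<ge> 2" "a \<in> {1..n}" "v \<in> {1..n}" "a \<noteq> v"
    and s': "\<And>u. s' u + of_bool (u = v) = s u + of_bool (u = a)"
  shows "(\<Sum>F\<in>dgraphs n (ksets k n - X) s. card (good_configs k F X v a))
      \<le> (\<Sum>F\<in>dgraphs n (ksets k n - X) s'. card (configs k F a))"
proof -
  let ?D = "dgraphs n (ksets k n - X)"
  have D: "F \<subseteq> ksets k n" "finite F" if "F \<in> ?D s" for F s
    using that finite_subset[of F "ksets k n"] by (auto simp: dgraphs_def)
  have finD: "finite (?D s)" for s
    by (rule finite_subset[of _ "Pow (ksets k n)"]) (auto simp: dgraphs_def)
  have fg: "finite (good_configs k F X v a)" if "finite F" for F
    using finite_configs[OF that] by (simp add: good_configs_def)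
  let ?f = "\<lambda>(F, h). (switch k F a h, \<lambda>j\<in>{..<k}. switch_column k a h j)"
  have "inj_on ?f (SIGMA F : ?D s. good_configs k F X v a)"
  proof (rule inj_onI, clarify)
    fix F h F' h' assume "F \<in> ?D s" "h \<in> good_configs k F X v a" "F' \<in> ?D s" "h' \<in> good_configs k F' X v a"
      "switch k F a h = switch k F' a h'"
      "(\<lambda>j\<in>{..<k}. switch_column k a h j) = (\<lambda>j\<in>{..<k}. switch_column k a h' j)"
    with D(1) assms(1,2,3) show "F = F' \<and> h = h'" by (intro switch_inj[of F k n F' a v h X h'])
  qed
  moreover have "?f ` (SIGMA F : ?D s. good_configs k F X v a) \<subseteq> (SIGMA F : ?D s'. configs k F a)"
  proof safe
    fix F h assume F: "F \<in> ?D s" and h: "h \<in> good_configs k F X v a"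
    note * = D(1)[OF F] assms(1,2,3) h
    have "switch k F a h \<subseteq> ksets k n - X"
      using F by (intro switch_subset[OF *]) (auto simp: dgraphs_def)
    moreover have "hdegree (switch k F a h) u = s' u" if "u \<in> {1..n}" for u
      using switch_degree[OF *, of u] s'[of u] F that by (auto simp: dgraphs_def)
    ultimately show "switch k F a h \<in> ?D s'" by (auto simp: dgraphs_def)
    show "(\<lambda>j\<in>{..<k}. switch_column k a h j) \<in> configs k (switch k F a h) a"
      by (rule switch_config[OF *])
  qed
  moreover have fc: "\<forall>F\<in>?D s'. finite (configs k F a)"
    by (intro ballI finite_configs D(2))
  moreover have fg: "\<forall>F\<in>?D s. finite (good_configs k F X v a)"
    by (intro ballI fg D(2))
  moreover have "finite (SIGMA F : ?D s'. configs k F a)"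
    using fc by (intro finite_SigmaI finD) blast
  ultimately have "card (SIGMA F : ?D s. good_configs k F X v a) \<le> card (SIGMA F : ?D s'. configs k F a)"
    by (intro card_inj_on_le)
  thus ?thesis unfolding card_SigmaI[OF finD fc] card_SigmaI[OF finD fg] .
qed

section \<open>Most arrays are good\<close>

lemma card_config_event_le:
  assumes F: "F \<subseteq> ksets k n" and i: "i \<in> {1..<k}" and "i' \<noteq> i" and pos: "0 < card F"
    and b: "\<And>x. card (ordered_edges F \<inter> T x) \<le> b * fact k"
  shows "real (card {h \<in> configs k F v. h i \<in> T (h i')}) \<le> real b / real (card F) * real (card (configs k F v))"
proof -
  have fin: "finite F" using F finite_subset by fastforce
  define S where "S = (\<lambda>l::nat. {xs \<in> ordered_edges F. l = 0 \<longrightarrow> xs ! 0 = v})"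
  have Si: "S i = ordered_edges F" using i by (auto simp: S_def)
  have finS: "finite (S l)" for l using finite_ordered_edges[OF fin] by (simp add: S_def)
  let ?P = "\<Prod>l\<in>{..<k} - {i}. card (S l)"
  \<comment> \<open>Row \<open>i\<close> is not row 0, so it ranges over all ordered edges; given
    row \<open>i'\<close>, at most \<open>b * fact k\<close> of them realise the event.\<close>
  have "card {h \<in> PiE {..<k} S. h i \<in> T (h i')} \<le> (b * fact k) * ?P"
  proof (rule card_PiE_dependent_le)
    show "finite {..<k}" "i \<in> {..<k}" "i' \<noteq> i" using i assms(3) by simp_all
    show "finite (S l)" for l by (rule finS)
    show "card (S i \<inter> T x) \<le> b * fact k" for x unfolding Si by (rule b)
  qed
  hence 1: "card {h \<in> configs k F v. h i \<in> T (h i')} \<le> b * fact k * ?P"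
    by (simp add: configs_def S_def)
  have "card (configs k F v) = (\<Prod>l<k. card (S l))" by (simp add: configs_def S_def card_PiE)
  also have "\<dots> = card (S i) * ?P" using i by (intro prod.remove) auto
  also have "\<dots> = card F * fact k * ?P" using card_ordered_edges[OF F] Si by simp
  finally have 2: "card (configs k F v) = card F * fact k * ?P" .
  have "real b / real (card F) * real (card (configs k F v)) = real (b * fact k * ?P)"
    unfolding 2 using pos by simp
  moreover have "real (card {h \<in> configs k F v. h i \<in> T (h i')}) \<le> real (b * fact k * ?P)"
    using 1 by (simp only: of_nat_le_iff)
  ultimately show ?thesis by (simp only:)
qed

text \<open>Row 0 is chosen first and fixes the top vertex of column \<open>j\<close>. At most
  \<open>D * fact (k - 1)\<close> ordered edges start there, and each of them prescribes the vertex
  in position \<open>j\<close> of the \<open>k - 1\<close> other rows, which has chance at most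
  \<open>\<Delta> / (k * card F)\<close> per row. Only degrees enter, since every row is asked for a
  single vertex.\<close>

lemma card_config_column_le:
  assumes F: "F \<subseteq> ksets k n" and X: "X \<subseteq> ksets k n" and k: "k \<ge> 2" and j: "j < k" and pos: "0 < card F"
    and \<Delta>: "\<And>u. hdegree F u \<le> \<Delta>" and D: "\<And>u. hdegree (F \<union> X) u \<le> D"
  shows "real (card {h \<in> configs k F v. set (switch_column k a h j) \<in> F \<union> X})
     \<le> fact (k - 1) * real D * (real \<Delta> / (real k * real (card F))) ^ (k - 1) * real (card (configs k F v))"
proof -
  have FX: "F \<union> X \<subseteq> ksets k n" using F X by blast
  have fin: "finite F" "finite (F \<union> X)" using F X finite_subset[OF _ finite_ksets] by auto
  let ?O = "{xs \<in> ordered_edges F. xs ! 0 = v}"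
  define z where "z = (\<lambda>g. if j = 0 then a else g ! j :: nat)"
  \<comment> \<open>\<open>?Y g\<close> lists the possible contents of column \<open>j\<close> once
    row 0 is \<open>g\<close>; \<open>?P g ys\<close> lists the arrays with that row and that
    column.\<close>
  let ?Y = "\<lambda>g. {ys \<in> ordered_edges (F \<union> X). ys ! 0 = z g}"
  let ?P = "\<lambda>g ys. PiE {..<k} (\<lambda>i. if i = 0 then {g} else {xs \<in> ordered_edges F. xs ! j = ys ! i})"
  have finO: "finite ?O" "\<And>g. finite (?Y g)" using fin by (auto simp: finite_ordered_edges)
  have finP: "finite (?P g ys)" for g ys by (intro finite_PiE) (use fin in \<open>auto simp: finite_ordered_edges\<close>)
  have "{h \<in> configs k F v. set (switch_column k a h j) \<in> F \<union> X} \<subseteq> (\<Union>g\<in>?O. \<Union>ys\<in>?Y g. ?P g ys)"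
  proof
    fix h assume "h \<in> {h \<in> configs k F v. set (switch_column k a h j) \<in> F \<union> X}"
    hence h: "h \<in> configs k F v" and c: "set (switch_column k a h j) \<in> F \<union> X" by auto
    have hi: "h i \<in> {xs \<in> ordered_edges F. i = 0 \<longrightarrow> xs ! 0 = v}" if "i < k" for i
    proof -
      from that have "i \<in> {..<k}" by simp
      with h show ?thesis unfolding configs_def by (rule PiE_mem)
    qed
    have "card (set (switch_column k a h j)) = k" using c FX by (auto simp: ksets_def)
    hence "distinct (switch_column k a h j)" using k by (intro card_distinct) simp
    hence "switch_column k a h j \<in> ?Y (h 0)"
      using c by (simp add: mem_ordered_edges z_def)
    moreover have "h \<in> ?P (h 0) (switch_column k a h j)"
      using h hi by (auto simp: configs_def PiE_iff nth_switch_column)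
    moreover have "h 0 \<in> ?O" using hi[of 0] k by auto
    ultimately show "h \<in> (\<Union>g\<in>?O. \<Union>ys\<in>?Y g. ?P g ys)" by blast
  qed
  hence "card {h \<in> configs k F v. set (switch_column k a h j) \<in> F \<union> X} \<le> card (\<Union>g\<in>?O. \<Union>ys\<in>?Y g. ?P g ys)"
    by (intro card_mono) (use finO finP in auto)
  also have "\<dots> \<le> (\<Sum>g\<in>?O. card (\<Union>ys\<in>?Y g. ?P g ys))" by (rule card_UN_le[OF finO(1)])
  also have "\<dots> \<le> (\<Sum>g\<in>?O. \<Sum>ys\<in>?Y g. card (?P g ys))" by (intro sum_mono card_UN_le finO)
  also have "\<dots> \<le> (\<Sum>g\<in>?O. \<Sum>ys\<in>?Y g. (\<Delta> * fact (k - 1)) ^ (k - 1))"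
  proof (intro sum_mono)
    fix g ys
    have "card (?P g ys) = (\<Prod>i<k. card (if i = 0 then {g} else {xs \<in> ordered_edges F. xs ! j = ys ! i}))"
      by (simp add: card_PiE)
    also have "\<dots> = (\<Prod>i\<in>{1..<k}. card {xs \<in> ordered_edges F. xs ! j = ys ! i})"
      using k by (simp add: prod.remove[of "{..<k}" 0] lessThan_remove0)
    also have "\<dots> \<le> (\<Prod>i\<in>{1..<k}. \<Delta> * fact (k - 1))"
      unfolding card_ordered_edges_nth[OF F j] by (intro prod_mono) (simp add: \<Delta>)
    finally show "card (?P g ys) \<le> (\<Delta> * fact (k - 1)) ^ (k - 1)" by simp
  qed
  also have "\<dots> \<le> (\<Sum>g\<in>?O. D * fact (k - 1) * (\<Delta> * fact (k - 1)) ^ (k - 1))"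
  proof (intro sum_mono)
    fix g
    have "0 < k" using k by simp
    from card_ordered_edges_nth[OF FX this] D
    show "(\<Sum>ys\<in>?Y g. (\<Delta> * fact (k - 1)) ^ (k - 1)) \<le> D * fact (k - 1) * (\<Delta> * fact (k - 1)) ^ (k - 1)"
      by (simp add: mult_le_mono)
  qed
  also have "\<dots> = hdegree F v * fact (k - 1) * (D * fact (k - 1) * (\<Delta> * fact (k - 1)) ^ (k - 1))"
    using card_ordered_edges_nth[OF F, of 0 v] k by simp
  finally have "real (card {h \<in> configs k F v. set (switch_column k a h j) \<in> F \<union> X}) \<le>
     real (hdegree F v * fact (k - 1) * (D * fact (k - 1) * (\<Delta> * fact (k - 1)) ^ (k - 1)))"
    by (simp only: of_nat_le_iff)
  also have "\<dots> = fact (k - 1) * real D * (real \<Delta> / (real k * real (card F))) ^ (k - 1) * real (card (configs k F v))"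
  proof -
    have "fact k = real k * fact (k - 1)" using k by (simp add: fact_reduce)
    hence "real \<Delta> * fact (k - 1) = real \<Delta> / (real k * real (card F)) * (real (card F) * fact k)"
      using k pos by simp
    hence "(real \<Delta> * fact (k - 1)) ^ (k - 1)
        = (real \<Delta> / (real k * real (card F))) ^ (k - 1) * (real (card F) * fact k) ^ (k - 1)"
      by (simp only: power_mult_distrib)
    moreover have "k \<ge> 1" using k by simp
    ultimately show ?thesis by (simp only: card_configs[OF F \<open>k \<ge> 1\<close>] of_nat_mult of_nat_power of_nat_fact mult_ac)
  qed
  finally show ?thesis .
qed

text \<open>Union bound, with \<open>q\<close> bounding the chance that a given position of a random
  row holds a given vertex. Fewer than k^2 pairs of rows meet with chance at most k^2 q each, and
  fewer than k rows contain \<open>a\<close> with chance at most k q each; both totals are rounded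
  up to k^4 q. The k columns contribute the last summand.\<close>

lemma card_good_configs_ge:
  assumes F: "F \<subseteq> ksets k n" and X: "X \<subseteq> ksets k n" and k: "k \<ge> 2" and pos: "0 < card F"
    and \<Delta>: "\<And>u. hdegree F u \<le> \<Delta>" and D: "\<And>u. hdegree (F \<union> X) u \<le> D"
  defines "q \<equiv> real \<Delta> / (real k * real (card F))"
  shows "(1 - (2 * real k ^ 4 * q + fact k * real D * q ^ (k - 1))) * real (card (configs k F v))
     \<le> real (card (good_configs k F X v a))"
proof -
  let ?C = "configs k F v"
  have fin: "finite F" using F finite_subset by fastforce
  note finC = finite_configs[OF fin, of k v]
  \<comment> \<open>The length condition is part of the event because the bound of
    \<open>card_config_event_le\<close> is required for every list in place of row
    \<open>i'\<close>, including lists of other lengths.\<close>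
  define E1 where "E1 = (\<lambda>i i'. {h \<in> ?C. h i \<in> {xs. length (h i') = k \<and> set xs \<inter> set (h i') \<noteq> {}}})"
  define E2 where "E2 = (\<lambda>i. {h \<in> ?C. h i \<in> {xs. a \<in> set xs}})"
  define E3 where "E3 = (\<lambda>j. {h \<in> ?C. set (switch_column k a h j) \<in> F \<union> X})"
  let ?U1 = "\<Union>i\<in>{1..<k}. \<Union>i'\<in>{..<k} - {i}. E1 i i'" and ?U2 = "\<Union>i\<in>{1..<k}. E2 i" and ?U3 = "\<Union>j<k. E3 j"
  have cover: "?C \<subseteq> good_configs k F X v a \<union> (?U1 \<union> ?U2 \<union> ?U3)"
  proof
    fix h assume h: "h \<in> ?C"
    have len: "length (h i) = k" if "i < k" for i
    proof -
      have "h i \<in> ordered_edges F"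
      proof -
        from that have "i \<in> {..<k}" by simp
        from PiE_mem[OF h[unfolded configs_def] this] show ?thesis by simp
      qed
      thus ?thesis using F by (auto simp: mem_ordered_edges ksets_def distinct_card)
    qed
    show "h \<in> good_configs k F X v a \<union> (?U1 \<union> ?U2 \<union> ?U3)"
    proof (rule ccontr)
      assume neg: "h \<notin> good_configs k F X v a \<union> (?U1 \<union> ?U2 \<union> ?U3)"
      \<comment> \<open>\<open>E1\<close> is bounded only for \<open>i > 0\<close>, where row
        \<open>i\<close> is unrestricted. A pair with \<open>i = 0\<close> follows by
        symmetry.\<close>
      have d: "set (h i) \<inter> set (h i') = {}" if "i < k" "i' < k" "i \<noteq> i'" "0 < i" for i i'
        using neg that h len[of i'] by (auto simp: E1_def)
      have "set (h i) \<inter> set (h i') = {}" if "i < k" "i' < k" "i \<noteq> i'" for i i'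
      proof (cases "0 < i")
        case True thus ?thesis using d that by blast
      next
        case False
        hence "0 < i'" using that by simp
        thus ?thesis using d[of i' i] that by blast
      qed
      moreover have "a \<notin> set (h i)" if "i < k" "0 < i" for i
        using neg that h by (auto simp: E2_def)
      moreover have "set (switch_column k a h j) \<notin> F \<union> X" if "j < k" for j
        using neg that h by (auto simp: E3_def)
      ultimately have "h \<in> good_configs k F X v a" using h unfolding good_configs_def by simp
      thus False using neg by blast
    qed
  qed
  have fE: "finite (E1 i i')" "finite (E2 i)" "finite (E3 i)" for i i'
    using finC by (auto simp: E1_def E2_def E3_def)
  have fG: "finite (good_configs k F X v a)" using finC by (simp add: good_configs_def)
  have "card ?C \<le> card (good_configs k F X v a \<union> (?U1 \<union> ?U2 \<union> ?U3))"
    by (rule card_mono[OF _ cover]) (use fE fG in auto)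
  also have "\<dots> \<le> card (good_configs k F X v a) + (card ?U1 + card ?U2 + card ?U3)"
    by (meson add_left_mono add_right_mono card_Un_le order_trans)
  finally have main: "real (card ?C) \<le> real (card (good_configs k F X v a)) + (real (card ?U1) + real (card ?U2) + real (card ?U3))"
    by linarith
  let ?c = "real (card ?C)"
  have q: "q \<ge> 0" by (simp add: q_def)
  have kq: "real \<Delta> / real (card F) = real k * q" using k by (simp add: q_def)
  have e1: "real (card (E1 i i')) \<le> real k ^ 2 * q * ?c" if "i \<in> {1..<k}" "i' \<noteq> i" for i i'
  proof -
    have "real (card (E1 i i')) \<le> real (k * \<Delta>) / real (card F) * ?c"
      unfolding E1_def
    proof (rule card_config_event_le[OF F that pos, where T = "\<lambda>x. {xs. length x = k \<and> set xs \<inter> set x \<noteq> {}}"])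
      fix x :: "nat list"
      show "card (ordered_edges F \<inter> {xs. length x = k \<and> set xs \<inter> set x \<noteq> {}}) \<le> k * \<Delta> * fact k"
      proof (cases "length x = k")
        case True
        have "card {xs \<in> ordered_edges F. set xs \<inter> set x \<noteq> {}} \<le> card (set x) * \<Delta> * fact k"
          by (rule card_ordered_edges_meet[OF F]) (auto simp: \<Delta>)
        also have "\<dots> \<le> k * \<Delta> * fact k" using card_length[of x] True by (intro mult_le_mono) auto
        finally show ?thesis using True by (simp add: Int_def)
      qed simp
    qed
    also have "real (k * \<Delta>) / real (card F) = real k ^ 2 * q" using arg_cong[OF kq, of "\<lambda>x. real k * x"] by (simp add: power2_eq_square)
    finally show ?thesis .
  qed
  have e2: "real (card (E2 i)) \<le> real k * q * ?c" if "i \<in> {1..<k}" for i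
  proof -
    have "real (card (E2 i)) \<le> real \<Delta> / real (card F) * ?c"
      unfolding E2_def
    proof (rule card_config_event_le[OF F that _ pos, where T = "\<lambda>x. {xs. a \<in> set xs}" and i' = 0])
      have "card {xs \<in> ordered_edges F. set xs \<inter> {a} \<noteq> {}} \<le> card {a} * \<Delta> * fact k"
        by (rule card_ordered_edges_meet[OF F]) (auto simp: \<Delta>)
      thus "card (ordered_edges F \<inter> {xs. a \<in> set xs}) \<le> \<Delta> * fact k" by (simp add: Int_def)
    qed (use that in auto)
    thus ?thesis unfolding kq .
  qed
  have e3: "real (card (E3 j)) \<le> fact (k - 1) * real D * q ^ (k - 1) * ?c" if "j < k" for j
    unfolding E3_def q_def by (rule card_config_column_le[OF F X k that pos \<Delta> D])
  have cU: "real (card (\<Union>i\<in>I. f i)) \<le> real (card I) * b" if "finite I" "\<And>i. i \<in> I \<Longrightarrow> real (card (f i)) \<le> b"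
    for I :: "nat set" and f :: "nat \<Rightarrow> (nat \<Rightarrow> nat list) set" and b
  proof -
    have "real (card (\<Union>i\<in>I. f i)) \<le> (\<Sum>i\<in>I. real (card (f i)))"
      using card_UN_le[OF that(1), of f] by (simp flip: of_nat_sum)
    also have "\<dots> \<le> real (card I) * b" using that(2) by (rule sum_bounded_above)
    finally show ?thesis .
  qed
  have n1: "real k ^ 2 * q * ?c \<ge> 0" "real k * q * ?c \<ge> 0" using q by auto
  have "real (card ?U1) \<le> real (card {1..<k}) * (real k * (real k ^ 2 * q * ?c))"
  proof (rule cU)
    fix i assume i: "i \<in> {1..<k}"
    have "real (card (\<Union>i'\<in>{..<k} - {i}. E1 i i')) \<le> real (card ({..<k} - {i})) * (real k ^ 2 * q * ?c)"
      by (rule cU) (use e1[OF i] in auto)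
    also have "\<dots> \<le> real k * (real k ^ 2 * q * ?c)"
      using i by (intro mult_right_mono n1) (auto simp: card_Diff_singleton)
    finally show "real (card (\<Union>i'\<in>{..<k} - {i}. E1 i i')) \<le> real k * (real k ^ 2 * q * ?c)" .
  qed simp
  also have "\<dots> \<le> real k * (real k * (real k ^ 2 * q * ?c))"
    using n1 q by (intro mult_right_mono mult_nonneg_nonneg) auto
  finally have u1: "real (card ?U1) \<le> real k ^ 4 * q * ?c" by (simp add: power_numeral_reduce mult_ac)
  have "real (card ?U2) \<le> real (card {1..<k}) * (real k * q * ?c)"
    by (rule cU) (use e2 in auto)
  also have "\<dots> \<le> real k ^ 3 * (real k * q * ?c)"
  proof (rule mult_right_mono[OF _ n1(2)])
    have "real (card {1..<k}) \<le> real k ^ 1" by simp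
    also have "\<dots> \<le> real k ^ 3" using k by (intro power_increasing) auto
    finally show "real (card {1..<k}) \<le> real k ^ 3" .
  qed
  finally have u2: "real (card ?U2) \<le> real k ^ 4 * q * ?c" by (simp add: power_numeral_reduce mult_ac)
  have "real (card ?U3) \<le> real (card {..<k}) * (fact (k - 1) * real D * q ^ (k - 1) * ?c)"
    by (rule cU) (use e3 in auto)
  also have "\<dots> = fact k * real D * q ^ (k - 1) * ?c" using k by (simp add: fact_reduce)
  finally have u3: "real (card ?U3) \<le> fact k * real D * q ^ (k - 1) * ?c" .
  show ?thesis using main u1 u2 u3 by (simp add: algebra_simps)
qed

text \<open>Both degree sequences have the same sum, so all graphs involved have the same number
  \<open>m\<close> of edges. The number of arrays is then the degree at the corner times a common
  factor \<open>c\<close>, which cancels from the double count. The lower bound \<open>L\<close> on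
  degrees gives \<open>k * m \<ge> n * L\<close>, which turns the hypothesis on \<open>q\<close>
  into a bound for the chance of hitting a vertex.\<close>

lemma dgraphs_switch_le:
  assumes k: "k \<ge> 2" and a: "a \<in> {1..n}" and v: "v \<in> {1..n}" and av: "a \<noteq> v" and X: "X \<subseteq> ksets k n"
    and s': "\<And>u. s' u + of_bool (u = v) = s u + of_bool (u = a)"
    and L: "0 < L" "\<And>u. u \<in> {1..n} \<Longrightarrow> L \<le> real (s u)"
    and U: "\<And>u. u \<in> {1..n} \<Longrightarrow> s u \<le> \<Delta>"
    and D: "\<And>u. u \<in> {1..n} \<Longrightarrow> s u + hdegree X u \<le> D"
    and q: "real \<Delta> / (real n * L) \<le> q"
  shows "(1 - (2 * real k ^ 4 * q + fact k * real D * q ^ (k - 1))) * L * real (card (dgraphs n (ksets k n - X) s))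
     \<le> real (s' a) * real (card (dgraphs n (ksets k n - X) s'))"
proof -
  let ?D = "dgraphs n (ksets k n - X)"
  define \<epsilon> where "\<epsilon> = 2 * real k ^ 4 * q + fact k * real D * q ^ (k - 1)"
  define m where "m = (\<Sum>u\<in>{1..n}. s u) div k"
  have n: "n > 0" using a by auto
  have kpos: "k > 0" using k by simp
  have sums: "(\<Sum>u\<in>{1..n}. s' u) = (\<Sum>u\<in>{1..n}. s u)"
  proof -
    have "(\<Sum>u\<in>{1..n}. s' u + of_bool (u = v)) = (\<Sum>u\<in>{1..n}. s u + of_bool (u = a))"
      by (simp only: s')
    moreover have "(\<Sum>u\<in>{1..n}. of_bool (u = w) :: nat) = 1" if "w \<in> {1..n}" for w
      using that by (subst sum.remove[of _ w]) auto
    ultimately show ?thesis using a v unfolding sum.distrib by simp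
  qed
  have cardF: "card F = m" "k * m = (\<Sum>u\<in>{1..n}. s u)" if "F \<in> ?D s \<or> F \<in> ?D s'" for F
  proof -
    have "F \<subseteq> ksets k n" using that by (auto simp: dgraphs_def)
    from handshake[OF this] have "(\<Sum>u\<in>{1..n}. s u) = k * card F"
      using that sums by (auto simp: dgraphs_def)
    thus "card F = m" "k * m = (\<Sum>u\<in>{1..n}. s u)" using kpos by (auto simp: m_def)
  qed
  show ?thesis
  proof (cases "?D s = {}")
    case True
    thus ?thesis by simp
  next
    case False
    then obtain F0 where F0: "F0 \<in> ?D s" by blast
    have km: "real n * L \<le> real k * real m"
    proof -
      have "real n * L = (\<Sum>u\<in>{1..n}. L)" by simp
      also have "\<dots> \<le> (\<Sum>u\<in>{1..n}. real (s u))" by (rule sum_mono) (rule L)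
      also have "\<dots> = real (k * m)" using cardF(2)[of F0] F0 by simp
      finally show ?thesis by simp
    qed
    have "0 < real n * L" using n L by simp
    hence m: "m > 0" using km by (cases m) auto
    define c where "c = fact (k - 1) * (real m * fact k) ^ (k - 1)"
    have c: "c > 0" using m by (simp add: c_def)
    have lower: "(1 - \<epsilon>) * (L * c) \<le> real (card (good_configs k F X v a))" if F: "F \<in> ?D s" for F
    proof -
      have Fs: "F \<subseteq> ksets k n" "F \<inter> X = {}" using F by (auto simp: dgraphs_def)
      have fin: "finite F" "finite X" using Fs X finite_subset[OF _ finite_ksets] by auto
      \<comment> \<open>The degree bounds must hold at every natural number, also outside the vertex
        set.\<close>
      have out: "hdegree G u = 0" if "G \<subseteq> ksets k n" "u \<notin> {1..n}" for G u
      proof -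
        have "u \<notin> e" if "e \<in> G" for e
        proof -
          have "e \<subseteq> {1..n}" using that \<open>G \<subseteq> ksets k n\<close> by (auto simp: ksets_def)
          thus ?thesis using \<open>u \<notin> {1..n}\<close> by blast
        qed
        hence "{e \<in> G. u \<in> e} = {}" by blast
        thus ?thesis by (simp only: hdegree_def card.empty)
      qed
      have d1: "hdegree F u \<le> \<Delta>" for u
        using F U[of u] out[OF Fs(1), of u] by (cases "u \<in> {1..n}") (auto simp: dgraphs_def)
      have d2: "hdegree (F \<union> X) u \<le> D" for u
        using F D[of u] out[of "F \<union> X" u] Fs X hdegree_Un_le[OF fin, of u]
        by (cases "u \<in> {1..n}") (auto simp: dgraphs_def)
      let ?q = "real \<Delta> / (real k * real (card F))"
      have "?q \<le> real \<Delta> / (real n * L)"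
        using km cardF(1)[of F] F \<open>0 < real n * L\<close> by (intro divide_left_mono) auto
      hence q': "?q \<le> q" "0 \<le> ?q" using q by auto
      have conf: "real (card (configs k F v)) = real (s v) * c"
        using card_configs[OF Fs(1), of v] k F v cardF(1)[of F] by (simp add: dgraphs_def c_def)
      have g: "(1 - (2 * real k ^ 4 * ?q + fact k * real D * ?q ^ (k - 1))) * real (card (configs k F v))
          \<le> real (card (good_configs k F X v a))"
        by (rule card_good_configs_ge[OF Fs(1) X k _ d1 d2]) (use cardF(1)[of F] F m in auto)
      show ?thesis
      proof (cases "\<epsilon> \<le> 1")
        case True
        have "(1 - \<epsilon>) * (L * c) \<le> (1 - \<epsilon>) * (real (s v) * c)"
          using True c L(2)[OF v] by (intro mult_left_mono mult_right_mono) auto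
        also have "\<dots> \<le> (1 - (2 * real k ^ 4 * ?q + fact k * real D * ?q ^ (k - 1))) * (real (s v) * c)"
        proof (rule mult_right_mono)
          show "1 - \<epsilon> \<le> 1 - (2 * real k ^ 4 * ?q + fact k * real D * ?q ^ (k - 1))"
            unfolding \<epsilon>_def using q' by (intro diff_left_mono add_mono mult_left_mono power_mono) auto
        qed (use c in auto)
        finally show ?thesis using g conf by simp
      next
        case False
        hence "(1 - \<epsilon>) * (L * c) \<le> 0" using L c by (intro mult_nonpos_nonneg) auto
        thus ?thesis by linarith
      qed
    qed
    have "(1 - \<epsilon>) * (L * c) * real (card (?D s)) = (\<Sum>F\<in>?D s. (1 - \<epsilon>) * (L * c))" by simp
    also have "\<dots> \<le> (\<Sum>F\<in>?D s. real (card (good_configs k F X v a)))"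
      by (rule sum_mono) (rule lower)
    also have "\<dots> \<le> (\<Sum>F\<in>?D s'. real (card (configs k F a)))"
      using sum_good_configs_le[OF k a v av, of s' s X] s' by (simp flip: of_nat_sum)
    also have "\<dots> = (\<Sum>F\<in>?D s'. real (s' a) * c)"
    proof (rule sum.cong[OF refl])
      fix F assume F: "F \<in> ?D s'"
      hence "F \<subseteq> ksets k n" by (auto simp: dgraphs_def)
      from card_configs[OF this, of a] show "real (card (configs k F a)) = real (s' a) * c"
        using k F a cardF(1)[of F] by (simp add: dgraphs_def c_def)
    qed
    finally have "c * ((1 - \<epsilon>) * L * real (card (?D s))) \<le> c * (real (s' a) * real (card (?D s')))"
      by (simp add: mult_ac)
    thus ?thesis using c unfolding \<epsilon>_def by simp
  qed
qed

section \<open>Extensions of a revealed edge set\<close>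

definition extensions :: "'a set set \<Rightarrow> 'a set \<Rightarrow> 'a set set" where
  "extensions \<F> B = {R \<in> \<F>. B \<subseteq> R}"

lemma sum_UN_le:
  fixes g :: "'a \<Rightarrow> real"
  assumes "finite I" "\<And>i. i \<in> I \<Longrightarrow> finite (A i)" "\<And>x. g x \<ge> 0"
  shows "sum g (\<Union>i\<in>I. A i) \<le> (\<Sum>i\<in>I. sum g (A i))"
  using assms(1,2)
proof (induction I rule: finite_induct)
  case (insert i I)
  have "sum g (A i \<union> (\<Union>i\<in>I. A i)) \<le> sum g (A i) + sum g (\<Union>i\<in>I. A i)"
    using insert sum.union_inter[of "A i" "\<Union>i\<in>I. A i" g] sum_nonneg[of "A i \<inter> (\<Union>i\<in>I. A i)" g] assms(3)
    by auto
  thus ?case using insert by auto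
qed simp

lemma sum_extensions:
  assumes "finite \<F>" "finite A"
  shows "(\<Sum>f\<in>A. card (extensions \<F> (insert f B))) = (\<Sum>R\<in>extensions \<F> B. card (A \<inter> R))"
proof -
  have fin: "finite (extensions \<F> B)" using assms by (simp add: extensions_def)
  have "(\<Sum>f\<in>A. card (extensions \<F> (insert f B))) = (\<Sum>f\<in>A. \<Sum>R\<in>extensions \<F> B. of_bool (f \<in> R))"
  proof (rule sum.cong[OF refl])
    fix f
    have "extensions \<F> (insert f B) = extensions \<F> B \<inter> {R. f \<in> R}" by (auto simp: extensions_def)
    thus "card (extensions \<F> (insert f B)) = (\<Sum>R\<in>extensions \<F> B. of_bool (f \<in> R))"
      using fin by simp
  qed
  also have "\<dots> = (\<Sum>R\<in>extensions \<F> B. \<Sum>f\<in>A. of_bool (f \<in> R))" by (rule sum.swap)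
  also have "\<dots> = (\<Sum>R\<in>extensions \<F> B. card (A \<inter> R))"
    by (rule sum.cong) (use assms in \<open>auto simp: Int_def\<close>)
  finally show ?thesis .
qed

lemma finite_regular_kgraphs [simp]: "finite (regular_kgraphs k n d)"
  by (rule finite_subset[of _ "Pow (ksets k n)"]) (auto simp: regular_kgraphs_def kgraphs_def ksets_def)

lemma regular_kgraphs_subset: "R \<in> regular_kgraphs k n d \<Longrightarrow> R \<subseteq> ksets k n"
  by (auto simp: regular_kgraphs_def kgraphs_def ksets_def)

lemma card_regular_kgraph: "R \<in> regular_kgraphs k n d \<Longrightarrow> k * card R = n * d"
  using handshake[OF regular_kgraphs_subset, of R k n d] by (simp add: regular_kgraphs_def)

section \<open>Comparing the numbers of extensions by two edges\<close>

context
  fixes k n d :: nat and B :: "nat set set" and \<Delta> :: nat and L q ratio :: real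
  assumes k: "k \<ge> 2" and B: "B \<subseteq> ksets k n" and d: "d > 0" and L: "L > 0"
    and low: "\<And>u. u \<in> {1..n} \<Longrightarrow> L + 1 \<le> real d - real (hdegree B u)"
    and up: "\<And>u. u \<in> {1..n} \<Longrightarrow> d - hdegree B u \<le> \<Delta>"
    and q: "real \<Delta> / (real n * L) \<le> q"
    and ratio: "ratio = (1 - (2 * real k ^ 4 * q + fact k * real (d + 2) * q ^ (k - 1))) * L / real \<Delta>"
begin

text \<open>The degrees still to be filled after \<open>B\<close> and one more edge
  \<open>Z\<close>. While units are moved, \<open>Z\<close> also takes values between f and e that
  mix vertices of both. The last term lowers a degree by at most 1, which the \<open>+ 1\<close> in
  \<open>low\<close> pays for.\<close>

definition residual :: "nat set \<Rightarrow> nat \<Rightarrow> nat" where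
  "residual Z u = d - hdegree B u - of_bool (u \<in> Z)"

lemma finite_revealed: "finite B" using B finite_subset by fastforce

lemma hdegree_less: "hdegree B u < d"
proof (cases "u \<in> {1..n}")
  case True
  from low[OF this] L show ?thesis by simp
next
  case False
  have "u \<notin> e" if "e \<in> B" for e
  proof -
    have "e \<subseteq> {1..n}" using that B by (auto simp: ksets_def)
    thus ?thesis using False by blast
  qed
  hence "{e \<in> B. u \<in> e} = {}" by blast
  thus ?thesis using d by (simp only: hdegree_def card.empty)
qed

lemma max_residual_pos: "n > 0 \<Longrightarrow> \<Delta> > 0"
proof -
  assume "n > 0"
  hence "1 \<in> {1..n}" by auto
  from low[OF this] up[OF this] L show "\<Delta> > 0" by linarith
qed

lemma residual_move:
  assumes X: "X = insert e (insert f B)" "e \<in> ksets k n" "f \<in> ksets k n"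
    and Z: "a \<in> Z" "v \<notin> Z" "a \<in> {1..n}" "v \<in> {1..n}"
  shows "ratio * real (card (dgraphs n (ksets k n - X) (residual Z)))
     \<le> real (card (dgraphs n (ksets k n - X) (residual (insert v (Z - {a})))))"
proof -
  let ?s = "residual Z" and ?s' = "residual (insert v (Z - {a}))"
  have n: "n > 0" using Z by auto
  \<comment> \<open>Residual degree and degree in \<open>X\<close> together are at most
    \<open>d + 2\<close>, with 2 for e and f; this is the \<open>d + 2\<close> in
    \<open>ratio\<close>.\<close>
  have XX: "hdegree X u \<le> hdegree B u + 2" for u
  proof -
    have "hdegree {e, f} u \<le> card {e, f}" by (rule hdegree_le_card) simp
    also have "\<dots> \<le> 2" by (simp add: card_insert_if)
    finally show ?thesis using hdegree_Un_le[OF finite_revealed, of "{e, f}" u] by (simp add: X)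
  qed
  have "(1 - (2 * real k ^ 4 * q + fact k * real (d + 2) * q ^ (k - 1))) * L * real (card (dgraphs n (ksets k n - X) ?s))
     \<le> real (?s' a) * real (card (dgraphs n (ksets k n - X) ?s'))"
  proof (rule dgraphs_switch_le[OF k Z(3,4) _ _ _ L _ _ _ q])
    show "a \<noteq> v" using Z by auto
    show "X \<subseteq> ksets k n" using X B by auto
    show "?s' u + of_bool (u = v) = ?s u + of_bool (u = a)" for u
      using hdegree_less[of u] Z by (auto simp: residual_def)
    show "L \<le> real (?s u)" if "u \<in> {1..n}" for u
      using low[OF that] hdegree_less[of u] by (simp add: residual_def of_nat_diff)
    show "?s u \<le> \<Delta>" if "u \<in> {1..n}" for u
      using up[OF that] by (simp add: residual_def)
    show "?s u + hdegree X u \<le> d + 2" if "u \<in> {1..n}" for u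
      using XX[of u] hdegree_less[of u] by (simp add: residual_def)
  qed
  also have "\<dots> \<le> real \<Delta> * real (card (dgraphs n (ksets k n - X) ?s'))"
    using up[OF Z(3)] by (intro mult_right_mono) (auto simp: residual_def)
  finally show ?thesis using max_residual_pos[OF n] by (simp add: ratio field_simps)
qed

text \<open>Vertices of \<open>A\<close> are exchanged for those of \<open>V\<close> one at a time.
  The vertices already exchanged are collected in \<open>Z\<close>, which therefore varies in the
  induction.\<close>

lemma residual_moves:
  assumes X: "X = insert e (insert f B)" "e \<in> ksets k n" "f \<in> ksets k n" and "ratio \<ge> 0"
  shows "card A = l \<Longrightarrow> card V = l \<Longrightarrow> finite A \<Longrightarrow> finite V \<Longrightarrow> A \<inter> V = {} \<Longrightarrow> Z \<inter> (A \<union> V) = {} \<Longrightarrow>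
      A \<subseteq> {1..n} \<Longrightarrow> V \<subseteq> {1..n} \<Longrightarrow>
      ratio ^ l * real (card (dgraphs n (ksets k n - X) (residual (Z \<union> A))))
        \<le> real (card (dgraphs n (ksets k n - X) (residual (Z \<union> V))))"
proof (induction l arbitrary: A V Z)
  case 0
  thus ?case by simp
next
  case (Suc l)
  let ?c = "\<lambda>Z. real (card (dgraphs n (ksets k n - X) (residual Z)))"
  from Suc.prems(1) obtain a A' where A: "A = insert a A'" "a \<notin> A'" "card A' = l"
    by (auto simp: card_Suc_eq)
  from Suc.prems(2) obtain v V' where V: "V = insert v V'" "v \<notin> V'" "card V' = l"
    by (auto simp: card_Suc_eq)
  have av: "a \<in> {1..n}" "v \<in> {1..n}" using Suc.prems A V by auto
  have eq: "insert v ((Z \<union> A) - {a}) = insert v Z \<union> A'" using Suc.prems A V by auto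
  have "ratio * ?c (Z \<union> A) \<le> ?c (insert v ((Z \<union> A) - {a}))"
    by (rule residual_move[OF X _ _ av]) (use Suc.prems A V in auto)
  hence "ratio ^ l * (ratio * ?c (Z \<union> A)) \<le> ratio ^ l * ?c (insert v Z \<union> A')"
    unfolding eq using assms(4) by (intro mult_left_mono) auto
  also have "\<dots> \<le> ?c (insert v Z \<union> V')"
    by (rule Suc.IH) (use Suc.prems A V in auto)
  also have "insert v Z \<union> V' = Z \<union> V" using V by auto
  finally show ?case by (simp add: mult_ac)
qed

text \<open>Deleting the revealed edges turns regular graphs into graphs with the residual degrees.
  Both e and f are forbidden there, so the roles of e and f can be swapped without changing the set
  of allowed edges.\<close>

lemma card_extensions_eq_dgraphs:
  assumes "e \<in> ksets k n - B" "f \<in> ksets k n - B" "e \<noteq> f"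
  shows "card {R \<in> extensions (regular_kgraphs k n d) (insert f B). e \<notin> R}
      = card (dgraphs n (ksets k n - insert e (insert f B)) (residual f))"
proof -
  have deg: "hdegree (F \<union> insert f B) u = hdegree F u + hdegree B u + of_bool (u \<in> f)"
    if "F \<inter> insert f B = {}" "finite F" for F u
  proof -
    have "hdegree (insert f B) u = hdegree B u + of_bool (u \<in> f)"
      using hdegree_Un_disjoint[of "{f}" B u] hdegree_sum[of "{f}" u] finite_revealed assms by simp
    thus ?thesis using hdegree_Un_disjoint[OF that(2) _ that(1)] finite_revealed by simp
  qed
  have "bij_betw (\<lambda>R. R - insert f B) {R \<in> extensions (regular_kgraphs k n d) (insert f B). e \<notin> R}
      (dgraphs n (ksets k n - insert e (insert f B)) (residual f))"
  proof (rule bij_betw_byWitness[where f' = "\<lambda>F. F \<union> insert f B"])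
    show "\<forall>R\<in>{R \<in> extensions (regular_kgraphs k n d) (insert f B). e \<notin> R}. R - insert f B \<union> insert f B = R"
      by (auto simp: extensions_def)
    show "\<forall>F\<in>dgraphs n (ksets k n - insert e (insert f B)) (residual f). F \<union> insert f B - insert f B = F"
      by (auto simp: dgraphs_def)
    show "(\<lambda>R. R - insert f B) ` {R \<in> extensions (regular_kgraphs k n d) (insert f B). e \<notin> R}
        \<subseteq> dgraphs n (ksets k n - insert e (insert f B)) (residual f)"
    proof (rule image_subsetI)
      fix R assume "R \<in> {R \<in> extensions (regular_kgraphs k n d) (insert f B). e \<notin> R}"
      hence R: "R \<in> regular_kgraphs k n d" "insert f B \<subseteq> R" "e \<notin> R" by (auto simp: extensions_def)
      have sub: "R \<subseteq> ksets k n" using R by (simp add: regular_kgraphs_subset)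
      hence fin: "finite (R - insert f B)" using finite_subset[OF _ finite_ksets] by blast
      have "hdegree (R - insert f B) u = residual f u" if "u \<in> {1..n}" for u
      proof -
        have "hdegree R u = d" using R(1) that by (simp add: regular_kgraphs_def)
        moreover have "(R - insert f B) \<union> insert f B = R" using R(2) by blast
        ultimately have "d = hdegree (R - insert f B) u + hdegree B u + of_bool (u \<in> f)"
          using deg[OF _ fin, of u] by (simp add: Int_commute)
        thus ?thesis unfolding residual_def by linarith
      qed
      thus "R - insert f B \<in> dgraphs n (ksets k n - insert e (insert f B)) (residual f)"
        using sub R(3) by (auto simp: dgraphs_def)
    qed
    show "(\<lambda>F. F \<union> insert f B) ` dgraphs n (ksets k n - insert e (insert f B)) (residual f)
        \<subseteq> {R \<in> extensions (regular_kgraphs k n d) (insert f B). e \<notin> R}"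
    proof (rule image_subsetI)
      fix F assume F: "F \<in> dgraphs n (ksets k n - insert e (insert f B)) (residual f)"
      hence sub: "F \<subseteq> ksets k n" "F \<inter> insert f B = {}" "e \<notin> F" by (auto simp: dgraphs_def)
      have fin: "finite F" using sub(1) finite_subset[OF _ finite_ksets] by blast
      have "hdegree (F \<union> insert f B) u = d" if "u \<in> {1..n}" for u
        using deg[OF sub(2) fin, of u] F that hdegree_less[of u] by (auto simp: dgraphs_def residual_def)
      hence "F \<union> insert f B \<in> regular_kgraphs k n d"
        using sub(1) B assms by (auto simp: regular_kgraphs_def kgraphs_def ksets_def)
      thus "F \<union> insert f B \<in> {R \<in> extensions (regular_kgraphs k n d) (insert f B). e \<notin> R}"
        using sub assms by (auto simp: extensions_def)
    qed
  qed
  thus ?thesis by (rule bij_betw_same_card)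
qed

text \<open>Graphs containing both e and f occur on both sides and are split off as
  \<open>y\<close>; for them \<open>ratio \<le> 1\<close> suffices. The others are compared by
  \<open>k\<close> moves from f to e, for which the two edges have to be disjoint.\<close>

lemma card_extensions_insert_ratio:
  assumes e: "e \<in> ksets k n - B" and f: "f \<in> ksets k n - B" and ef: "e \<inter> f = {}" and r: "0 \<le> ratio" "ratio \<le> 1"
  shows "ratio ^ k * real (card (extensions (regular_kgraphs k n d) (insert f B)))
     \<le> real (card (extensions (regular_kgraphs k n d) (insert e B)))"
proof -
  let ?E = "extensions (regular_kgraphs k n d)"
  have fin: "finite (?E A)" for A by (simp add: extensions_def)
  have ne: "e \<noteq> f"
  proof
    assume "e = f"
    hence "e = {}" using ef by simp
    thus False using e k by (simp add: ksets_def)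
  qed
  have split: "card (?E (insert g B)) = card {R \<in> ?E (insert g B). g' \<notin> R} + card (?E (insert g' (insert g B)))" for g g'
  proof -
    have "?E (insert g B) = {R \<in> ?E (insert g B). g' \<notin> R} \<union> ?E (insert g' (insert g B))"
      by (auto simp: extensions_def)
    moreover have "card ({R \<in> ?E (insert g B). g' \<notin> R} \<union> ?E (insert g' (insert g B)))
        = card {R \<in> ?E (insert g B). g' \<notin> R} + card (?E (insert g' (insert g B)))"
      by (rule card_Un_disjoint) (use fin in \<open>auto simp: extensions_def\<close>)
    ultimately show ?thesis by (rule trans[OF arg_cong[of _ _ card]])
  qed
  let ?D = "\<lambda>Z. real (card (dgraphs n (ksets k n - insert e (insert f B)) (residual Z)))"
  have 1: "real (card {R \<in> ?E (insert f B). e \<notin> R}) = ?D f"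
    using card_extensions_eq_dgraphs[OF e f ne] by simp
  have 2: "real (card {R \<in> ?E (insert e B). f \<notin> R}) = ?D e"
    using card_extensions_eq_dgraphs[OF f e ne[symmetric]] by (simp only: insert_commute)
  define y where "y = real (card (?E (insert e (insert f B))))"
  have y1: "real (card (?E (insert f B))) = ?D f + y"
    unfolding y_def 1[symmetric] of_nat_add[symmetric] by (simp only: split[of f e])
  have "real (card (?E (insert e B))) = real (card {R \<in> ?E (insert e B). f \<notin> R}) + real (card (?E (insert f (insert e B))))"
    by (simp only: split[of e f] of_nat_add)
  hence y2: "real (card (?E (insert e B))) = ?D e + y"
    by (simp only: 2 y_def insert_commute[of f e])
  have fe: "card e = k" "card f = k" "finite e" "finite f" "e \<subseteq> {1..n}" "f \<subseteq> {1..n}"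
    using e f finite_mem_ksets[of e k n] finite_mem_ksets[of f k n] by (simp_all add: ksets_def)
  have "ratio ^ k * ?D ({} \<union> f) \<le> ?D ({} \<union> e)"
    by (rule residual_moves[OF refl _ _ r(1)]) (use e f ef fe in \<open>simp_all add: Int_commute\<close>)
  hence 3: "ratio ^ k * ?D f \<le> ?D e" by simp
  have "ratio ^ k * y \<le> 1 * y"
    using r by (intro mult_right_mono power_le_one) (simp_all add: y_def)
  hence "ratio ^ k * ?D f + ratio ^ k * y \<le> ?D e + y" using 3 by simp
  thus ?thesis unfolding y1 y2 distrib_left .
qed

text \<open>The comparison with e is averaged over f. Every extension of \<open>B\<close> has
  \<open>M - card B\<close> further edges, at most \<open>k * \<Delta>\<close> of which meet e; the
  number of edges f disjoint from e is at most the number of all unrevealed k-sets.\<close>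

lemma card_extensions_insert_ge:
  assumes e: "e \<in> ksets k n - B" and r: "0 \<le> ratio" "ratio \<le> 1" and M: "k * M = n * d"
  shows "ratio ^ k * (real M - real (card B) - real k * real \<Delta>) * real (card (extensions (regular_kgraphs k n d) B))
     \<le> (real (n choose k) - real (card B)) * real (card (extensions (regular_kgraphs k n d) (insert e B)))"
proof -
  let ?E = "extensions (regular_kgraphs k n d)" and ?K = "ksets k n - B"
  have kpos: "k > 0" using k by simp
  have finE: "finite (?E A)" for A by (simp add: extensions_def)
  have cardR: "card R = M" if "R \<in> ?E B" for R
  proof -
    have "k * card R = k * M" using card_regular_kgraph[of R k n d] that M by (simp add: extensions_def)
    thus ?thesis using kpos by simp
  qed
  have all: "(\<Sum>f\<in>?K. real (card (?E (insert f B)))) = (real M - real (card B)) * real (card (?E B))"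
  proof -
    have "(\<Sum>f\<in>?K. real (card (?E (insert f B)))) = (\<Sum>R\<in>?E B. real (card (?K \<inter> R)))"
      using sum_extensions[of "regular_kgraphs k n d" ?K B] by (simp flip: of_nat_sum)
    also have "\<dots> = (\<Sum>R\<in>?E B. real M - real (card B))"
    proof (rule sum.cong[OF refl])
      fix R assume R: "R \<in> ?E B"
      hence Rr: "R \<in> regular_kgraphs k n d" and sub1: "B \<subseteq> R" by (simp_all add: extensions_def)
      note sub = sub1 regular_kgraphs_subset[OF Rr]
      have "finite R" using sub finite_subset[OF _ finite_ksets] by blast
      moreover have "?K \<inter> R = R - B" using sub by auto
      ultimately show "real (card (?K \<inter> R)) = real M - real (card B)"
        using cardR[OF R] sub card_mono[of R B] by (simp add: card_Diff_subset finite_revealed of_nat_diff)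
    qed
    finally show ?thesis by simp
  qed
  have thru: "(\<Sum>f\<in>{f\<in>?K. v \<in> f}. real (card (?E (insert f B)))) \<le> real \<Delta> * real (card (?E B))"
    if v: "v \<in> {1..n}" for v
  proof -
    have "(\<Sum>f\<in>{f\<in>?K. v \<in> f}. real (card (?E (insert f B)))) = (\<Sum>R\<in>?E B. real (card ({f\<in>?K. v \<in> f} \<inter> R)))"
      using sum_extensions[of "regular_kgraphs k n d" "{f\<in>?K. v \<in> f}" B] by (simp flip: of_nat_sum)
    also have "\<dots> \<le> (\<Sum>R\<in>?E B. real \<Delta>)"
    proof (rule sum_mono)
      fix R assume R: "R \<in> ?E B"
      hence Rr: "R \<in> regular_kgraphs k n d" and sub1: "B \<subseteq> R" by (simp_all add: extensions_def)
      have "hdegree R v = d" using v Rr by (simp add: regular_kgraphs_def)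
      note sub = sub1 regular_kgraphs_subset[OF Rr] this
      have fin: "finite R" using sub finite_subset[OF _ finite_ksets] by blast
      have "{f\<in>?K. v \<in> f} \<inter> R = {e \<in> R. v \<in> e} - {e \<in> B. v \<in> e}" using sub by auto
      moreover have "card ({e \<in> R. v \<in> e} - {e \<in> B. v \<in> e}) = card {e \<in> R. v \<in> e} - card {e \<in> B. v \<in> e}"
        by (rule card_Diff_subset) (use sub finite_revealed in auto)
      ultimately have "card ({f\<in>?K. v \<in> f} \<inter> R) = d - hdegree B v"
        using sub(3) by (simp add: hdegree_def)
      thus "real (card ({f\<in>?K. v \<in> f} \<inter> R)) \<le> real \<Delta>" using up[OF v] by simp
    qed
    finally show ?thesis by (simp add: mult.commute)
  qed
  have fe: "finite e" "card e = k" "e \<subseteq> {1..n}" using e finite_mem_ksets[of e k n] by (simp_all add: ksets_def)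
  let ?g = "\<lambda>f. real (card (?E (insert f B)))"
  have "sum ?g ?K = sum ?g {f\<in>?K. f \<inter> e = {}} + sum ?g {f\<in>?K. f \<inter> e \<noteq> {}}"
  proof -
    have "?K = {f\<in>?K. f \<inter> e = {}} \<union> {f\<in>?K. f \<inter> e \<noteq> {}}" by blast
    moreover have "sum ?g ({f\<in>?K. f \<inter> e = {}} \<union> {f\<in>?K. f \<inter> e \<noteq> {}})
        = sum ?g {f\<in>?K. f \<inter> e = {}} + sum ?g {f\<in>?K. f \<inter> e \<noteq> {}}"
      by (rule sum.union_disjoint) (simp, simp, blast)
    ultimately show ?thesis by (rule trans[OF arg_cong[of _ _ "sum ?g"]])
  qed
  moreover have "sum ?g {f\<in>?K. f \<inter> e \<noteq> {}} \<le> real k * real \<Delta> * real (card (?E B))"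
  proof -
    have "{f\<in>?K. f \<inter> e \<noteq> {}} = (\<Union>v\<in>e. {f\<in>?K. v \<in> f})" by blast
    hence "sum ?g {f\<in>?K. f \<inter> e \<noteq> {}} = sum ?g (\<Union>v\<in>e. {f\<in>?K. v \<in> f})" by (rule arg_cong)
    also have "\<dots> \<le> (\<Sum>v\<in>e. sum ?g {f\<in>?K. v \<in> f})"
      by (rule sum_UN_le) (simp_all add: fe)
    also have "\<dots> \<le> (\<Sum>v\<in>e. real \<Delta> * real (card (?E B)))"
    proof (rule sum_mono)
      fix v assume "v \<in> e"
      hence "v \<in> {1..n}" using fe(3) by blast
      thus "sum ?g {f\<in>?K. v \<in> f} \<le> real \<Delta> * real (card (?E B))" by (rule thru)
    qed
    also have "\<dots> = real k * real \<Delta> * real (card (?E B))" by (simp add: fe)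
    finally show ?thesis .
  qed
  ultimately have disj: "(real M - real (card B) - real k * real \<Delta>) * real (card (?E B)) \<le> sum ?g {f\<in>?K. f \<inter> e = {}}"
    unfolding all by (simp add: algebra_simps)
  have "ratio ^ k * ((real M - real (card B) - real k * real \<Delta>) * real (card (?E B))) \<le> ratio ^ k * sum ?g {f\<in>?K. f \<inter> e = {}}"
    using disj r by (intro mult_left_mono) auto
  also have "\<dots> = (\<Sum>f\<in>{f\<in>?K. f \<inter> e = {}}. ratio ^ k * ?g f)" by (rule sum_distrib_left)
  also have "\<dots> \<le> (\<Sum>f\<in>{f\<in>?K. f \<inter> e = {}}. ?g e)"
  proof (rule sum_mono)
    fix f assume "f \<in> {f\<in>?K. f \<inter> e = {}}"
    hence f: "f \<in> ?K" "e \<inter> f = {}" by (simp_all add: Int_commute)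
    show "ratio ^ k * ?g f \<le> ?g e" by (rule card_extensions_insert_ratio[OF e f r])
  qed
  also have "\<dots> \<le> real (card ?K) * ?g e"
  proof -
    have "card {f\<in>?K. f \<inter> e = {}} \<le> card ?K" by (rule card_mono) auto
    thus ?thesis by (simp add: mult_right_mono)
  qed
  also have "real (card ?K) = real (n choose k) - real (card B)"
    using card_mono[OF finite_ksets B] by (simp add: card_Diff_subset finite_revealed B card_ksets of_nat_diff)
  finally show ?thesis by (simp only: mult.assoc)
qed

end

section \<open>Revealing a uniformly random member of a set family\<close>

text \<open>Given the revealed set, the hidden graph is uniform among the extensions whatever the
  order of revelation was, so a set is enough as state. \<open>pmf_of_set (R - B)\<close> is
  meaningful only before everything has been revealed, whence the later condition
  \<open>card B < M\<close>.\<close>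

definition next_edge :: "'a set set \<Rightarrow> 'a set \<Rightarrow> 'a pmf" where
  "next_edge \<F> B = bind_pmf (pmf_of_set (extensions \<F> B)) (\<lambda>R. pmf_of_set (R - B))"

locale uniform_family =
  fixes \<F> :: "'a set set" and K :: "'a set" and M :: nat
  assumes finK: "finite K" and member_subset: "R \<in> \<F> \<Longrightarrow> R \<subseteq> K" and card_member: "R \<in> \<F> \<Longrightarrow> card R = M"
begin

lemma finite_family: "finite \<F>"
  by (rule finite_subset[of _ "Pow K"]) (use member_subset finK in auto)

lemma finite_ext: "finite (extensions \<F> B)"
  using finite_family by (simp add: extensions_def)

lemma ext_sub: "R \<in> extensions \<F> B \<Longrightarrow> B \<subseteq> R \<and> R \<subseteq> K \<and> finite R \<and> card R = M"
  using member_subset[of R] card_member[of R] finite_subset[of R K] finK by (simp add: extensions_def)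

lemma pmf_next_edge:
  assumes ne: "extensions \<F> B \<noteq> {}" and B: "finite B" "card B < M"
  shows "pmf (next_edge \<F> B) e = (if e \<in> B then 0 else
     real (card (extensions \<F> (insert e B))) / ((real M - real (card B)) * real (card (extensions \<F> B))))"
proof -
  let ?E = "extensions \<F> B"
  have d: "real (card (R - B)) = real M - real (card B) \<and> finite (R - B) \<and> R - B \<noteq> {}" if "R \<in> ?E" for R
  proof -
    have "card (R - B) = M - card B" using ext_sub[OF that] B by (simp add: card_Diff_subset)
    moreover have "R - B \<noteq> {}" using B calculation by (intro notI) simp
    ultimately show ?thesis using ext_sub[OF that] B by simp
  qed
  have "pmf (next_edge \<F> B) e = (\<Sum>R\<in>?E. pmf (pmf_of_set (R - B)) e) / real (card ?E)"
    unfolding next_edge_def pmf_bind by (rule integral_pmf_of_set[OF ne finite_ext])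
  also have "(\<Sum>R\<in>?E. pmf (pmf_of_set (R - B)) e) = (\<Sum>R\<in>?E. of_bool (e \<notin> B \<and> e \<in> R) / (real M - real (card B)))"
    by (rule sum.cong[OF refl]) (use d in \<open>simp add: pmf_of_set indicator_def\<close>)
  also have "\<dots> = (\<Sum>R\<in>?E. of_bool (e \<notin> B \<and> e \<in> R)) / (real M - real (card B))"
    by (rule sum_divide_distrib[symmetric])
  also have "(\<Sum>R\<in>?E. of_bool (e \<notin> B \<and> e \<in> R) :: real) = (if e \<in> B then 0 else real (card (extensions \<F> (insert e B))))"
  proof (cases "e \<in> B")
    case False
    have "extensions \<F> (insert e B) = ?E \<inter> {R. e \<in> R}" by (auto simp: extensions_def)
    thus ?thesis using False finite_ext by simp
  qed simp
  finally show ?thesis by simp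
qed

lemma set_next_edge:
  assumes ne: "extensions \<F> B \<noteq> {}" and B: "finite B" "card B < M"
  shows "set_pmf (next_edge \<F> B) = {e. e \<notin> B \<and> extensions \<F> (insert e B) \<noteq> {}}"
proof -
  have "card (extensions \<F> A) = 0 \<longleftrightarrow> extensions \<F> A = {}" for A using finite_ext by simp
  thus ?thesis using B ne by (auto simp: set_pmf_eq pmf_next_edge[OF ne B] split: if_splits)
qed

text \<open>For a fixed outcome \<open>S\<close>, the number of extensions of
  \<open>insert e B\<close> cancels, so each of the \<open>M - card B\<close> elements of
  \<open>S - B\<close> contributes the same weight. This lets the process stop at any time and be
  completed to an exactly uniform member.\<close>

lemma bind_next_edge_extensions:
  assumes ne: "extensions \<F> B \<noteq> {}" and B: "finite B" "card B < M"
  shows "bind_pmf (next_edge \<F> B) (\<lambda>e. pmf_of_set (extensions \<F> (insert e B))) = pmf_of_set (extensions \<F> B)"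
proof (rule pmf_eqI)
  fix S
  let ?E = "extensions \<F>" and ?c = "(real M - real (card B)) * real (card (extensions \<F> B))"
  have c: "?c > 0" using ne B finite_ext by (simp add: card_gt_0_iff)
  have set: "set_pmf (next_edge \<F> B) \<subseteq> K - B"
    unfolding set_next_edge[OF assms] using ext_sub by blast
  have "pmf (bind_pmf (next_edge \<F> B) (\<lambda>e. pmf_of_set (?E (insert e B)))) S
      = (\<Sum>e\<in>K - B. pmf (pmf_of_set (?E (insert e B))) S * pmf (next_edge \<F> B) e)"
    unfolding pmf_bind by (rule integral_measure_pmf_real) (use finK set in auto)
  also have "\<dots> = (\<Sum>e\<in>K - B. of_bool (S \<in> ?E B \<and> e \<in> S) / ?c)"
  proof (rule sum.cong[OF refl])
    fix e assume e: "e \<in> K - B"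
    show "pmf (pmf_of_set (?E (insert e B))) S * pmf (next_edge \<F> B) e = of_bool (S \<in> ?E B \<and> e \<in> S) / ?c"
    proof (cases "?E (insert e B) = {}")
      case True
      hence "\<not> (S \<in> ?E B \<and> e \<in> S)" by (auto simp: extensions_def)
      thus ?thesis using True e by (simp add: pmf_next_edge[OF assms])
    next
      case False
      have "card (?E (insert e B)) > 0" using False finite_ext by (simp add: card_gt_0_iff)
      moreover have "S \<in> ?E (insert e B) \<longleftrightarrow> S \<in> ?E B \<and> e \<in> S" by (auto simp: extensions_def)
      ultimately show ?thesis using e False finite_ext
        by (simp add: pmf_next_edge[OF assms] pmf_of_set indicator_def)
    qed
  qed
  also have "\<dots> = pmf (pmf_of_set (?E B)) S"
  proof (cases "S \<in> ?E B")
    case True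
    have "(K - B) \<inter> {e. e \<in> S} = S - B" using ext_sub[OF True] by auto
    moreover have "card (S - B) = M - card B" using ext_sub[OF True] B by (simp add: card_Diff_subset)
    ultimately have "(\<Sum>e\<in>K - B. of_bool (S \<in> ?E B \<and> e \<in> S) :: real) = real M - real (card B)"
      using True finK B by simp
    thus ?thesis using True ne finite_ext B by (simp add: pmf_of_set flip: sum_divide_distrib)
  next
    case False
    thus ?thesis using ne finite_ext by (simp add: pmf_of_set)
  qed
  finally show "pmf (bind_pmf (next_edge \<F> B) (\<lambda>e. pmf_of_set (?E (insert e B)))) S = pmf (pmf_of_set (?E B)) S" .
qed

definition states :: "nat \<Rightarrow> 'a set set" where
  "states t = {B. B \<subseteq> K \<and> card B = t \<and> extensions \<F> B \<noteq> {}}"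

definition add_edge :: "'a set \<Rightarrow> 'a set pmf" where
  "add_edge B = map_pmf (\<lambda>e. insert e B) (next_edge \<F> B)"

lemma set_add_edge:
  assumes "B \<in> states t" "t < M"
  shows "set_pmf (add_edge B) \<subseteq> states (Suc t)"
proof -
  have fin: "finite B" using assms finK finite_subset by (auto simp: states_def)
  have "extensions \<F> B \<noteq> {}" "card B < M" using assms by (auto simp: states_def)
  note set = set_next_edge[OF this(1) fin this(2)]
  show ?thesis
  proof
    fix B' assume "B' \<in> set_pmf (add_edge B)"
    then obtain e where e: "e \<notin> B" "extensions \<F> (insert e B) \<noteq> {}" "B' = insert e B"
      by (auto simp: add_edge_def set)
    hence "e \<in> K" using ext_sub by blast
    thus "B' \<in> states (Suc t)" using e assms fin by (auto simp: states_def)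
  qed
qed

lemma bind_add_edge:
  assumes "B \<in> states t" "t < M"
  shows "bind_pmf (add_edge B) (\<lambda>B. pmf_of_set (extensions \<F> B)) = pmf_of_set (extensions \<F> B)"
proof -
  have fin: "finite B" using assms finK finite_subset by (auto simp: states_def)
  have "extensions \<F> B \<noteq> {}" "card B < M" using assms by (auto simp: states_def)
  from bind_next_edge_extensions[OF this(1) fin this(2)] show ?thesis
    by (simp add: add_edge_def bind_map_pmf)
qed

end

section \<open>Markov chains with time-dependent invariants\<close>

primrec chain :: "('a \<Rightarrow> 'a pmf) \<Rightarrow> 'a \<Rightarrow> nat \<Rightarrow> 'a pmf" where
  "chain \<kappa> x 0 = return_pmf x"
| "chain \<kappa> x (Suc t) = bind_pmf (chain \<kappa> x t) \<kappa>"

lemma map_chain: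
  assumes "\<And>x. map_pmf f (\<kappa> x) = \<kappa>' (f x)"
  shows "map_pmf f (chain \<kappa> x t) = chain \<kappa>' (f x) t"
proof (induction t)
  case (Suc t)
  have "map_pmf f (chain \<kappa> x (Suc t)) = bind_pmf (map_pmf f (chain \<kappa> x t)) \<kappa>'"
    by (simp add: map_bind_pmf assms bind_map_pmf)
  thus ?case using Suc by simp
qed simp

lemma set_chain:
  assumes "x \<in> S 0" "\<And>t x. t < T \<Longrightarrow> x \<in> S t \<Longrightarrow> set_pmf (\<kappa> x) \<subseteq> S (Suc t)"
  shows "t \<le> T \<Longrightarrow> set_pmf (chain \<kappa> x t) \<subseteq> S t"
proof (induction t)
  case 0
  thus ?case using assms(1) by simp
next
  case (Suc t)
  hence *: "t < T" "set_pmf (chain \<kappa> x t) \<subseteq> S t" by simp_all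
  show ?case
  proof
    fix y assume "y \<in> set_pmf (chain \<kappa> x (Suc t))"
    then obtain z where z: "z \<in> set_pmf (chain \<kappa> x t)" "y \<in> set_pmf (\<kappa> z)" by auto
    thus "y \<in> S (Suc t)" using assms(2)[OF *(1), of z] *(2) by blast
  qed
qed

text \<open>A kernel \<open>h\<close> that is harmonic for one step is harmonic for all steps. It is
  used with the uniformly random completion as \<open>h\<close>, in both coordinates of the
  coupling.\<close>

lemma bind_chain:
  assumes "x \<in> S 0" "\<And>t x. t < T \<Longrightarrow> x \<in> S t \<Longrightarrow> set_pmf (\<kappa> x) \<subseteq> S (Suc t)"
    and "\<And>t x. t < T \<Longrightarrow> x \<in> S t \<Longrightarrow> bind_pmf (\<kappa> x) h = h x"
  shows "t \<le> T \<Longrightarrow> bind_pmf (chain \<kappa> x t) h = h x"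
proof (induction t)
  case 0
  thus ?case by (simp add: bind_return_pmf)
next
  case (Suc t)
  hence t: "t < T" "t \<le> T" by simp_all
  have "set_pmf (chain \<kappa> x t) \<subseteq> S t" by (rule set_chain[where T = T, OF assms(1,2) t(2)])
  hence "bind_pmf (chain \<kappa> x t) (\<lambda>y. bind_pmf (\<kappa> y) h) = bind_pmf (chain \<kappa> x t) h"
    using assms(3)[OF t(1)] by (intro bind_pmf_cong) auto
  thus ?case using Suc t by (simp add: bind_assoc_pmf)
qed

text \<open>A supermartingale has non-increasing expectation. The sets \<open>S t\<close> restrict
  the one-step inequality to states that can be reached at time \<open>t\<close>.\<close>

lemma nn_integral_chain_le:
  fixes g :: "nat \<Rightarrow> 'a \<Rightarrow> ennreal"
  assumes "x \<in> S 0" "\<And>t x. t < T \<Longrightarrow> x \<in> S t \<Longrightarrow> set_pmf (\<kappa> x) \<subseteq> S (Suc t)"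
    and "\<And>t x. t < T \<Longrightarrow> x \<in> S t \<Longrightarrow> (\<integral>\<^sup>+y. g (Suc t) y \<partial>\<kappa> x) \<le> g t x"
  shows "t \<le> T \<Longrightarrow> (\<integral>\<^sup>+y. g t y \<partial>chain \<kappa> x t) \<le> g 0 x"
proof (induction t)
  case 0
  thus ?case by simp
next
  case (Suc t)
  hence t: "t < T" "t \<le> T" by simp_all
  have S: "set_pmf (chain \<kappa> x t) \<subseteq> S t" by (rule set_chain[where T = T, OF assms(1,2) t(2)])
  have "(\<integral>\<^sup>+y. g (Suc t) y \<partial>chain \<kappa> x (Suc t)) = (\<integral>\<^sup>+z. \<integral>\<^sup>+y. g (Suc t) y \<partial>\<kappa> z \<partial>chain \<kappa> x t)"
    by simp
  also have "\<dots> \<le> (\<integral>\<^sup>+z. g t z \<partial>chain \<kappa> x t)"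
    by (rule nn_integral_mono_AE) (use S assms(3)[OF t(1)] in \<open>auto simp: AE_measure_pmf_iff\<close>)
  also have "\<dots> \<le> g 0 x" using Suc t by simp
  finally show ?case .
qed

text \<open>Markov's inequality.\<close>

lemma emeasure_le_nn_integral_divide:
  fixes p :: "'a pmf" and g :: "'a \<Rightarrow> ennreal"
  assumes "c > 0" "\<And>x. x \<in> A \<Longrightarrow> ennreal c \<le> g x" "(\<integral>\<^sup>+x. g x \<partial>p) \<le> ennreal b" "b \<ge> 0"
  shows "measure_pmf.prob p A \<le> b / c"
proof -
  have "ennreal c * emeasure p A = (\<integral>\<^sup>+x. ennreal c * indicator A x \<partial>p)"
    by (simp add: nn_integral_cmult)
  also have "\<dots> \<le> (\<integral>\<^sup>+x. g x \<partial>p)"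
    by (rule nn_integral_mono) (use assms(2) in \<open>auto simp: indicator_def\<close>)
  also have "\<dots> \<le> ennreal b" by (rule assms)
  finally have "ennreal (c * measure_pmf.prob p A) \<le> ennreal b"
    using assms by (simp add: measure_pmf.emeasure_eq_measure ennreal_mult)
  hence "c * measure_pmf.prob p A \<le> b" using assms by (simp add: ennreal_le_iff)
  thus ?thesis using assms by (simp add: field_simps)
qed

section \<open>The coupling\<close>

text \<open>The excess of \<open>q\<close> over \<open>(1 - \<epsilon>) * u\<close> is nonnegative
  of total mass \<open>\<epsilon>\<close>, so after division by \<open>\<epsilon>\<close> it is a
  distribution.\<close>

lemma pmf_residual_exists:
  assumes "0 < \<epsilon>" "\<epsilon> \<le> 1" and le: "\<And>e. (1 - \<epsilon>) * pmf u e \<le> pmf q e"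
  shows "\<exists>r. \<forall>e. pmf q e = (1 - \<epsilon>) * pmf u e + \<epsilon> * pmf r e"
proof -
  define f where "f = (\<lambda>e. (pmf q e - (1 - \<epsilon>) * pmf u e) / \<epsilon>)"
  have f: "f e \<ge> 0" for e using assms by (simp add: f_def)
  have int: "integrable (count_space UNIV) f"
    unfolding f_def by (intro integrable_divide Bochner_Integration.integrable_diff integrable_mult_right integrable_pmf)
  have "integral\<^sup>L (count_space UNIV) f = (1 - (1 - \<epsilon>) * 1) / \<epsilon>"
    unfolding f_def
    by (subst integral_divide_zero, subst Bochner_Integration.integral_diff)
       (auto intro: integrable_pmf simp: integral_pmf)
  hence "integral\<^sup>L (count_space UNIV) f = 1" using assms by simp
  hence one: "(\<integral>\<^sup>+e. ennreal (f e) \<partial>count_space UNIV) = 1"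
    using nn_integral_eq_integral[OF int] f by simp
  have "pmf (embed_pmf f) e = f e" for e by (rule pmf_embed_pmf[OF f one])
  hence "pmf q e = (1 - \<epsilon>) * pmf u e + \<epsilon> * pmf (embed_pmf f) e" for e
    using assms by (simp add: f_def)
  thus ?thesis by blast
qed

text \<open>Stopping at \<open>m\<close> edges lets a uniformly random extension to \<open>m\<close> edges be preserved by every step.\<close>

definition thin_step :: "'a set \<Rightarrow> nat \<Rightarrow> real \<Rightarrow> 'a set \<Rightarrow> 'a set pmf" where
  "thin_step K m \<epsilon> A = (if card A < m then
      bind_pmf (pmf_of_set (K - A)) (\<lambda>X. map_pmf (\<lambda>c. if c then insert X A else A) (bernoulli_pmf (1 - \<epsilon>)))
    else return_pmf A)"

text \<open>The candidate X is uniform outside \<open>A\<close>, not outside \<open>B\<close>. If X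
  lies in \<open>B\<close>, accepting it is harmless and the next edge is drawn from
  \<open>q\<close> separately. Otherwise X is uniform outside \<open>B\<close>; an accepted X is
  itself the next edge, and after a rejection the next edge comes from the residual law
  \<open>r\<close>. Given either case the next edge has law \<open>q\<close>, while the acceptance
  coin never depends on X.\<close>

lemma coupled_step_exists:
  fixes q :: "'a pmf"
  assumes finK: "finite K" and AB: "A \<subseteq> B" "B \<subseteq> K" "B \<noteq> K" and q: "set_pmf q \<subseteq> K - B"
    and \<epsilon>: "0 < \<epsilon>" "\<epsilon> \<le> 1" and le: "\<And>e. e \<in> K - B \<Longrightarrow> (1 - \<epsilon>) / real (card (K - B)) \<le> pmf q e"
  shows "\<exists>J. map_pmf fst J = thin_step K m \<epsilon> A \<and> map_pmf snd J = map_pmf (\<lambda>e. insert e B) q \<and>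
     (\<forall>x\<in>set_pmf J. fst x \<subseteq> snd x)"
proof (cases "card A < m")
  case False
  have "map_pmf fst (map_pmf (\<lambda>e. (A, insert e B)) q) = thin_step K m \<epsilon> A"
    using False by (simp add: pmf.map_comp o_def thin_step_def)
  moreover have "map_pmf snd (map_pmf (\<lambda>e. (A, insert e B)) q) = map_pmf (\<lambda>e. insert e B) q"
    by (simp add: pmf.map_comp o_def)
  moreover have "\<forall>x\<in>set_pmf (map_pmf (\<lambda>e. (A, insert e B)) q). fst x \<subseteq> snd x" using AB by auto
  ultimately show ?thesis by blast
next
  case True
  let ?u = "pmf_of_set (K - B)"
  have KB: "K - B \<noteq> {}" "finite (K - B)" using AB finK by auto
  have KA: "K - A \<noteq> {}" "finite (K - A)" using AB finK by auto
  have "(1 - \<epsilon>) * pmf ?u e \<le> pmf q e" for e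
    using le[of e] KB by (cases "e \<in> K - B") (auto simp: pmf_of_set)
  from pmf_residual_exists[OF \<epsilon> this] obtain r where
    r: "pmf q e = (1 - \<epsilon>) * pmf ?u e + \<epsilon> * pmf r e" for e by blast
  define Y where "Y = (\<lambda>X c. if X \<in> B then q else if c then return_pmf X else r)"
  define J where "J = bind_pmf (pmf_of_set (K - A)) (\<lambda>X. bind_pmf (bernoulli_pmf (1 - \<epsilon>))
     (\<lambda>c. map_pmf (\<lambda>Y. (if c then insert X A else A, insert Y B)) (Y X c)))"
  have fst: "map_pmf fst J = thin_step K m \<epsilon> A"
    using True by (simp add: J_def thin_step_def map_bind_pmf pmf.map_comp o_def) (simp add: map_pmf_def)
  have Yq: "bind_pmf (pmf_of_set (K - A)) (\<lambda>X. bind_pmf (bernoulli_pmf (1 - \<epsilon>)) (Y X)) = q"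
  proof (rule pmf_eqI)
    fix z
    let ?b = "real (card (K - B))" and ?a = "real (card (B - A))"
    have b: "?b > 0" using KB by (simp add: card_gt_0_iff)
    have disj: "K - A = (B - A) \<union> (K - B)" using AB by auto
    have fin: "finite (B - A)" using finite_subset[OF AB(2) finK] by simp
    have cd: "real (card (K - A)) = ?a + ?b"
      unfolding disj using fin KB by (subst card_Un_disjoint) auto
    have inner: "pmf (bind_pmf (bernoulli_pmf (1 - \<epsilon>)) (Y X)) z
        = (if X \<in> B then pmf q z else (1 - \<epsilon>) * of_bool (X = z) + \<epsilon> * pmf r z)" for X
      using \<epsilon> by (simp add: pmf_bind Y_def indicator_def) (simp add: algebra_simps)
    have "(\<Sum>X\<in>K - A. pmf (bind_pmf (bernoulli_pmf (1 - \<epsilon>)) (Y X)) z)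
        = (\<Sum>X\<in>B - A. pmf q z) + (\<Sum>X\<in>K - B. (1 - \<epsilon>) * of_bool (X = z) + \<epsilon> * pmf r z)"
      unfolding inner disj using fin KB
      by (subst sum.union_disjoint) (auto intro!: arg_cong2[of _ _ _ _ "(+)"] sum.cong)
    also have "\<dots> = ?a * pmf q z + ((1 - \<epsilon>) * of_bool (z \<in> K - B) + ?b * (\<epsilon> * pmf r z))"
    proof -
      have "(\<Sum>X\<in>K - B. of_bool (X = z) :: real) = of_bool (z \<in> K - B)"
        using KB by (simp add: of_bool_def sum.delta)
      thus ?thesis by (simp add: sum.distrib flip: sum_distrib_left)
    qed
    also have "(1 - \<epsilon>) * of_bool (z \<in> K - B) = ?b * ((1 - \<epsilon>) * pmf ?u z)"
      using b KB by (simp add: pmf_of_set indicator_def)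
    also have "?a * pmf q z + (?b * ((1 - \<epsilon>) * pmf ?u z) + ?b * (\<epsilon> * pmf r z)) = (?a + ?b) * pmf q z"
      by (simp only: r[of z] distrib_left distrib_right add.assoc)
    finally have "(\<Sum>X\<in>K - A. pmf (bind_pmf (bernoulli_pmf (1 - \<epsilon>)) (Y X)) z) = real (card (K - A)) * pmf q z"
      unfolding cd .
    moreover have "pmf (bind_pmf (pmf_of_set (K - A)) (\<lambda>X. bind_pmf (bernoulli_pmf (1 - \<epsilon>)) (Y X))) z
        = (\<Sum>X\<in>K - A. pmf (bind_pmf (bernoulli_pmf (1 - \<epsilon>)) (Y X)) z) / real (card (K - A))"
      unfolding pmf_bind[of "pmf_of_set (K - A)"] by (rule integral_pmf_of_set[OF KA])
    ultimately show "pmf (bind_pmf (pmf_of_set (K - A)) (\<lambda>X. bind_pmf (bernoulli_pmf (1 - \<epsilon>)) (Y X))) z = pmf q z"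
      using KA by simp
  qed
  have "map_pmf snd J = map_pmf (\<lambda>e. insert e B) (bind_pmf (pmf_of_set (K - A)) (\<lambda>X. bind_pmf (bernoulli_pmf (1 - \<epsilon>)) (Y X)))"
    by (simp add: J_def map_bind_pmf pmf.map_comp o_def)
  hence snd: "map_pmf snd J = map_pmf (\<lambda>e. insert e B) q" unfolding Yq .
  have "fst x \<subseteq> snd x" if "x \<in> set_pmf J" for x
  proof -
    obtain X c y where x: "y \<in> set_pmf (Y X c)" "x = (if c then insert X A else A, insert y B)"
      using \<open>x \<in> set_pmf J\<close> unfolding J_def set_bind_pmf set_map_pmf by blast
    have "X \<in> B \<or> y = X" if c using x(1) that by (auto simp: Y_def split: if_splits)
    thus ?thesis using x(2) AB by auto
  qed
  thus ?thesis using fst snd by blast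
qed

section \<open>Thinning and uniformly random sets of m elements\<close>

context
  fixes K :: "'a set" and m :: nat
  assumes finK: "finite K" and m: "m \<le> card K"
begin

lemma uniform_subsets: "uniform_family {E. E \<subseteq> K \<and> card E = m} K m"
  by unfold_locales (use finK in auto)

lemma card_extensions_subsets:
  assumes "A \<subseteq> K" "card A \<le> m"
  shows "card (extensions {E. E \<subseteq> K \<and> card E = m} A) = (card K - card A) choose (m - card A)"
proof -
  have finA: "finite A" using assms finK finite_subset by blast
  have "bij_betw (\<lambda>E. E - A) (extensions {E. E \<subseteq> K \<and> card E = m} A) {S. S \<subseteq> K - A \<and> card S = m - card A}"
  proof (rule bij_betw_byWitness[where f' = "\<lambda>S. S \<union> A"])
    show "\<forall>E\<in>extensions {E. E \<subseteq> K \<and> card E = m} A. E - A \<union> A = E" by (auto simp: extensions_def)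
    show "\<forall>S\<in>{S. S \<subseteq> K - A \<and> card S = m - card A}. S \<union> A - A = S" by auto
    show "(\<lambda>E. E - A) ` extensions {E. E \<subseteq> K \<and> card E = m} A \<subseteq> {S. S \<subseteq> K - A \<and> card S = m - card A}"
      using finA by (auto simp: extensions_def card_Diff_subset)
    show "(\<lambda>S. S \<union> A) ` {S. S \<subseteq> K - A \<and> card S = m - card A} \<subseteq> extensions {E. E \<subseteq> K \<and> card E = m} A"
    proof (rule image_subsetI)
      fix S assume S: "S \<in> {S. S \<subseteq> K - A \<and> card S = m - card A}"
      have "finite S" using S finK finite_subset[of S K] by auto
      hence "card (S \<union> A) = card S + card A" using finA S by (intro card_Un_disjoint) auto
      thus "S \<union> A \<in> extensions {E. E \<subseteq> K \<and> card E = m} A" using S assms by (auto simp: extensions_def)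
    qed
  qed
  hence "card (extensions {E. E \<subseteq> K \<and> card E = m} A) = card {S. S \<subseteq> K - A \<and> card S = m - card A}"
    by (rule bij_betw_same_card)
  also have "\<dots> = card (K - A) choose (m - card A)" using finK by (intro n_subsets) auto
  finally show ?thesis using assms finA by (simp add: card_Diff_subset)
qed

lemma extensions_subsets_nonempty:
  assumes "A \<subseteq> K" "card A \<le> m"
  shows "extensions {E. E \<subseteq> K \<and> card E = m} A \<noteq> {}"
proof -
  have "card (extensions {E. E \<subseteq> K \<and> card E = m} A) > 0"
    unfolding card_extensions_subsets[OF assms] using m assms by simp
  thus ?thesis by (intro notI) simp
qed

text \<open>Revealing a uniformly random m-set element by element adds a uniformly random new
  element each time; in counts this is the absorption identity for binomial coefficients. The
  general facts on \<open>next_edge\<close> thus apply to the thinned set as well.\<close>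

lemma next_edge_subsets:
  assumes A: "A \<subseteq> K" "card A < m"
  shows "next_edge {E. E \<subseteq> K \<and> card E = m} A = pmf_of_set (K - A)"
proof (rule pmf_eqI)
  fix e
  interpret uniform_family "{E. E \<subseteq> K \<and> card E = m}" K m by (rule uniform_subsets)
  have finA: "finite A" using A finK finite_subset by blast
  have KA: "card (K - A) = card K - card A" using A finA by (simp add: card_Diff_subset)
  have ne: "K - A \<noteq> {}"
  proof
    assume "K - A = {}"
    hence "card (K - A) = 0" by (simp only: card.empty)
    thus False using KA A m by simp
  qed
  let ?E = "extensions {E. E \<subseteq> K \<and> card E = m}"
  have nee: "?E A \<noteq> {}" using extensions_subsets_nonempty A by simp
  show "pmf (next_edge {E. E \<subseteq> K \<and> card E = m} A) e = pmf (pmf_of_set (K - A)) e"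
  proof (cases "e \<in> K - A")
    case True
    define a b where "a = card K - card A - 1" and "b = m - card A - 1"
    have ab: "card K - card A = Suc a" "m - card A = Suc b" using A m by (simp_all add: a_def b_def)
    have "card (?E (insert e A)) = (card K - card (insert e A)) choose (m - card (insert e A))"
      by (rule card_extensions_subsets) (use A True finA in auto)
    hence 1: "card (?E (insert e A)) = a choose b" using True finA by (simp add: a_def b_def)
    have 2: "card (?E A) = Suc a choose Suc b" using card_extensions_subsets[of A] A ab by simp
    have mb: "real m - real (card A) = real (Suc b)" using ab(2) A by (simp add: of_nat_diff flip: ab(2))
    have pos: "a choose b > 0" using A m by (intro zero_less_binomial) (simp add: a_def b_def)
    have "Suc b * (Suc a choose Suc b) = Suc a * (a choose b)" by (rule Suc_times_binomial)
    hence "real (Suc b) * real (Suc a choose Suc b) = real (Suc a) * real (a choose b)"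
      by (metis of_nat_mult)
    moreover have "real (Suc a) \<noteq> 0" "real (a choose b) \<noteq> 0" using pos by simp_all
    moreover have "pmf (next_edge {E. E \<subseteq> K \<and> card E = m} A) e = real (a choose b) / (real (Suc b) * real (Suc a choose Suc b))"
      using pmf_next_edge[OF nee finA A(2), of e] True unfolding 1 2 mb by simp
    moreover have "pmf (pmf_of_set (K - A)) e = 1 / real (Suc a)"
      using True finK ne KA ab(1) by (simp add: pmf_of_set)
    ultimately show ?thesis by (simp only:) simp
  next
    case False
    have "?E (insert e A) = {}" if "e \<notin> A" using False that by (auto simp: extensions_def)
    hence "pmf (next_edge {E. E \<subseteq> K \<and> card E = m} A) e = 0"
      using pmf_next_edge[OF nee finA A(2), of e] by simp
    thus ?thesis using False finK ne by (simp add: pmf_of_set)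
  qed
qed

lemma set_thin_step:
  assumes "A \<subseteq> K" "card A \<le> m"
  shows "set_pmf (thin_step K m \<epsilon> A) \<subseteq> {A. A \<subseteq> K \<and> card A \<le> m}"
proof (cases "card A < m")
  case True
  have finA: "finite A" using assms finK finite_subset by blast
  have "card (K - A) > 0" using True m assms finA by (simp add: card_Diff_subset)
  hence "K - A \<noteq> {}" by (intro notI) simp
  moreover have "finite (K - A)" using finK by simp
  ultimately have "set_pmf (pmf_of_set (K - A)) = K - A" by simp
  hence *: "set_pmf (thin_step K m \<epsilon> A) \<subseteq> (\<Union>X\<in>K - A. {insert X A, A})"
    using True by (auto simp: thin_step_def)
  have "insert X A \<subseteq> K \<and> card (insert X A) \<le> m" if "X \<in> K - A" for X
    using that assms True finA by auto
  thus ?thesis using * assms by blast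
next
  case False
  thus ?thesis using assms by (simp add: thin_step_def)
qed

text \<open>The coin is independent of the candidate, so it can be tossed first: a rejection changes
  nothing, and an acceptance is one step of revealing a uniformly random m-set.\<close>

lemma bind_thin_step:
  assumes "A \<subseteq> K" "card A \<le> m" "0 \<le> \<epsilon>" "\<epsilon> \<le> 1"
  shows "bind_pmf (thin_step K m \<epsilon> A) (\<lambda>A. pmf_of_set (extensions {E. E \<subseteq> K \<and> card E = m} A))
     = pmf_of_set (extensions {E. E \<subseteq> K \<and> card E = m} A)"
proof (cases "card A < m")
  case True
  interpret uniform_family "{E. E \<subseteq> K \<and> card E = m}" K m by (rule uniform_subsets)
  have finA: "finite A" using assms finK finite_subset by blast
  let ?h = "\<lambda>A. pmf_of_set (extensions {E. E \<subseteq> K \<and> card E = m} A)"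
  have b: "bind_pmf (pmf_of_set (K - A)) (\<lambda>X. ?h (insert X A)) = ?h A"
    using bind_next_edge_extensions[OF extensions_subsets_nonempty[OF assms(1,2)] finA True]
    unfolding next_edge_subsets[OF assms(1) True] .
  have "bind_pmf (thin_step K m \<epsilon> A) ?h
      = bind_pmf (pmf_of_set (K - A)) (\<lambda>X. bind_pmf (bernoulli_pmf (1 - \<epsilon>)) (\<lambda>c. ?h (if c then insert X A else A)))"
    using True by (simp add: thin_step_def bind_assoc_pmf bind_map_pmf)
  also have "\<dots> = bind_pmf (bernoulli_pmf (1 - \<epsilon>)) (\<lambda>c. bind_pmf (pmf_of_set (K - A)) (\<lambda>X. ?h (if c then insert X A else A)))"
    by (rule bind_commute_pmf)
  also have "\<dots> = bind_pmf (bernoulli_pmf (1 - \<epsilon>)) (\<lambda>c. ?h A)"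
  proof (rule bind_pmf_cong[OF refl])
    fix c show "bind_pmf (pmf_of_set (K - A)) (\<lambda>X. ?h (if c then insert X A else A)) = ?h A"
      using b by (cases c) simp_all
  qed
  finally show ?thesis by simp
next
  case False
  thus ?thesis by (simp add: thin_step_def bind_return_pmf)
qed

text \<open>An accepted candidate is always new, so it at least halves the weight; a rejection keeps
  it. The expected factor is at most (1 - \<epsilon>)/2 + \<epsilon>.\<close>

lemma nn_integral_thin_step_le:
  assumes "A \<subseteq> K" "card A \<le> m" "0 \<le> \<epsilon>" "\<epsilon> \<le> 1"
  shows "(\<integral>\<^sup>+A'. ennreal (of_bool (card A' < m) * (1/2) ^ card A') \<partial>thin_step K m \<epsilon> A)
    \<le> ennreal ((1 + \<epsilon>) / 2) * ennreal (of_bool (card A < m) * (1/2) ^ card A)"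
proof (cases "card A < m")
  case True
  have finA: "finite A" using assms finK finite_subset by blast
  have "card (K - A) > 0" using True m assms finA by (simp add: card_Diff_subset)
  hence "K - A \<noteq> {}" by (intro notI) simp
  moreover have "finite (K - A)" using finK by simp
  ultimately have ne: "K - A \<noteq> {}" "finite (K - A)" .
  let ?f = "\<lambda>A'. of_bool (card A' < m) * (1/2) ^ card A' :: real"
  have "(\<integral>\<^sup>+A'. ennreal (?f A') \<partial>thin_step K m \<epsilon> A)
      = (\<integral>\<^sup>+X. \<integral>\<^sup>+c. ennreal (?f (if c then insert X A else A)) \<partial>bernoulli_pmf (1 - \<epsilon>) \<partial>pmf_of_set (K - A))"
    using True by (simp add: thin_step_def)
  also have "\<dots> \<le> (\<integral>\<^sup>+X. ennreal ((1 + \<epsilon>) / 2 * (1/2) ^ card A) \<partial>pmf_of_set (K - A))"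
  proof (rule nn_integral_mono_AE, unfold AE_measure_pmf_iff, rule ballI)
    fix X assume "X \<in> set_pmf (pmf_of_set (K - A))"
    hence X: "X \<in> K - A" using ne by simp
    have 1: "?f (insert X A) \<le> (1/2) * (1/2) ^ card A" using X finA by simp
    have 2: "?f A = (1/2) ^ card A" using True by simp
    have "(\<integral>\<^sup>+c. ennreal (?f (if c then insert X A else A)) \<partial>bernoulli_pmf (1 - \<epsilon>))
        = ennreal (?f (insert X A)) * ennreal (1 - \<epsilon>) + ennreal (?f A) * ennreal \<epsilon>"
      using assms by (subst nn_integral_bernoulli_pmf) simp_all
    also have "\<dots> = ennreal (?f (insert X A) * (1 - \<epsilon>) + ?f A * \<epsilon>)"
      using assms by (simp add: ennreal_mult ennreal_plus)
    also have "\<dots> \<le> ennreal ((1/2) * (1/2) ^ card A * (1 - \<epsilon>) + (1/2) ^ card A * \<epsilon>)"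
      using 1 2 assms by (intro ennreal_leI add_mono mult_right_mono) auto
    also have "(1/2) * x * (1 - \<epsilon>) + x * \<epsilon> = (1 + \<epsilon>) / 2 * x" for x :: real
      by (simp add: field_simps)
    finally show "(\<integral>\<^sup>+c. ennreal (?f (if c then insert X A else A)) \<partial>bernoulli_pmf (1 - \<epsilon>))
        \<le> ennreal ((1 + \<epsilon>) / 2 * (1/2) ^ card A)" .
  qed
  also have "\<dots> = ennreal ((1 + \<epsilon>) / 2) * ennreal (?f A)"
  proof -
    have "ennreal ((1 + \<epsilon>) / 2 * (1/2) ^ card A) = ennreal ((1 + \<epsilon>) / 2) * ennreal ((1/2) ^ card A)"
      by (rule ennreal_mult) (use assms in auto)
    thus ?thesis using True by simp
  qed
  finally show ?thesis .
next
  case False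
  thus ?thesis by (simp add: thin_step_def)
qed

end

lemma prob_thin_chain_le:
  fixes K :: "'a set"
  assumes finK: "finite K" and m: "m \<le> card K" and \<epsilon>: "0 \<le> \<epsilon>" "\<epsilon> \<le> 1"
  shows "measure_pmf.prob (chain (thin_step K m \<epsilon>) {} T) {A. card A < m} \<le> 2 ^ m * ((1 + \<epsilon>) / 2) ^ T"
proof -
  let ?c = "(1 + \<epsilon>) / 2" and ?f = "\<lambda>A :: 'a set. ennreal (of_bool (card A < m) * (1/2) ^ card A)"
  \<comment> \<open>The first factor compensates the loss of \<open>?c\<close> per step that is
    still to come, which makes \<open>g\<close> a supermartingale.\<close>
  define g where "g = (\<lambda>t A. ennreal (?c ^ (T - t)) * ?f A)"
  have c: "?c \<ge> 0" using \<epsilon> by simp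
  have "(\<integral>\<^sup>+A. g T A \<partial>chain (thin_step K m \<epsilon>) {} T) \<le> g 0 {}"
  proof (rule nn_integral_chain_le[where S = "\<lambda>t. {A. A \<subseteq> K \<and> card A \<le> m}" and T = T])
    show "set_pmf (thin_step K m \<epsilon> A) \<subseteq> {A. A \<subseteq> K \<and> card A \<le> m}" if "A \<in> {A. A \<subseteq> K \<and> card A \<le> m}" for A
      using set_thin_step[OF finK m] that by simp
    show "(\<integral>\<^sup>+A'. g (Suc t) A' \<partial>thin_step K m \<epsilon> A) \<le> g t A"
      if "t < T" "A \<in> {A. A \<subseteq> K \<and> card A \<le> m}" for t A
    proof -
      have "(\<integral>\<^sup>+A'. g (Suc t) A' \<partial>thin_step K m \<epsilon> A) = ennreal (?c ^ (T - Suc t)) * (\<integral>\<^sup>+A'. ?f A' \<partial>thin_step K m \<epsilon> A)"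
        unfolding g_def by (simp add: nn_integral_cmult)
      also have "\<dots> \<le> ennreal (?c ^ (T - Suc t)) * (ennreal ?c * ?f A)"
        using nn_integral_thin_step_le[OF finK m, of A \<epsilon>] that \<epsilon> by (intro mult_left_mono) simp_all
      also have "\<dots> = ennreal (?c ^ (T - Suc t) * ?c) * ?f A"
        using c by (simp only: ennreal_mult zero_le_power mult.assoc)
      also have "?c ^ (T - Suc t) * ?c = ?c ^ (T - t)"
        using that(1) by (metis Suc_diff_Suc power_Suc2)
      finally show ?thesis unfolding g_def .
    qed
  qed auto
  also have "\<dots> \<le> ennreal (?c ^ T)" by (cases "0 < m") (simp_all add: g_def)
  finally have int: "(\<integral>\<^sup>+A. ?f A \<partial>chain (thin_step K m \<epsilon>) {} T) \<le> ennreal (?c ^ T)" by (simp add: g_def)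
  have "measure_pmf.prob (chain (thin_step K m \<epsilon>) {} T) {A. card A < m} \<le> ?c ^ T / (1/2) ^ m"
  proof (rule emeasure_le_nn_integral_divide[OF _ _ int])
    fix A :: "'a set" assume "A \<in> {A. card A < m}"
    thus "ennreal ((1/2) ^ m) \<le> ?f A" by (intro ennreal_leI) (simp add: power_decreasing)
  qed (use c in auto)
  thus ?thesis by (simp add: power_divide field_simps)
qed

context uniform_family
begin

lemma coupling_exists:
  assumes ne: "\<F> \<noteq> {}" and m: "m \<le> card K" and T: "T \<le> M" and \<epsilon>: "0 < \<epsilon>" "\<epsilon> \<le> 1"
  defines "bad \<equiv> {B. \<exists>e\<in>K - B. pmf (next_edge \<F> B) e < (1 - \<epsilon>) / real (card (K - B))}"
  shows "\<exists>p. map_pmf fst p = pmf_of_set {E. E \<subseteq> K \<and> card E = m} \<and> map_pmf snd p = pmf_of_set \<F> \<and>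
     measure_pmf.prob p {x. fst x \<subseteq> snd x}
       \<ge> 1 - (\<Sum>t<T. measure_pmf.prob (chain add_edge {} t) bad) - 2 ^ m * ((1 + \<epsilon>) / 2) ^ T"
proof -
  define ok where "ok = (\<lambda>(A, B). A \<subseteq> B \<and> B \<subseteq> K \<and> B \<noteq> K \<and> set_pmf (next_edge \<F> B) \<subseteq> K - B \<and> B \<notin> bad)"
  have "\<exists>J. map_pmf fst J = thin_step K m \<epsilon> (fst x) \<and> map_pmf snd J = add_edge (snd x) \<and>
      (ok x \<longrightarrow> (\<forall>y\<in>set_pmf J. fst y \<subseteq> snd y))" for x
  proof (cases "ok x")
    case True
    obtain A B where x: "x = (A, B)" by fastforce
    have ok: "A \<subseteq> B" "B \<subseteq> K" "B \<noteq> K" "set_pmf (next_edge \<F> B) \<subseteq> K - B" "B \<notin> bad"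
      using True by (simp_all add: ok_def x)
    have le: "(1 - \<epsilon>) / real (card (K - B)) \<le> pmf (next_edge \<F> B) e" if "e \<in> K - B" for e
      using ok(5) that unfolding bad_def by force
    have "\<exists>J. map_pmf fst J = thin_step K m \<epsilon> A \<and> map_pmf snd J = map_pmf (\<lambda>e. insert e B) (next_edge \<F> B) \<and>
       (\<forall>x\<in>set_pmf J. fst x \<subseteq> snd x)"
      by (rule coupled_step_exists[OF finK ok(1-4) \<epsilon> le])
    then obtain J where "map_pmf fst J = thin_step K m \<epsilon> A" "map_pmf snd J = add_edge B"
      "\<forall>x\<in>set_pmf J. fst x \<subseteq> snd x" unfolding add_edge_def by (elim exE conjE)
    thus ?thesis unfolding x by (intro exI[of _ J]) simp
  next
    case False
    \<comment> \<open>Outside \<open>ok\<close> nothing is asked of containment, but the marginals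
      must remain correct; independent moves achieve this.\<close>
    thus ?thesis
      by (intro exI[of _ "pair_pmf (thin_step K m \<epsilon> (fst x)) (add_edge (snd x))"])
         (simp add: map_fst_pair_pmf map_snd_pair_pmf)
  qed
  then obtain J where J: "\<And>x. map_pmf fst (J x) = thin_step K m \<epsilon> (fst x)" "\<And>x. map_pmf snd (J x) = add_edge (snd x)"
      "\<And>x y. ok x \<Longrightarrow> y \<in> set_pmf (J x) \<Longrightarrow> fst y \<subseteq> snd y" by metis
  define Z where "Z = chain J ({}, {})"
  have Z: "map_pmf fst (Z t) = chain (thin_step K m \<epsilon>) {} t" "map_pmf snd (Z t) = chain add_edge {} t" for t
    using map_chain[where f = fst and \<kappa> = J and \<kappa>' = "thin_step K m \<epsilon>" and x = "({}, {})" and t = t, OF J(1)]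
      map_chain[where f = snd and \<kappa> = J and \<kappa>' = add_edge and x = "({}, {})" and t = t, OF J(2)]
    by (simp_all add: Z_def)
  have "extensions \<F> {} = \<F>" by (simp add: extensions_def)
  hence S0: "{} \<in> states 0" using ne by (simp add: states_def)
  have SB: "set_pmf (chain add_edge {} t) \<subseteq> states t" if "t \<le> T" for t
    by (rule set_chain[where T = T and S = states and \<kappa> = add_edge, OF S0 _ that]) (use set_add_edge T in auto)
  have SA: "set_pmf (chain (thin_step K m \<epsilon>) {} T) \<subseteq> {A. A \<subseteq> K \<and> card A \<le> m}"
    by (rule set_chain[where T = T and S = "\<lambda>_. {A. A \<subseteq> K \<and> card A \<le> m}"])
       (use set_thin_step[OF finK m, of _ \<epsilon>] in auto)
  let ?N = "{x. \<not> fst x \<subseteq> snd x}"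
  \<comment> \<open>Containment fails after a step only if it failed before or the step started from
    a bad set; the failures add up by a union bound.\<close>
  have fail: "t \<le> T \<Longrightarrow> emeasure (Z t) ?N \<le> (\<Sum>s<t. emeasure (Z s) {x. snd x \<in> bad})" for t
  proof (induction t)
    case 0
    thus ?case by (simp add: Z_def indicator_def)
  next
    case (Suc t)
    have step: "emeasure (J x) ?N \<le> indicator ?N x + indicator {x. snd x \<in> bad} x" if x: "x \<in> set_pmf (Z t)" for x
    proof (cases "fst x \<subseteq> snd x \<and> snd x \<notin> bad")
      case True
      have "snd x \<in> set_pmf (map_pmf snd (Z t))" using x by simp
      hence B: "snd x \<in> states t" using SB[of t] Suc.prems unfolding Z by auto
      hence B': "snd x \<subseteq> K" "card (snd x) = t" "extensions \<F> (snd x) \<noteq> {}" by (simp_all add: states_def)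
      have tM: "t < M" using Suc.prems T by simp
      have finB: "finite (snd x)" using B' finK finite_subset by blast
      obtain R where "R \<in> extensions \<F> (snd x)" using B' by blast
      hence R: "snd x \<subseteq> R" "R \<subseteq> K" "card R = M" using ext_sub by blast+
      hence "snd x \<noteq> K" using B' tM by auto
      moreover have "set_pmf (next_edge \<F> (snd x)) \<subseteq> K - snd x"
        unfolding set_next_edge[OF B'(3) finB tM[folded B'(2)]] using ext_sub by blast
      ultimately have "ok x" using True B' by (simp add: ok_def case_prod_unfold)
      hence "set_pmf (J x) \<inter> ?N = {}" using J(3) by blast
      thus ?thesis by (simp add: measure_pmf.emeasure_eq_measure measure_pmf_zero_iff[THEN iffD2])
    next
      case False
      have "emeasure (J x) ?N \<le> 1" by (rule measure_pmf.emeasure_le_1)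
      also have "1 \<le> indicator ?N x + (indicator {x. snd x \<in> bad} x :: ennreal)"
        using False by (auto simp: indicator_def)
      finally show ?thesis .
    qed
    have "emeasure (Z (Suc t)) ?N = (\<integral>\<^sup>+x. emeasure (J x) ?N \<partial>Z t)" by (simp add: Z_def)
    also have "\<dots> \<le> (\<integral>\<^sup>+x. indicator ?N x + indicator {x. snd x \<in> bad} x \<partial>Z t)"
      by (rule nn_integral_mono_AE) (use step in \<open>auto simp: AE_measure_pmf_iff\<close>)
    also have "\<dots> = emeasure (Z t) ?N + emeasure (Z t) {x. snd x \<in> bad}" by (simp add: nn_integral_add)
    also have "\<dots> \<le> (\<Sum>s<t. emeasure (Z s) {x. snd x \<in> bad}) + emeasure (Z t) {x. snd x \<in> bad}"
      using Suc by (intro add_right_mono) simp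
    finally show ?case by simp
  qed
  have Zbad: "emeasure (Z s) {x. snd x \<in> bad} = ennreal (measure_pmf.prob (chain add_edge {} s) bad)" for s
    by (simp add: vimage_def flip: Z measure_pmf.emeasure_eq_measure)
  have Zthin: "emeasure (Z T) {x. card (fst x) < m} \<le> ennreal (2 ^ m * ((1 + \<epsilon>) / 2) ^ T)"
  proof -
    have "emeasure (Z T) {x. card (fst x) < m} = ennreal (measure_pmf.prob (chain (thin_step K m \<epsilon>) {} T) {A. card A < m})"
      by (simp add: vimage_def flip: Z measure_pmf.emeasure_eq_measure)
    also have "\<dots> \<le> ennreal (2 ^ m * ((1 + \<epsilon>) / 2) ^ T)"
      by (rule ennreal_leI[OF prob_thin_chain_le[OF finK m]]) (use \<epsilon> in auto)
    finally show ?thesis .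
  qed
  let ?S = "{E. E \<subseteq> K \<and> card E = m}"
  let ?h = "\<lambda>A. pmf_of_set (extensions ?S A)" and ?h' = "\<lambda>B. pmf_of_set (extensions \<F> B)"
  \<comment> \<open>Both coordinates are completed independently, which makes the marginals exactly
    uniform. If the thinned set already has \<open>m\<close> elements, it is its own only
    completion, and containment survives.\<close>
  define p where "p = bind_pmf (Z T) (\<lambda>x. pair_pmf (?h (fst x)) (?h' (snd x)))"
  have "map_pmf fst p = bind_pmf (map_pmf fst (Z T)) ?h"
    by (simp add: p_def map_bind_pmf map_fst_pair_pmf bind_map_pmf)
  also have "\<dots> = ?h {}" unfolding Z
    by (rule bind_chain[where T = T and S = "\<lambda>_. {A. A \<subseteq> K \<and> card A \<le> m}"])
       (use set_thin_step[OF finK m, of _ \<epsilon>] bind_thin_step[OF finK m, of _ \<epsilon>] \<epsilon> in auto)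
  also have "extensions ?S {} = ?S" by (simp add: extensions_def)
  finally have p1: "map_pmf fst p = pmf_of_set ?S" .
  have "map_pmf snd p = bind_pmf (map_pmf snd (Z T)) ?h'"
    by (simp add: p_def map_bind_pmf map_snd_pair_pmf bind_map_pmf)
  also have "\<dots> = ?h' {}" unfolding Z
    by (rule bind_chain[where T = T and S = states])
       (use S0 set_add_edge bind_add_edge T in auto)
  also have "extensions \<F> {} = \<F>" by (simp add: extensions_def)
  finally have p2: "map_pmf snd p = pmf_of_set \<F>" .
  have last: "emeasure (pair_pmf (?h (fst x)) (?h' (snd x))) ?N \<le> indicator ?N x + indicator {x. card (fst x) < m} x"
    if x: "x \<in> set_pmf (Z T)" for x
  proof (cases "fst x \<subseteq> snd x \<and> \<not> card (fst x) < m")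
    case True
    have "fst x \<in> set_pmf (map_pmf fst (Z T))" using x by simp
    hence "fst x \<in> {A. A \<subseteq> K \<and> card A \<le> m}" using SA unfolding Z by blast
    hence A: "fst x \<subseteq> K" "card (fst x) = m" using True by auto
    have "snd x \<in> set_pmf (map_pmf snd (Z T))" using x by simp
    hence "snd x \<in> states T" using SB[of T] unfolding Z by auto
    hence B: "extensions \<F> (snd x) \<noteq> {}" by (simp add: states_def)
    have extA: "extensions ?S (fst x) = {fst x}"
    proof -
      have "E = fst x" if "E \<in> extensions ?S (fst x)" for E
      proof -
        have E: "fst x \<subseteq> E" "E \<subseteq> K" "card E = m" using that by (auto simp: extensions_def)
        have "finite E" using E finK finite_subset by blast
        thus ?thesis using card_subset_eq[of E "fst x"] E A by auto
      qed
      moreover have "fst x \<in> extensions ?S (fst x)" using A by (simp add: extensions_def)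
      ultimately show ?thesis by blast
    qed
    have "set_pmf (pair_pmf (?h (fst x)) (?h' (snd x))) \<inter> ?N = {}"
    proof -
      have "set_pmf (?h' (snd x)) = extensions \<F> (snd x)" using B finite_ext by simp
      moreover have "set_pmf (?h (fst x)) = {fst x}" unfolding extA by simp
      moreover have "\<forall>R\<in>extensions \<F> (snd x). fst x \<subseteq> R" using ext_sub True by blast
      ultimately show ?thesis by fastforce
    qed
    thus ?thesis by (simp only: measure_pmf.emeasure_eq_measure measure_pmf_zero_iff[THEN iffD2] ennreal_0 zero_le)
  next
    case False
    have "emeasure (pair_pmf (?h (fst x)) (?h' (snd x))) ?N \<le> 1" by (rule measure_pmf.emeasure_le_1)
    also have "1 \<le> indicator ?N x + (indicator {x. card (fst x) < m} x :: ennreal)"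
      using False by (auto simp: indicator_def)
    finally show ?thesis .
  qed
  let ?\<beta> = "\<Sum>t<T. measure_pmf.prob (chain add_edge {} t) bad" and ?\<eta> = "2 ^ m * ((1 + \<epsilon>) / 2) ^ T"
  have "emeasure p ?N = (\<integral>\<^sup>+x. emeasure (pair_pmf (?h (fst x)) (?h' (snd x))) ?N \<partial>Z T)" by (simp add: p_def)
  also have "\<dots> \<le> (\<integral>\<^sup>+x. indicator ?N x + indicator {x. card (fst x) < m} x \<partial>Z T)"
    by (rule nn_integral_mono_AE) (use last in \<open>auto simp: AE_measure_pmf_iff\<close>)
  also have "\<dots> = emeasure (Z T) ?N + emeasure (Z T) {x. card (fst x) < m}" by (simp add: nn_integral_add)
  also have "\<dots> \<le> ennreal ?\<beta> + ennreal ?\<eta>"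
    using fail[of T] Zthin unfolding Zbad by (intro add_mono) (simp_all add: sum_ennreal)
  also have "\<dots> = ennreal (?\<beta> + ?\<eta>)"
    using \<epsilon> by (intro ennreal_plus[symmetric] sum_nonneg) auto
  finally have le: "ennreal (measure_pmf.prob p ?N) \<le> ennreal (?\<beta> + ?\<eta>)"
    unfolding measure_pmf.emeasure_eq_measure .
  have "0 \<le> ?\<beta> + ?\<eta>" using \<epsilon> by (intro add_nonneg_nonneg sum_nonneg) auto
  with le have "measure_pmf.prob p ?N \<le> ?\<beta> + ?\<eta>" by (simp only: ennreal_le_iff)
  moreover have "measure_pmf.prob p ?N = 1 - measure_pmf.prob p {x. fst x \<subseteq> snd x}"
    using measure_pmf.prob_compl[of "{x. fst x \<subseteq> snd x}" p] by (simp add: Compl_eq_Diff_UNIV[symmetric] Collect_neg_eq)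
  ultimately show ?thesis using p1 p2 by (intro exI[of _ p]) simp
qed

end

section \<open>Concentration of residual degrees\<close>

text \<open>From \<open>(1 - x + x\<^sup>2) * (1 + x) = 1 + x ^ 3\<close> and
  \<open>1 + x \<le> exp x\<close>.\<close>

lemma exp_minus_le_quadratic:
  fixes x :: real
  assumes "0 \<le> x"
  shows "exp (- x) \<le> 1 - x + x\<^sup>2"
proof -
  have "1 \<le> (1 - x + x\<^sup>2) * (1 + x)" using assms by (simp add: power2_eq_square algebra_simps)
  also have "\<dots> \<le> (1 - x + x\<^sup>2) * exp x"
  proof (rule mult_left_mono)
    have "1 - x + x\<^sup>2 = (1 - x / 2)\<^sup>2 + 3 / 4 * x\<^sup>2" by (simp add: power2_eq_square algebra_simps)
    thus "0 \<le> 1 - x + x\<^sup>2" by simp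
  qed (rule exp_ge_add_one_self)
  finally show ?thesis by (simp add: exp_minus field_simps)
qed

context uniform_family
begin

text \<open>All members meet \<open>D\<close> in the same number of elements, so the hidden part of
  every extension contains equally many elements of \<open>D\<close>, and averaging over extensions
  changes nothing.\<close>

lemma prob_next_edge:
  assumes ne: "extensions \<F> B \<noteq> {}" and B: "finite B" "card B < M"
    and D: "\<And>R. R \<in> \<F> \<Longrightarrow> card (R \<inter> D) = d"
  shows "measure_pmf.prob (next_edge \<F> B) D = real (d - card (B \<inter> D)) / (real M - real (card B))"
proof -
  let ?p = "real (d - card (B \<inter> D)) / (real M - real (card B))"
  have "emeasure (next_edge \<F> B) D = (\<integral>\<^sup>+R. emeasure (pmf_of_set (R - B)) D \<partial>pmf_of_set (extensions \<F> B))"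
    by (simp add: next_edge_def)
  also have "\<dots> = (\<integral>\<^sup>+R. ennreal ?p \<partial>pmf_of_set (extensions \<F> B))"
  proof (rule nn_integral_cong_AE, unfold AE_measure_pmf_iff, rule ballI)
    fix R assume "R \<in> set_pmf (pmf_of_set (extensions \<F> B))"
    hence R: "R \<in> extensions \<F> B" using ne finite_ext by simp
    have fin: "finite (R - B)" using ext_sub[OF R] by simp
    have c: "card (R - B) = M - card B" using ext_sub[OF R] B by (simp add: card_Diff_subset)
    hence ne': "R - B \<noteq> {}" using B by (intro notI) simp
    have "(R - B) \<inter> D = (R \<inter> D) - (B \<inter> D)" by blast
    moreover have "card ((R \<inter> D) - (B \<inter> D)) = card (R \<inter> D) - card (B \<inter> D)"
      by (rule card_Diff_subset) (use B ext_sub[OF R] in auto)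
    moreover have "card (R \<inter> D) = d" using R D by (simp add: extensions_def)
    ultimately have "card ((R - B) \<inter> D) = d - card (B \<inter> D)" by simp
    thus "emeasure (pmf_of_set (R - B)) D = ennreal ?p"
      using emeasure_pmf_of_set[OF ne' fin, of D] c B by (simp add: of_nat_diff)
  qed
  finally have "ennreal (measure_pmf.prob (next_edge \<F> B) D) = ennreal ?p"
    by (simp add: measure_pmf.emeasure_eq_measure)
  thus ?thesis using B by (subst (asm) ennreal_inj) auto
qed

text \<open>The bases \<open>w s\<close> below turn the powers \<open>w s ^ residual\<close> into a supermartingale, by Bernoulli's inequality.\<close>

lemma nn_integral_residual_power_le:
  assumes \<F>: "\<F> \<noteq> {}" and t: "t < M" and z: "z > 0"
    and D: "\<And>R. R \<in> \<F> \<Longrightarrow> card (R \<inter> D) = d"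
  shows "(\<integral>\<^sup>+B. ennreal (z ^ (d - card (B \<inter> D))) \<partial>chain add_edge {} t)
    \<le> ennreal ((1 + (real M - real t) / real M * (z - 1)) ^ d)"
proof -
  \<comment> \<open>\<open>w\<close> solves backwards, from \<open>w t = z\<close>, the recursion
    \<open>w s = w' * (1 - c)\<close> below. At time 0 it gives the generating function of a
    binomial variable with \<open>d\<close> trials and success probability
    \<open>(M - t) / M\<close>, which thus dominates that of the residual count.\<close>
  define w where "w = (\<lambda>s. 1 + (real M - real t) / (real M - real s) * (z - 1))"
  define g where "g = (\<lambda>s B. ennreal (w s ^ (d - card (B \<inter> D))))"
  have w_pos: "w s > 0" if "s \<le> t" for s
  proof -
    define a where "a = (real M - real t) / (real M - real s)"
    have a: "0 < a" "a \<le> 1" using t that by (simp_all add: a_def)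
    have "w s = 1 + a * (z - 1)" by (simp only: w_def a_def)
    also have "\<dots> = (1 - a) + a * z" by (simp add: algebra_simps)
    finally have "w s = (1 - a) + a * z" .
    moreover have "a * z > 0" using a z by simp
    ultimately show ?thesis using a by linarith
  qed
  have "extensions \<F> {} = \<F>" by (simp add: extensions_def)
  hence S0: "{} \<in> states 0" using \<F> by (simp add: states_def)
  have "(\<integral>\<^sup>+B. g t B \<partial>chain add_edge {} t) \<le> g 0 {}"
  proof (rule nn_integral_chain_le[where S = states and T = t])
    show "{} \<in> states 0" by (rule S0)
    show "set_pmf (add_edge B) \<subseteq> states (Suc s)" if "s < t" "B \<in> states s" for s B
      using set_add_edge[OF that(2)] that(1) t by simp
    show "(\<integral>\<^sup>+B'. g (Suc s) B' \<partial>add_edge B) \<le> g s B" if s: "s < t" and B: "B \<in> states s" for s B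
    proof -
      have Bs: "B \<subseteq> K" "card B = s" "extensions \<F> B \<noteq> {}" using B by (simp_all add: states_def)
      have fin: "finite B" using finite_subset[OF Bs(1) finK] .
      have sM: "card B < M" using Bs s t by simp
      define y where "y = d - card (B \<inter> D)"
      define p where "p = real y / (real M - real s)"
      define w' where "w' = w (Suc s)"
      have w': "w' > 0" unfolding w'_def by (rule w_pos) (use s in simp)
      have dM: "real M - real s > 0" "real M - real (Suc s) > 0" using s t by simp_all
      have prob: "measure_pmf.prob (next_edge \<F> B) D = p"
        using prob_next_edge[OF Bs(3) fin sM D] by (simp add: p_def y_def Bs(2))
      have p01: "0 \<le> p" "p \<le> 1" unfolding prob[symmetric] by simp_all
      have "(\<integral>\<^sup>+B'. g (Suc s) B' \<partial>add_edge B) = (\<integral>\<^sup>+e. g (Suc s) (insert e B) \<partial>next_edge \<F> B)"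
        by (simp add: add_edge_def)
      also have "\<dots> = (\<integral>\<^sup>+e. ennreal (w' ^ (y - 1)) * indicator D e + ennreal (w' ^ y) * indicator (- D) e \<partial>next_edge \<F> B)"
      proof (rule nn_integral_cong_AE, unfold AE_measure_pmf_iff, rule ballI)
        fix e assume "e \<in> set_pmf (next_edge \<F> B)"
        hence e: "e \<notin> B" unfolding set_next_edge[OF Bs(3) fin sM] by simp
        show "g (Suc s) (insert e B) = ennreal (w' ^ (y - 1)) * indicator D e + ennreal (w' ^ y) * indicator (- D) e"
        proof (cases "e \<in> D")
          case True
          hence "card (insert e B \<inter> D) = Suc (card (B \<inter> D))" using e fin by simp
          hence "d - card (insert e B \<inter> D) = y - 1" by (simp add: y_def)
          thus ?thesis using True by (simp add: g_def w'_def)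
        next
          case False
          thus ?thesis by (simp add: g_def w'_def y_def)
        qed
      qed
      also have "\<dots> = ennreal (w' ^ (y - 1)) * emeasure (next_edge \<F> B) D + ennreal (w' ^ y) * emeasure (next_edge \<F> B) (- D)"
        by (subst nn_integral_add) (simp_all add: nn_integral_cmult)
      also have "emeasure (next_edge \<F> B) D = ennreal p"
        by (simp add: measure_pmf.emeasure_eq_measure prob)
      also have "emeasure (next_edge \<F> B) (- D) = ennreal (1 - p)"
        using measure_pmf.prob_compl[of D "next_edge \<F> B"] prob
        by (simp add: measure_pmf.emeasure_eq_measure Compl_eq_Diff_UNIV)
      also have "ennreal (w' ^ (y - 1)) * ennreal p + ennreal (w' ^ y) * ennreal (1 - p)
          = ennreal (w' ^ (y - 1) * p + w' ^ y * (1 - p))"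
        using w' p01 by (simp add: ennreal_mult ennreal_plus)
      also have "w' ^ (y - 1) * p + w' ^ y * (1 - p) \<le> w s ^ y"
      proof -
        \<comment> \<open>With this \<open>c\<close> one step multiplies \<open>w' ^ y\<close> by
          exactly \<open>1 - y * c\<close>, and Bernoulli's inequality bounds that by
          \<open>(1 - c) ^ y\<close>.\<close>
        define c where "c = (1 - 1 / w') / (real M - real s)"
        have ws: "w s = w' * (1 - c)"
        proof -
          have "w' * (1 - 1 / w') = w' - 1" using w' by (simp add: field_simps)
          hence "w' * c = (w' - 1) / (real M - real s)" by (simp add: c_def)
          hence "w' * (1 - c) = w' - (w' - 1) / (real M - real s)" by (simp add: right_diff_distrib)
          also have "\<dots> = 1 + (w' - 1) * (1 - 1 / (real M - real s))" using dM by (simp add: field_simps)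
          also have "(w' - 1) * (1 - 1 / (real M - real s)) = (real M - real t) / (real M - real s) * (z - 1)"
            using dM unfolding w'_def w_def by (simp add: divide_simps)
          finally show ?thesis by (simp add: w_def)
        qed
        have "w' ^ (y - 1) * p + w' ^ y * (1 - p) = w' ^ y * (1 + real y * (- c))"
        proof (cases y)
          \<comment> \<open>The exponent \<open>y - 1\<close> is truncated here, but its weight
            \<open>p\<close> vanishes.\<close>
          case 0
          thus ?thesis by (simp add: p_def)
        next
          case (Suc y')
          have "p * (w' - 1) = w' * (real y * c)" using w' dM by (simp add: p_def c_def divide_simps) 
          hence "p + w' * (1 - p) = w' * (1 + real y * (- c))" by (simp add: algebra_simps)
          moreover have "w' ^ (y - 1) * p + w' ^ y * (1 - p) = w' ^ y' * (p + w' * (1 - p))"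
            using Suc by (simp add: distrib_left mult_ac)
          moreover have "w' ^ y * b = w' ^ y' * (w' * b)" for b using Suc by (simp add: mult_ac)
          ultimately show ?thesis by (simp only:)
        qed
        also have "\<dots> \<le> w' ^ y * (1 + - c) ^ y"
        proof (intro mult_left_mono Bernoulli_inequality)
          have "0 < w s" by (rule w_pos) (use s in simp)
          hence "0 < 1 - c" unfolding ws using w' by (simp add: zero_less_mult_iff)
          thus "-1 \<le> - c" by simp
        qed (use w' in simp)
        finally show ?thesis by (simp add: ws power_mult_distrib)
      qed
      finally show ?thesis by (simp add: g_def y_def ennreal_leI)
    qed
  qed simp
  moreover have "w t = z" "w 0 = 1 + (real M - real t) / real M * (z - 1)" using t by (simp_all add: w_def)
  ultimately show ?thesis by (simp add: g_def)
qed

text \<open>Chernoff bound with \<open>exp x\<close> for x = \<delta>/2 and x = -\<delta>/2. With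
  \<open>exp x - 1\<close> at most x + x^2, both exponents become \<mu> times x^2 - \<delta>|x|,
  which is smallest, namely -\<delta>^2/4, at these values.\<close>

lemma prob_residual_tail_le:
  assumes \<F>: "\<F> \<noteq> {}" and t: "t < M" and \<delta>: "0 \<le> \<delta>" "\<delta> \<le> 1"
    and D: "\<And>R. R \<in> \<F> \<Longrightarrow> card (R \<inter> D) = d"
  defines "\<mu> \<equiv> (real M - real t) / real M * real d"
  shows "measure_pmf.prob (chain add_edge {} t) {B. \<bar>real (d - card (B \<inter> D)) - \<mu>\<bar> > \<delta> * \<mu>}
    \<le> 2 * exp (- (\<delta>\<^sup>2 * \<mu> / 4))"
proof -
  let ?P = "measure_pmf.prob (chain add_edge {} t)"
  let ?Y = "\<lambda>B. real (d - card (B \<inter> D))"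
  define \<tau> where "\<tau> = (real M - real t) / real M"
  have \<tau>: "0 \<le> \<tau>" "\<tau> \<le> 1" using t by (simp_all add: \<tau>_def)
  have \<mu>: "\<mu> = \<tau> * real d" by (simp add: \<mu>_def \<tau>_def)
  have \<mu>0: "\<mu> \<ge> 0" unfolding \<mu> using \<tau> by simp
  have chernoff: "?P A \<le> exp (- (\<delta>\<^sup>2 * \<mu> / 4))"
    if A: "\<And>B. B \<in> A \<Longrightarrow> x * b \<le> x * ?Y B" and x: "\<mu> * (exp x - 1) - x * b \<le> - (\<delta>\<^sup>2 * \<mu> / 4)" for A x b
  proof -
    have "(1 + \<tau> * (exp x - 1)) ^ d \<le> exp (\<tau> * (exp x - 1)) ^ d"
    proof (rule power_mono[OF exp_ge_add_one_self])
      have "0 \<le> (1 - \<tau>) + \<tau> * exp x" using \<tau> by simp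
      thus "0 \<le> 1 + \<tau> * (exp x - 1)" by (simp add: algebra_simps)
    qed
    also have "\<dots> = exp (\<mu> * (exp x - 1))" by (simp add: \<mu> mult_ac flip: exp_of_nat_mult)
    finally have "ennreal ((1 + \<tau> * (exp x - 1)) ^ d) \<le> ennreal (exp (\<mu> * (exp x - 1)))" by (rule ennreal_leI)
    moreover have "(\<integral>\<^sup>+B. ennreal (exp x ^ (d - card (B \<inter> D))) \<partial>chain add_edge {} t)
        \<le> ennreal ((1 + \<tau> * (exp x - 1)) ^ d)"
      unfolding \<tau>_def by (rule nn_integral_residual_power_le[OF \<F> t exp_gt_zero D])
    ultimately have int: "(\<integral>\<^sup>+B. ennreal (exp x ^ (d - card (B \<inter> D))) \<partial>chain add_edge {} t)
        \<le> ennreal (exp (\<mu> * (exp x - 1)))" by (rule order_trans[rotated])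
    have "?P A \<le> exp (\<mu> * (exp x - 1)) / exp (x * b)"
    proof (rule emeasure_le_nn_integral_divide[OF _ _ int])
      fix B assume "B \<in> A"
      from A[OF this] show "ennreal (exp (x * b)) \<le> ennreal (exp x ^ (d - card (B \<inter> D)))"
        by (intro ennreal_leI) (simp add: mult.commute flip: exp_of_nat_mult)
    qed simp_all
    also have "\<dots> = exp (\<mu> * (exp x - 1) - x * b)" by (simp add: exp_diff)
    also have "\<dots> \<le> exp (- (\<delta>\<^sup>2 * \<mu> / 4))" using x by simp
    finally show ?thesis .
  qed
  have up: "?P {B. ?Y B \<ge> (1 + \<delta>) * \<mu>} \<le> exp (- (\<delta>\<^sup>2 * \<mu> / 4))"
  proof (rule chernoff[where x = "\<delta> / 2" and b = "(1 + \<delta>) * \<mu>"])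
    have "exp (\<delta> / 2) - 1 \<le> \<delta> / 2 + (\<delta> / 2)\<^sup>2" using exp_bound[of "\<delta> / 2"] \<delta> by simp
    hence "\<mu> * (exp (\<delta> / 2) - 1) \<le> \<mu> * (\<delta> / 2 + (\<delta> / 2)\<^sup>2)" using \<mu>0 by (intro mult_left_mono) auto
    moreover have "\<mu> * (\<delta> / 2 + (\<delta> / 2)\<^sup>2) - \<delta> / 2 * ((1 + \<delta>) * \<mu>) = - (\<delta>\<^sup>2 * \<mu> / 4)"
      by (simp add: power2_eq_square field_simps)
    ultimately show "\<mu> * (exp (\<delta> / 2) - 1) - \<delta> / 2 * ((1 + \<delta>) * \<mu>) \<le> - (\<delta>\<^sup>2 * \<mu> / 4)"
      by linarith
  qed (use \<delta> in \<open>simp add: mult_left_mono\<close>)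
  have lo: "?P {B. ?Y B \<le> (1 - \<delta>) * \<mu>} \<le> exp (- (\<delta>\<^sup>2 * \<mu> / 4))"
  proof (rule chernoff[where x = "- (\<delta> / 2)" and b = "(1 - \<delta>) * \<mu>"])
    have "exp (- (\<delta> / 2)) - 1 \<le> - (\<delta> / 2) + (\<delta> / 2)\<^sup>2" using exp_minus_le_quadratic[of "\<delta> / 2"] \<delta> by simp
    hence "\<mu> * (exp (- (\<delta> / 2)) - 1) \<le> \<mu> * (- (\<delta> / 2) + (\<delta> / 2)\<^sup>2)" using \<mu>0 by (intro mult_left_mono) auto
    moreover have "\<mu> * (- (\<delta> / 2) + (\<delta> / 2)\<^sup>2) - - (\<delta> / 2) * ((1 - \<delta>) * \<mu>) = - (\<delta>\<^sup>2 * \<mu> / 4)"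
      by (simp add: power2_eq_square field_simps)
    ultimately show "\<mu> * (exp (- (\<delta> / 2)) - 1) - - (\<delta> / 2) * ((1 - \<delta>) * \<mu>) \<le> - (\<delta>\<^sup>2 * \<mu> / 4)"
      by linarith
  qed (use \<delta> in \<open>simp add: mult_left_mono\<close>)
  have "?P {B. \<bar>?Y B - \<mu>\<bar> > \<delta> * \<mu>} \<le> ?P ({B. ?Y B \<ge> (1 + \<delta>) * \<mu>} \<union> {B. ?Y B \<le> (1 - \<delta>) * \<mu>})"
    by (rule measure_pmf.finite_measure_mono) (auto simp: algebra_simps abs_if split: if_splits)
  also have "\<dots> \<le> ?P {B. ?Y B \<ge> (1 + \<delta>) * \<mu>} + ?P {B. ?Y B \<le> (1 - \<delta>) * \<mu>}"
    by (rule measure_Un_le) simp_all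
  finally show ?thesis using up lo by simp
qed

end

section \<open>Random regular hypergraphs\<close>

text \<open>A graph with the right number of edges that minimises the sum of the squared degrees is regular: otherwise
  moving an edge from a vertex of large degree to one of small degree decreases that sum.\<close>

lemma regular_kgraphs_nonempty:
  assumes k: "k \<ge> 1" and M: "k * M = n * d" "M \<le> n choose k"
  shows "regular_kgraphs k n d \<noteq> {}"
proof -
  define P where "P = (\<lambda>F. F \<subseteq> ksets k n \<and> card F = M)"
  define \<Phi> where "\<Phi> = (\<lambda>F. \<Sum>u\<in>{1..n}. (hdegree F u)\<^sup>2)"
  obtain F0 where "F0 \<subseteq> ksets k n" "card F0 = M"
    by (rule obtain_subset_with_card_n[of M "ksets k n"]) (simp_all add: card_ksets M(2))
  hence "P F0" by (simp add: P_def)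
  from ex_has_least_nat[where P = P and k = F0 and m = \<Phi>, OF this]
  obtain F where F: "P F" and "\<forall>G. P G \<longrightarrow> \<Phi> F \<le> \<Phi> G" by (elim exE conjE)
  hence least: "\<Phi> F \<le> \<Phi> G" if "P G" for G using that by simp
  have sub: "F \<subseteq> ksets k n" and cF: "card F = M" using F by (simp_all add: P_def)
  have fin: "finite F" using sub finite_subset[OF _ finite_ksets] by blast
  have total: "(\<Sum>u\<in>{1..n}. hdegree F u) = (\<Sum>u\<in>{1..n}. d)"
    unfolding handshake[OF sub] cF M(1) by simp
  have "\<forall>u\<in>{1..n}. hdegree F u = d"
  proof (rule ccontr)
    assume "\<not> ?thesis"
    then obtain x where x: "x \<in> {1..n}" "hdegree F x \<noteq> d" by blast
    have "\<exists>u\<in>{1..n}. hdegree F u > d"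
    proof (rule ccontr)
      assume "\<not> ?thesis"
      hence le: "hdegree F u \<le> d" if "u \<in> {1..n}" for u using that by (simp add: not_less)
      have "(\<Sum>u\<in>{1..n}. hdegree F u) < (\<Sum>u\<in>{1..n}. d)"
      proof (rule sum_strict_mono_ex1)
        show "\<exists>u\<in>{1..n}. hdegree F u < d" using x le[OF x(1)] by (intro bexI[of _ x]) simp_all
      qed (use le in simp_all)
      thus False using total by simp
    qed
    then obtain u where u: "u \<in> {1..n}" "hdegree F u > d" by blast
    have "\<exists>w\<in>{1..n}. hdegree F w < d"
    proof (rule ccontr)
      assume "\<not> ?thesis"
      hence le: "d \<le> hdegree F w" if "w \<in> {1..n}" for w using that by (simp add: not_less)
      have "(\<Sum>u\<in>{1..n}. d) < (\<Sum>u\<in>{1..n}. hdegree F u)"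
      proof (rule sum_strict_mono_ex1)
        show "\<exists>u\<in>{1..n}. d < hdegree F u" using u by (intro bexI[of _ u]) simp_all
      qed (use le in simp_all)
      thus False using total by simp
    qed
    then obtain w where w: "w \<in> {1..n}" "hdegree F w < d" by blast
    have uw: "u \<noteq> w" using u w by auto
    let ?U = "{e\<in>F. u \<in> e \<and> w \<notin> e}" and ?W = "{e\<in>F. w \<in> e \<and> u \<notin> e}" and ?UW = "{e\<in>F. u \<in> e \<and> w \<in> e}"
    let ?m = "\<lambda>e. insert w (e - {u})"
    have dU: "hdegree F u = card ?U + card ?UW"
    proof -
      have "{e\<in>F. u \<in> e} = ?U \<union> ?UW" by blast
      moreover have "card (?U \<union> ?UW) = card ?U + card ?UW"
        by (rule card_Un_disjoint) (use fin in auto)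
      ultimately show ?thesis by (simp only: hdegree_def)
    qed
    have dW: "hdegree F w = card ?W + card ?UW"
    proof -
      have "{e\<in>F. w \<in> e} = ?W \<union> ?UW" by blast
      moreover have "card (?W \<union> ?UW) = card ?W + card ?UW"
        by (rule card_Un_disjoint) (use fin in auto)
      ultimately show ?thesis by (simp only: hdegree_def)
    qed
    \<comment> \<open>More edges contain only \<open>u\<close> than contain only \<open>w\<close>,
      and exchanging \<open>u\<close> for \<open>w\<close> is injective, so some exchanged edge is
      not yet present.\<close>
    have "\<exists>e\<in>?U. ?m e \<notin> F"
    proof (rule ccontr)
      assume "\<not> ?thesis"
      hence "?m ` ?U \<subseteq> ?W" using uw by auto
      moreover have "inj_on ?m ?U"
      proof (rule inj_onI)
        fix e f assume ef: "e \<in> ?U" "f \<in> ?U" and eq: "?m e = ?m f"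
        have inv: "insert u (?m g - {w}) = g" if "g \<in> ?U" for g using that by blast
        show "e = f" using inv[OF ef(1)] inv[OF ef(2)] unfolding eq by (rule trans[OF sym])
      qed
      ultimately have "card ?U \<le> card ?W" using fin by (intro card_inj_on_le) auto
      thus False using dU dW u w by simp
    qed
    then obtain e where e: "e \<in> F" "u \<in> e" "w \<notin> e" "?m e \<notin> F" by blast
    let ?G = "insert (?m e) (F - {e})"
    have "e \<in> ksets k n" using e(1) sub by blast
    hence ek: "e \<subseteq> {1..n}" "card e = k" "finite e" using finite_mem_ksets[of e k n] by (simp_all add: ksets_def)
    have mk: "?m e \<in> ksets k n"
    proof -
      have "?m e \<subseteq> {1..n}" using ek w by blast
      moreover have "card (?m e) = k" using ek e k by simp
      ultimately show ?thesis by (simp add: ksets_def)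
    qed
    have "card ?G = M" using e cF fin card_Suc_Diff1[OF fin e(1)] by simp
    moreover have "?G \<subseteq> ksets k n" using mk sub by blast
    ultimately have PG: "P ?G" unfolding P_def by simp
    have dG: "hdegree ?G x + of_bool (x = u) = hdegree F x + of_bool (x = w)" for x
    proof -
      have "hdegree ?G x = of_bool (x \<in> ?m e) + hdegree (F - {e}) x"
        using fin e(4) by (simp only: hdegree_sum finite_insert finite_Diff sum.insert) simp
      moreover have "hdegree F x = of_bool (x \<in> e) + hdegree (F - {e}) x"
        using fin e(1) by (simp add: hdegree_sum sum.remove del: sum_of_bool_eq)
      ultimately show ?thesis using e uw by auto
    qed
    have split: "\<Phi> H = (hdegree H u)\<^sup>2 + ((hdegree H w)\<^sup>2 + (\<Sum>x\<in>{1..n} - {u} - {w}. (hdegree H x)\<^sup>2))" for H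
      unfolding \<Phi>_def using u(1) w(1) uw by (subst sum.remove[of _ u], simp, simp, subst sum.remove[of _ w]) auto
    have rest: "(\<Sum>x\<in>{1..n} - {u} - {w}. (hdegree ?G x)\<^sup>2) = (\<Sum>x\<in>{1..n} - {u} - {w}. (hdegree F x)\<^sup>2)"
    proof (rule sum.cong[OF refl])
      fix x assume "x \<in> {1..n} - {u} - {w}"
      thus "(hdegree ?G x)\<^sup>2 = (hdegree F x)\<^sup>2" using dG[of x] by simp
    qed
    obtain b where b: "hdegree F w = b" by simp
    \<comment> \<open>The two degrees lie on different sides of \<open>d\<close>, so they differ by
      at least 2 and the subtraction is not truncated. The move lowers the sum of squares by 2a +
      2.\<close>
    define a where "a = hdegree F u - (b + 2)"
    have a: "hdegree F u = a + 2 + b" using u w b by (simp add: a_def)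
    have "hdegree ?G u = a + 1 + b" "hdegree ?G w = b + 1" using dG[of u] dG[of w] uw a b by auto
    hence "\<Phi> ?G < \<Phi> F" unfolding split rest a b by (simp add: power2_eq_square algebra_simps)
    thus False using least[OF PG] by simp
  qed
  hence "F \<in> regular_kgraphs k n d" using sub by (simp add: regular_kgraphs_def kgraphs_def ksets_def)
  thus ?thesis by blast
qed

lemma uniform_regular_kgraphs:
  assumes "k \<ge> 1" "k * M = n * d"
  shows "uniform_family (regular_kgraphs k n d) (ksets k n) M"
proof
  fix R assume R: "R \<in> regular_kgraphs k n d"
  show "R \<subseteq> ksets k n" by (rule regular_kgraphs_subset[OF R])
  have "k * card R = k * M" using card_regular_kgraph[OF R] assms(2) by simp
  thus "card R = M" using assms(1) by simp
qed simp

text \<open>Each of the k moves loses at most a factor 1 - 3\<delta> for the spread of the residual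
  degrees and 1 - \<epsilon>' for bad arrays; discarding the edges that meet e loses a further
  factor 1 - 2k^2/n. Bernoulli's inequality adds these losses up to \<epsilon>.\<close>

lemma pmf_next_edge_regular_ge:
  assumes k: "k \<ge> 2" and n: "n > 0" and d: "d > 0" and M: "k * M = n * d"
    and B: "B \<in> uniform_family.states (regular_kgraphs k n d) (ksets k n) t" and t: "t < M"
    and \<mu>: "\<mu> = (real M - real t) / real M * real d"
    and \<delta>: "0 \<le> \<delta>" "\<delta> \<le> 1 / 8" "1 \<le> \<delta> * \<mu>"
    and conc: "\<And>v. v \<in> {1..n} \<Longrightarrow> \<bar>real (d - hdegree B v) - \<mu>\<bar> \<le> \<delta> * \<mu>"
    and \<epsilon>': "\<epsilon>' = 2 * real k ^ 4 * (2 / real n) + fact k * real (d + 2) * (2 / real n) ^ (k - 1)"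
    and \<epsilon>: "real k * (3 * \<delta> + \<epsilon>') + 2 * (real k)\<^sup>2 / real n \<le> \<epsilon>" "\<epsilon> \<le> 1"
    and e: "e \<in> ksets k n - B"
  shows "(1 - \<epsilon>) / real (card (ksets k n - B)) \<le> pmf (next_edge (regular_kgraphs k n d) B) e"
proof -
  interpret uniform_family "regular_kgraphs k n d" "ksets k n" M
    by (rule uniform_regular_kgraphs) (use k M in auto)
  let ?E = "extensions (regular_kgraphs k n d)"
  have Bs: "B \<subseteq> ksets k n" "card B = t" "?E B \<noteq> {}" using B by (simp_all add: states_def)
  have finB: "finite B" by (rule finite_subset[OF Bs(1) finite_ksets])
  have \<mu>0: "\<mu> > 0"
  proof (rule ccontr)
    assume "\<not> ?thesis"
    hence "\<delta> * \<mu> \<le> 0" using \<delta>(1) by (intro mult_nonneg_nonpos) auto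
    thus False using \<delta>(3) by simp
  qed
  \<comment> \<open>Residual degrees are at least (1 - \<delta>)\<mu>; one more \<delta>\<mu>, which
    is at least 1, pays for the \<open>+ 1\<close> that the switching demands.\<close>
  define L where "L = (1 - 2 * \<delta>) * \<mu>"
  define \<Delta> where "\<Delta> = nat \<lfloor>(1 + \<delta>) * \<mu>\<rfloor>"
  \<comment> \<open>For \<delta> up to 1/8 the largest residual degree is at most twice
    \<open>L\<close>, whence the 2.\<close>
  define q where "q = 2 / real n"
  have L: "L > 0" using \<delta> \<mu>0 by (simp add: L_def)
  have low: "L + 1 \<le> real d - real (hdegree B u)" if "u \<in> {1..n}" for u
  proof -
    have 1: "real (d - hdegree B u) \<ge> L + 1"
      using conc[OF that] \<delta>(3) by (simp add: L_def algebra_simps abs_le_iff)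
    hence "d - hdegree B u > 0" using L by (intro gr0I) simp
    thus ?thesis using 1 by (simp add: of_nat_diff)
  qed
  have up: "d - hdegree B u \<le> \<Delta>" if "u \<in> {1..n}" for u
  proof -
    have "real (d - hdegree B u) \<le> (1 + \<delta>) * \<mu>"
      using conc[OF that] by (simp add: algebra_simps abs_le_iff)
    hence "int (d - hdegree B u) \<le> \<lfloor>(1 + \<delta>) * \<mu>\<rfloor>" by (simp add: le_floor_iff)
    thus ?thesis by (simp add: \<Delta>_def)
  qed
  have \<Delta>: "real \<Delta> \<le> (1 + \<delta>) * \<mu>" using \<delta> \<mu>0 by (simp add: \<Delta>_def)
  have one: "1 \<in> {1..n}" using n by simp
  have L\<Delta>: "L \<le> real \<Delta>" using low[OF one] up[OF one] by simp
  have \<Delta>0: "real \<Delta> > 0" using L L\<Delta> by simp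
  have q: "real \<Delta> / (real n * L) \<le> q"
  proof -
    have "real \<Delta> \<le> 2 * L"
    proof -
      have "(1 + \<delta>) * \<mu> \<le> (2 * (1 - 2 * \<delta>)) * \<mu>" using \<delta> \<mu>0 by (intro mult_right_mono) auto
      with \<Delta> have "real \<Delta> \<le> (2 * (1 - 2 * \<delta>)) * \<mu>" by (rule order_trans)
      thus ?thesis by (simp only: L_def mult.assoc)
    qed
    hence "real \<Delta> / (real n * L) \<le> 2 * L / (real n * L)" using L n by (intro divide_right_mono) auto
    thus ?thesis using L by (simp add: q_def)
  qed
  define \<rho> where "\<rho> = (1 - (2 * real k ^ 4 * q + fact k * real (d + 2) * q ^ (k - 1))) * L / real \<Delta>"
  have \<rho>: "\<rho> = (1 - \<epsilon>') * L / real \<Delta>" by (simp only: \<rho>_def \<epsilon>' q_def)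
  have \<epsilon>'0: "\<epsilon>' \<ge> 0" by (simp add: \<epsilon>')
  define \<xi> where "\<xi> = 3 * \<delta> + \<epsilon>'"
  have \<xi>0: "\<xi> \<ge> 0" using \<delta> \<epsilon>'0 by (simp add: \<xi>_def)
  have k\<xi>: "real k * \<xi> \<le> \<epsilon> - 2 * (real k)\<^sup>2 / real n" using \<epsilon>(1) by (simp add: \<xi>_def)
  have "2 * (real k)\<^sup>2 / real n \<ge> 0" by simp
  hence k\<xi>1: "real k * \<xi> \<le> 1" using k\<xi> \<epsilon>(2) by linarith
  have "1 * \<xi> \<le> real k * \<xi>" using k \<xi>0 by (intro mult_right_mono) auto
  hence \<xi>1: "\<xi> \<le> 1" using k\<xi>1 by simp
  have \<epsilon>'1: "\<epsilon>' \<le> 1" using \<xi>1 \<delta> by (simp add: \<xi>_def)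
  have \<rho>ge: "1 - \<xi> \<le> \<rho>"
  proof -
    have "(1 - 3 * \<delta>) * real \<Delta> \<le> (1 - 3 * \<delta>) * ((1 + \<delta>) * \<mu>)"
      using \<Delta> \<delta> by (intro mult_left_mono) auto
    also have "\<dots> = ((1 - 3 * \<delta>) * (1 + \<delta>)) * \<mu>" by simp
    also have "\<dots> \<le> (1 - 2 * \<delta>) * \<mu>"
      using \<mu>0 \<delta> by (intro mult_right_mono) (auto simp: algebra_simps)
    finally have "1 - 3 * \<delta> \<le> L / real \<Delta>" using \<Delta>0 by (simp add: L_def field_simps)
    hence "(1 - \<epsilon>') * (1 - 3 * \<delta>) \<le> (1 - \<epsilon>') * (L / real \<Delta>)"
      using \<epsilon>'1 by (intro mult_left_mono) auto
    moreover have "1 - \<xi> \<le> (1 - \<epsilon>') * (1 - 3 * \<delta>)"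
      using \<delta> \<epsilon>'0 by (simp add: \<xi>_def algebra_simps)
    ultimately show ?thesis by (simp add: \<rho>)
  qed
  have \<rho>0: "0 \<le> \<rho>" using \<rho>ge \<xi>1 by simp
  have \<rho>1: "\<rho> \<le> 1"
  proof -
    have "(1 - \<epsilon>') * L \<le> 1 * L" using \<epsilon>'0 L by (intro mult_right_mono) auto
    thus ?thesis using L\<Delta> \<Delta>0 by (simp add: \<rho>)
  qed
  have \<rho>k: "1 - real k * \<xi> \<le> \<rho> ^ k"
  proof -
    have "1 + real k * (- \<xi>) \<le> (1 + - \<xi>) ^ k" using \<xi>1 by (intro Bernoulli_inequality) simp
    also have "\<dots> \<le> \<rho> ^ k" using \<rho>ge \<xi>1 by (intro power_mono) auto
    finally show ?thesis by simp
  qed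
  have tM: "real M - real t > 0" using t by simp
  define \<kappa> where "\<kappa> = 2 * (real k)\<^sup>2 / real n"
  \<comment> \<open>Since \<mu>/(M - t) = d/M = k/n, the edges meeting e are a fraction of order
    k^2/n of the hidden edges at every time.\<close>
  have kD: "real k * real \<Delta> \<le> \<kappa> * (real M - real t)"
  proof -
    have "real k * real M = real n * real d" using M by (simp flip: of_nat_mult)
    hence "real d / real M = real k / real n" using n t by (simp add: field_simps)
    moreover have "\<mu> = (real M - real t) * (real d / real M)" unfolding \<mu> by simp
    ultimately have \<mu>': "\<mu> = (real M - real t) * (real k / real n)" by (simp only:)
    have "(1 + \<delta>) * \<mu> \<le> 2 * \<mu>" using \<delta> \<mu>0 by (intro mult_right_mono) auto
    hence "real k * real \<Delta> \<le> real k * (2 * \<mu>)" using \<Delta> by (intro mult_left_mono) auto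
    also have "\<dots> = \<kappa> * (real M - real t)" unfolding \<mu>' \<kappa>_def by (simp add: power2_eq_square)
    finally show ?thesis .
  qed
  have \<kappa>: "0 \<le> \<kappa>" "\<kappa> \<le> 1"
  proof -
    show "0 \<le> \<kappa>" by (simp add: \<kappa>_def)
    have "real k * \<xi> \<ge> 0" using \<xi>0 by simp
    thus "\<kappa> \<le> 1" using k\<xi> \<epsilon>(2) by (simp add: \<kappa>_def)
  qed
  let ?b = "real (card (?E B))" and ?c = "real (card (?E (insert e B)))"
  have b: "?b > 0" using Bs(3) finite_ext by (simp add: card_gt_0_iff)
  have "\<rho> ^ k * (real M - real (card B) - real k * real \<Delta>) * ?b
     \<le> (real (n choose k) - real (card B)) * ?c"
    by (rule card_extensions_insert_ge[OF k Bs(1) d L low up q \<rho>_def e \<rho>0 \<rho>1 M])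
  moreover have N: "real (card (ksets k n - B)) = real (n choose k) - real (card B)"
    using card_mono[OF finite_ksets Bs(1)] by (simp add: card_Diff_subset finB Bs(1) card_ksets of_nat_diff)
  ultimately have ge: "\<rho> ^ k * (real M - real t - real k * real \<Delta>) * ?b \<le> real (card (ksets k n - B)) * ?c"
    by (simp add: Bs(2))
  have "(1 - \<epsilon>) * (real M - real t) \<le> ((1 - real k * \<xi>) * (1 - \<kappa>)) * (real M - real t)"
  proof (rule mult_right_mono)
    have "0 \<le> real k * \<xi> * \<kappa>" using \<xi>0 \<kappa> by simp
    thus "1 - \<epsilon> \<le> (1 - real k * \<xi>) * (1 - \<kappa>)"
      using k\<xi> by (simp add: \<kappa>_def[symmetric] algebra_simps)
  qed (use tM in simp)
  also have "\<dots> = (1 - real k * \<xi>) * ((1 - \<kappa>) * (real M - real t))" by simp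
  also have "\<dots> \<le> \<rho> ^ k * ((1 - \<kappa>) * (real M - real t))"
    using \<rho>k \<kappa> tM by (intro mult_right_mono) auto
  also have "\<dots> \<le> \<rho> ^ k * (real M - real t - real k * real \<Delta>)"
    using kD \<rho>0 by (intro mult_left_mono) (auto simp: algebra_simps)
  finally have "(1 - \<epsilon>) * (real M - real t) * ?b \<le> \<rho> ^ k * (real M - real t - real k * real \<Delta>) * ?b"
    using b by (intro mult_right_mono) auto
  hence main: "(1 - \<epsilon>) * (real M - real t) * ?b \<le> real (card (ksets k n - B)) * ?c" using ge by linarith
  have "card (ksets k n - B) > 0" using e by (auto simp: card_gt_0_iff)
  hence "(1 - \<epsilon>) / real (card (ksets k n - B)) \<le> ?c / ((real M - real t) * ?b)"
    using main tM b by (simp add: field_simps)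
  also have "\<dots> = pmf (next_edge (regular_kgraphs k n d) B) e"
    using pmf_next_edge[OF Bs(3) finB, of e] t e Bs(2) by simp
  finally show ?thesis .
qed

text \<open>A reachable state is bad only if some residual degree deviates from its mean. The tail
  bound is applied to the star of each vertex, which meets every regular graph in \<open>d\<close>
  edges.\<close>

lemma prob_bad_regular_le:
  assumes k: "k \<ge> 2" and n: "n > 0" and d: "d > 0" and M: "k * M = n * d" and t: "t < M"
    and ne: "regular_kgraphs k n d \<noteq> {}"
    and \<mu>: "\<mu> = (real M - real t) / real M * real d"
    and \<delta>: "0 \<le> \<delta>" "\<delta> \<le> 1 / 8" "1 \<le> \<delta> * \<mu>"
    and \<epsilon>: "real k * (3 * \<delta> + (2 * real k ^ 4 * (2 / real n) + fact k * real (d + 2) * (2 / real n) ^ (k - 1)))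
        + 2 * (real k)\<^sup>2 / real n \<le> \<epsilon>" "\<epsilon> \<le> 1"
  shows "measure_pmf.prob (chain (uniform_family.add_edge (regular_kgraphs k n d)) {} t)
      {B. \<exists>e\<in>ksets k n - B. pmf (next_edge (regular_kgraphs k n d) B) e < (1 - \<epsilon>) / real (card (ksets k n - B))}
    \<le> real n * (2 * exp (- (\<delta>\<^sup>2 * \<mu> / 4)))"
proof -
  interpret uniform_family "regular_kgraphs k n d" "ksets k n" M
    by (rule uniform_regular_kgraphs) (use k M in auto)
  let ?p = "chain add_edge {} t"
  let ?bad = "{B. \<exists>e\<in>ksets k n - B. pmf (next_edge (regular_kgraphs k n d) B) e < (1 - \<epsilon>) / real (card (ksets k n - B))}"
  let ?dev = "\<lambda>v. {B. \<bar>real (d - card (B \<inter> {e. v \<in> e})) - \<mu>\<bar> > \<delta> * \<mu>}"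
  have "extensions (regular_kgraphs k n d) {} = regular_kgraphs k n d" by (simp add: extensions_def)
  hence S0: "{} \<in> states 0" using ne by (simp add: states_def)
  have SB: "set_pmf ?p \<subseteq> states t"
    by (rule set_chain[where T = t and S = states and \<kappa> = add_edge, OF S0]) (use set_add_edge t in auto)
  have deg: "card (B \<inter> {e. v \<in> e}) = hdegree B v" for B v
    by (simp add: hdegree_def Int_def)
  have "measure_pmf.prob ?p ?bad \<le> measure_pmf.prob ?p (\<Union>v\<in>{1..n}. ?dev v)"
  proof (rule measure_pmf.finite_measure_mono_AE)
    show "AE B in measure_pmf ?p. B \<in> ?bad \<longrightarrow> B \<in> (\<Union>v\<in>{1..n}. ?dev v)"
      unfolding AE_measure_pmf_iff
    proof (intro ballI impI)
      fix B assume B: "B \<in> set_pmf ?p" and bad: "B \<in> ?bad"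
      show "B \<in> (\<Union>v\<in>{1..n}. ?dev v)"
      proof (rule ccontr)
        assume neg: "B \<notin> (\<Union>v\<in>{1..n}. ?dev v)"
        have conc: "\<bar>real (d - hdegree B v) - \<mu>\<bar> \<le> \<delta> * \<mu>" if "v \<in> {1..n}" for v
          using neg that unfolding deg by (auto simp: not_less)
        have "B \<in> states t" using B SB by blast
        from pmf_next_edge_regular_ge[OF k n d M this t \<mu> \<delta> conc refl \<epsilon>] bad
        show False by (force simp: not_less)
      qed
    qed
  qed simp
  also have "\<dots> \<le> (\<Sum>v\<in>{1..n}. measure_pmf.prob ?p (?dev v))"
    by (rule measure_UNION_le) simp_all
  also have "\<dots> \<le> (\<Sum>v\<in>{1..n}. 2 * exp (- (\<delta>\<^sup>2 * \<mu> / 4)))"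
  proof (rule sum_mono)
    fix v assume v: "v \<in> {1..n}"
    have "card (R \<inter> {e. v \<in> e}) = d" if "R \<in> regular_kgraphs k n d" for R
      using that v unfolding deg by (simp add: regular_kgraphs_def)
    from prob_residual_tail_le[OF ne t \<delta>(1) _ this] \<delta>(2)
    show "measure_pmf.prob ?p (?dev v) \<le> 2 * exp (- (\<delta>\<^sup>2 * \<mu> / 4))" unfolding \<mu> by simp
  qed
  finally show ?thesis by simp
qed

text \<open>\<open>C1\<close> keeps the losses from bad arrays and from edges meeting e below
  \<gamma>/16, \<open>C2\<close> makes the Chernoff exponent at least (k + 2) log n, and
  \<open>C3\<close> makes \<open>d\<close> small enough for a regular graph to exist.\<close>

lemma coupling_G_nm_R_nd:
  fixes n k d m :: nat and C \<gamma> :: real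
  assumes k: "k \<ge> 2" and n: "n \<ge> 4" and d: "d > 0" and dvd: "k dvd n * d"
    and C1: "C \<ge> 16 * (4 * real k ^ 5 + 3 * real k * fact k * 2 ^ (k - 1) + 2 * (real k)\<^sup>2)"
    and C2: "C \<ge> 36864 * (real k)\<^sup>2 * (real k + 2)" and C3: "C \<ge> real k ^ k"
    and \<gamma>: "C * (root 3 (real d / real n ^ (k - 1) + ln (real n) / real d) + 1 / real n) \<le> \<gamma>" "\<gamma> < 1"
    and m: "real m = (1 - \<gamma>) * real n * real d / real k"
  shows "\<exists>p. map_pmf fst p = G_nm k n m \<and> map_pmf snd p = R_nd k n d \<and>
    measure_pmf.prob p {x. fst x \<subseteq> snd x} \<ge> 1 - 10 / real n"
proof -
  have kr: "real k \<ge> 2" using k by simp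
  have nr: "real n \<ge> 4" using n by simp
  have dr: "real d \<ge> 1" using d by simp
  have ln1: "ln (real n) \<ge> 1"
  proof -
    have "exp 1 \<le> real n" using exp_le nr by linarith
    thus ?thesis using nr by (subst ln_ge_iff) auto
  qed
  have Ck: "C \<ge> 36864 * real k"
  proof -
    have "1 * 1 \<le> real k * (real k + 2)" using kr by (intro mult_mono) auto
    hence "36864 * real k * 1 \<le> 36864 * real k * (real k * (real k + 2))" using kr by (intro mult_left_mono) auto
    thus ?thesis using C2 by (simp add: power2_eq_square mult_ac)
  qed
  have C0: "C \<ge> 1" using Ck kr by linarith
  define x where "x = real d / real n ^ (k - 1)"
  define y where "y = ln (real n) / real d"
  have xy: "x > 0" "y > 0" using dr nr ln1 by (simp_all add: x_def y_def)
  have r0: "root 3 (x + y) > 0" using xy by simp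
  have "C * root 3 (x + y) + C * (1 / real n) \<le> \<gamma>" using \<gamma>(1) by (simp add: x_def y_def distrib_left)
  moreover have "C * root 3 (x + y) > 0" "C * (1 / real n) > 0" using r0 C0 nr by simp_all
  ultimately have Cr: "C * root 3 (x + y) \<le> \<gamma>" and Cn: "C / real n \<le> \<gamma>" and \<gamma>0: "\<gamma> > 0" by auto
  have cube: "C ^ 3 * (x + y) \<le> \<gamma> ^ 3"
  proof -
    have "(C * root 3 (x + y)) ^ 3 \<le> \<gamma> ^ 3" using Cr r0 C0 by (intro power_mono) auto
    moreover have "root 3 (x + y) ^ 3 = x + y" by (rule odd_real_root_pow) simp
    ultimately show ?thesis by (simp add: power_mult_distrib)
  qed
  have CC: "C \<le> C ^ 3" using power_increasing[of 1 3 C] C0 by simp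
  have \<gamma>3: "\<gamma> ^ 3 \<le> \<gamma>" using power_decreasing[of 1 3 \<gamma>] \<gamma>0 \<gamma>(2) by simp
  have "C ^ 3 * x + C ^ 3 * y \<le> \<gamma> ^ 3" using cube by (simp add: distrib_left)
  moreover have "C ^ 3 * x > 0" "C ^ 3 * y > 0" using C0 xy by simp_all
  ultimately have Cx: "C ^ 3 * x \<le> \<gamma> ^ 3" and Cy: "C ^ 3 * y \<le> \<gamma> ^ 3" by linarith+
  have Cx': "C * x \<le> \<gamma>"
  proof -
    have "C * x \<le> C ^ 3 * x" using CC xy by (intro mult_right_mono) auto
    thus ?thesis using Cx \<gamma>3 by linarith
  qed
  \<comment> \<open>A tail exponent of order \<delta>^2 \<mu>, with \<delta> of order \<gamma> and
    \<mu> of order at least \<gamma> d, calls for the cube of \<gamma>.\<close>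
  have Cy': "C * ln (real n) \<le> \<gamma> ^ 3 * real d"
  proof -
    have "C * y \<le> C ^ 3 * y" using CC xy by (intro mult_right_mono) auto
    hence "C * y \<le> \<gamma> ^ 3" using Cy by linarith
    thus ?thesis using dr by (simp add: y_def field_simps)
  qed
  have xd: "real d = x * real n ^ (k - 1)" using nr by (simp add: x_def)
  have kkx: "real k ^ k * x \<le> 1"
  proof -
    have "real k ^ k * x \<le> C * x" using C3 xy by (intro mult_right_mono) auto
    thus ?thesis using Cx' \<gamma>(2) by linarith
  qed
  have dn: "real d \<le> real n ^ (k - 1)"
  proof -
    have "1 * x \<le> C * x" using C0 xy by (intro mult_right_mono) auto
    hence "x \<le> 1" using Cx' \<gamma>(2) by linarith
    hence "x * real n ^ (k - 1) \<le> 1 * real n ^ (k - 1)" by (intro mult_right_mono) auto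
    thus ?thesis using xd by simp
  qed
  obtain M where M: "n * d = k * M" using dvd by blast
  have Mr: "real M = real n * real d / real k"
    using arg_cong[OF M, of real] kr by (simp add: field_simps)
  have kM: "k * M = n * d" using M by simp
  have nk: "real n ^ k = real n * real n ^ (k - 1)" using k by (metis One_nat_def Suc_1 Suc_leD Suc_le_lessD power_minus_mult mult.commute)
  have kn: "k \<le> n"
  proof -
    have "\<gamma> * real n < 1 * real n" using \<gamma>(2) nr by (intro mult_strict_right_mono) auto
    moreover have "C \<le> \<gamma> * real n" using Cn nr by (simp add: field_simps)
    ultimately have "C < real n" by simp
    thus ?thesis using Ck kr by linarith
  qed
  \<comment> \<open>\<open>M\<close> is at most n d = x n^k, and \<open>C3\<close> bounds this by
    (n/k)^k, hence by the binomial coefficient.\<close>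
  have MN: "M \<le> n choose k"
  proof -
    have kk: "real k ^ k \<ge> 1" using kr by (intro one_le_power) simp
    have "real M \<le> real n * real d" unfolding Mr using kr dr nr by (simp add: field_simps)
    also have "\<dots> = x * real n ^ k" unfolding nk xd by simp
    also have "\<dots> \<le> 1 / real k ^ k * real n ^ k"
    proof (rule mult_right_mono)
      have "0 < real k ^ k" using kk by linarith
      thus "x \<le> 1 / real k ^ k" using kkx by (simp add: pos_le_divide_eq mult.commute)
    qed simp
    also have "\<dots> = (real n / real k) ^ k" by (simp add: power_divide)
    also have "\<dots> \<le> real (n choose k)" using binomial_ge_n_over_k_pow_k[OF kn, where ?'a = real] by simp
    finally show ?thesis by simp
  qed
  have ne: "regular_kgraphs k n d \<noteq> {}" by (rule regular_kgraphs_nonempty[OF _ kM MN]) (use k in simp)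
  have mM: "real m = (1 - \<gamma>) * real M" using m by (simp add: Mr)
  have \<gamma>M: "\<gamma> * real M \<ge> real n"
  proof -
    have "real k * 1 \<le> C * ln (real n)" by (intro mult_mono) (use Ck ln1 kr C0 in linarith)+
    hence "real k \<le> \<gamma> ^ 3 * real d" using Cy' by linarith
    also have "\<dots> \<le> \<gamma> * real d" using \<gamma>3 by (intro mult_right_mono) auto
    finally have "real n * real k \<le> real n * (\<gamma> * real d)" by (intro mult_left_mono) auto
    thus ?thesis using kr by (simp add: Mr field_simps)
  qed
  have M0: "real M > 0" using \<gamma>M nr \<gamma>0 by (metis less_le_trans zero_less_mult_pos zero_less_numeral)
  \<comment> \<open>The summand 3k\<delta> of the error is then \<gamma>/16, half of
    \<open>\<epsilon>\<close>; the other half is left for the losses controlled by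
    \<open>C1\<close>.\<close>
  define \<delta> where "\<delta> = \<gamma> / (48 * real k)"
  define \<epsilon> where "\<epsilon> = \<gamma> / 8"
  define j where "j = nat \<lceil>\<gamma> * real M / 4\<rceil>"
  define T where "T = M - j"
  have j: "real j \<ge> \<gamma> * real M / 4" "real j \<le> \<gamma> * real M / 4 + 1"
    using \<gamma>0 M0 by (simp_all add: j_def)
  have \<gamma>M1: "\<gamma> * real M \<le> real M" using mult_right_mono[of \<gamma> 1 "real M"] \<gamma>(2) by simp
  have jM: "j \<le> M" 
  proof -
    have "\<lceil>\<gamma> * real M / 4\<rceil> \<le> int M" using \<gamma>M1 M0 by (simp add: ceiling_le_iff)
    thus ?thesis by (simp only: j_def nat_le_iff)
  qed
  have TM: "T \<le> M" by (simp add: T_def)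
  have Tr: "real T = real M - real j" using jM by (simp add: T_def of_nat_diff)
  interpret uniform_family "regular_kgraphs k n d" "ksets k n" M
    by (rule uniform_regular_kgraphs) (use k kM in auto)
  define bad where "bad = {B. \<exists>e\<in>ksets k n - B. pmf (next_edge (regular_kgraphs k n d) B) e
      < (1 - \<epsilon>) / real (card (ksets k n - B))}"
  have m_le: "m \<le> card (ksets k n)"
  proof -
    have "real m \<le> real M" unfolding mM using \<gamma>0 M0 by (simp add: algebra_simps)
    thus ?thesis using MN by (simp add: card_ksets)
  qed
  have \<epsilon>01: "0 < \<epsilon>" "\<epsilon> \<le> 1" using \<gamma>0 \<gamma>(2) by (simp_all add: \<epsilon>_def)
  obtain p where p: "map_pmf fst p = pmf_of_set {E. E \<subseteq> ksets k n \<and> card E = m}"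
      "map_pmf snd p = pmf_of_set (regular_kgraphs k n d)"
      "measure_pmf.prob p {x. fst x \<subseteq> snd x}
       \<ge> 1 - (\<Sum>t<T. measure_pmf.prob (chain add_edge {} t) bad) - 2 ^ m * ((1 + \<epsilon>) / 2) ^ T"
    using coupling_exists[OF ne m_le TM \<epsilon>01] unfolding bad_def by blast
  have \<delta>: "0 \<le> \<delta>" "\<delta> \<le> 1 / 8" using \<gamma>0 \<gamma>(2) kr by (simp_all add: \<delta>_def field_simps)
  have err: "real k * (3 * \<delta> + (2 * real k ^ 4 * (2 / real n) + fact k * real (d + 2) * (2 / real n) ^ (k - 1)))
        + 2 * (real k)\<^sup>2 / real n \<le> \<epsilon>"
  proof -
    have a1: "1 / real n \<le> \<gamma> / C" using Cn C0 nr by (simp add: field_simps)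
    have "fact k * real (d + 2) * (2 / real n) ^ (k - 1) \<le> fact k * (3 * real d) * (2 / real n) ^ (k - 1)"
      using dr by (intro mult_right_mono mult_left_mono) auto
    also have "\<dots> = 3 * fact k * 2 ^ (k - 1) * x" by (simp add: x_def power_divide)
    also have "\<dots> \<le> 3 * fact k * 2 ^ (k - 1) * (\<gamma> / C)"
      using Cx' C0 by (intro mult_left_mono) (auto simp: field_simps)
    finally have a2: "fact k * real (d + 2) * (2 / real n) ^ (k - 1) \<le> 3 * fact k * 2 ^ (k - 1) * (\<gamma> / C)" .
    have a3: "2 * real k ^ 4 * (2 / real n) \<le> 4 * real k ^ 4 * (\<gamma> / C)"
      using mult_left_mono[OF a1, of "4 * real k ^ 4"] by simp
    have a4: "2 * (real k)\<^sup>2 / real n \<le> 2 * (real k)\<^sup>2 * (\<gamma> / C)"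
      using mult_left_mono[OF a1, of "2 * (real k)\<^sup>2"] by simp
    have "real k * (3 * \<delta> + (2 * real k ^ 4 * (2 / real n) + fact k * real (d + 2) * (2 / real n) ^ (k - 1)))
        + 2 * (real k)\<^sup>2 / real n
      \<le> real k * (3 * \<delta> + (4 * real k ^ 4 * (\<gamma> / C) + 3 * fact k * 2 ^ (k - 1) * (\<gamma> / C)))
        + 2 * (real k)\<^sup>2 * (\<gamma> / C)"
      using a2 a3 a4 by (intro add_mono mult_left_mono) auto
    also have "\<dots> = 3 * (real k * \<delta>) + (4 * real k ^ 5 + 3 * real k * fact k * 2 ^ (k - 1) + 2 * (real k)\<^sup>2) * (\<gamma> / C)"
      by (simp add: algebra_simps power_numeral_reduce)
    also have "\<dots> \<le> 3 * (real k * \<delta>) + C / 16 * (\<gamma> / C)"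
      using C1 \<gamma>0 C0 by (intro add_left_mono mult_right_mono) auto
    also have "\<dots> = \<epsilon>" using kr C0 by (simp add: \<delta>_def \<epsilon>_def)
    finally show ?thesis .
  qed
  have step_prob: "measure_pmf.prob (chain add_edge {} t) bad \<le> 2 * real n / real n ^ (k + 2)" if t: "t < T" for t
  proof -
    define \<mu> where "\<mu> = (real M - real t) / real M * real d"
    have "real M - real t \<ge> \<gamma> * real M / 4" using t j(1) Tr by linarith
    hence "(real M - real t) / real M \<ge> \<gamma> / 4" using M0 by (simp add: field_simps)
    hence \<mu>: "\<mu> \<ge> \<gamma> / 4 * real d" unfolding \<mu>_def by (intro mult_right_mono) auto
    \<comment> \<open>36864 = 16 * 48^2: a square of 48 from \<open>\<delta>\<close>, one 4 from the
      lower bound on \<open>\<mu>\<close> and one from the Chernoff exponent.\<close>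
    have \<delta>\<mu>: "\<delta>\<^sup>2 * \<mu> / 4 \<ge> (real k + 2) * ln (real n)"
    proof -
      have "36864 * (real k)\<^sup>2 * ((real k + 2) * ln (real n)) = 36864 * (real k)\<^sup>2 * (real k + 2) * ln (real n)" by simp
      also have "\<dots> \<le> C * ln (real n)" using C2 ln1 by (intro mult_right_mono) auto
      also have "\<dots> \<le> \<gamma> ^ 3 * real d" by (rule Cy')
      also have "\<dots> = 36864 * (real k)\<^sup>2 * (\<delta>\<^sup>2 * (\<gamma> / 4 * real d) / 4)"
        using kr by (simp add: \<delta>_def power2_eq_square power3_eq_cube field_simps)
      also have "\<dots> \<le> 36864 * (real k)\<^sup>2 * (\<delta>\<^sup>2 * \<mu> / 4)"
        using \<mu> by (intro mult_left_mono divide_right_mono) auto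
      finally show ?thesis by (rule mult_left_le_imp_le) (use kr in simp)
    qed
    have \<delta>1: "1 \<le> \<delta> * \<mu>"
    proof -
      have \<mu>0: "\<mu> \<ge> 0" using \<mu> \<gamma>0 dr by (smt (verit) mult_nonneg_nonneg divide_nonneg_nonneg)
      have "4 * 1 * 1 \<le> 4 * (real k + 2) * ln (real n)" using kr ln1 by (intro mult_mono) auto
      hence "1 \<le> \<delta>\<^sup>2 * \<mu>" using \<delta>\<mu> by linarith
      also have "\<dots> = \<delta> * (\<delta> * \<mu>)" by (simp add: power2_eq_square)
      also have "\<dots> \<le> 1 * (\<delta> * \<mu>)" using \<delta> \<mu>0 by (intro mult_right_mono) auto
      finally show ?thesis by simp
    qed
    have tM: "t < M" using t TM by simp
    have "measure_pmf.prob (chain add_edge {} t) bad \<le> real n * (2 * exp (- (\<delta>\<^sup>2 * \<mu> / 4)))"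
      unfolding bad_def
      by (rule prob_bad_regular_le[OF k _ d kM tM ne \<mu>_def \<delta> \<delta>1 err \<epsilon>01(2)]) (use n in simp)
    also have "\<dots> \<le> real n * (2 * exp (- (real (k + 2) * ln (real n))))"
      using \<delta>\<mu> by (intro mult_left_mono) (auto simp: add_ac)
    also have "exp (- (real (k + 2) * ln (real n))) = 1 / real n ^ (k + 2)"
      using nr by (simp only: exp_minus exp_of_nat_mult) (simp add: inverse_eq_divide)
    finally show ?thesis by simp
  qed
  have \<beta>: "(\<Sum>t<T. measure_pmf.prob (chain add_edge {} t) bad) \<le> 2 / real n"
  proof -
    have "(\<Sum>t<T. measure_pmf.prob (chain add_edge {} t) bad) \<le> real (card {..<T}) * (2 * real n / real n ^ (k + 2))"
      by (rule sum_bounded_above) (use step_prob in simp)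
    also have "\<dots> = real T * (2 * real n / real n ^ (k + 2))" by simp
    \<comment> \<open>There are at most n^k steps and n vertices, so tails of size 2/n^(k+2) leave a
      total of 2/n.\<close>
    also have "\<dots> \<le> real n ^ k * (2 * real n / real n ^ (k + 2))"
    proof (rule mult_right_mono)
      have "real M \<le> real n * real d" unfolding Mr using kr dr nr by (simp add: field_simps)
      also have "\<dots> \<le> real n ^ k" unfolding nk using dn by (intro mult_left_mono) auto
      finally show "real T \<le> real n ^ k" using TM by linarith
    qed simp
    also have "\<dots> = 2 / real n" using nr by (simp add: power_add power2_eq_square field_simps)
    finally show ?thesis .
  qed
  have \<eta>: "2 ^ m * ((1 + \<epsilon>) / 2) ^ T \<le> 8 / real n"
  proof -
    have "real T - real m = \<gamma> * real M - real j" using Tr mM by (simp add: algebra_simps)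
    hence Tm: "real T - real m \<ge> \<gamma> * real M * (3 / 4) - 1" using j(2) by linarith
    have ln2: "ln 2 \<ge> (1::real) / 2" 
    proof -
      have "exp (1 / 2) \<le> (2::real)" using exp_bound[of "1 / 2"] by (simp add: power2_eq_square)
      thus ?thesis by (subst ln_ge_iff) simp_all
    qed
    have pow2: "(2::real) ^ l = exp (real l * ln 2)" for l by (simp add: exp_of_nat_mult)
    have "(1 + \<epsilon>) ^ T \<le> exp \<epsilon> ^ T" using \<epsilon>01 by (intro power_mono exp_ge_add_one_self) auto
    also have "\<dots> = exp (real T * \<epsilon>)" by (simp add: exp_of_nat_mult)
    finally have "2 ^ m * ((1 + \<epsilon>) / 2) ^ T \<le> exp (real m * ln 2) * (exp (real T * \<epsilon>) / exp (real T * ln 2))"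
      unfolding power_divide pow2 by (intro mult_left_mono divide_right_mono) auto
    also have "\<dots> = exp (real T * \<epsilon> - (real T - real m) * ln 2)"
      by (simp add: left_diff_distrib exp_diff exp_add field_simps)
    also have "\<dots> \<le> exp (- (real n / 8))"
    proof -
      have "real T * \<epsilon> \<le> real M * \<epsilon>" using TM \<epsilon>01 by (intro mult_right_mono) auto
      hence 1: "real T * \<epsilon> \<le> \<gamma> * real M / 8" by (simp add: \<epsilon>_def mult.commute)
      have 2: "(\<gamma> * real M * (3 / 4) - 1) * (1 / 2) \<le> (real T - real m) * ln 2"
        using Tm ln2 \<gamma>M nr by (intro mult_mono) auto
      \<comment> \<open>The left-hand expression is at least n/8 because \<gamma>M/4 - 1/2 is at
        least n/4 - 1/2 and n is at least 4.\<close>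
      have "real n / 8 \<le> (\<gamma> * real M * (3 / 4) - 1) * (1 / 2) - \<gamma> * real M / 8"
        using \<gamma>M nr by (simp add: field_simps)
      with 1 2 have "real T * \<epsilon> + real n / 8 \<le> (real T - real m) * ln 2" by linarith
      thus ?thesis by simp
    qed
    also have "\<dots> \<le> 8 / real n"
    proof -
      have "real n / 8 \<le> exp (real n / 8)" using exp_ge_add_one_self[of "real n / 8"] by linarith
      thus ?thesis using nr by (simp add: exp_minus field_simps)
    qed
    finally show ?thesis .
  qed
  have "map_pmf fst p = G_nm k n m"
    unfolding p(1) G_nm_def by (rule arg_cong[of _ _ pmf_of_set]) (auto simp: kgraphs_def ksets_def)
  moreover have "map_pmf snd p = R_nd k n d" unfolding p(2) R_nd_def ..
  moreover have "measure_pmf.prob p {x. fst x \<subseteq> snd x} \<ge> 1 - 10 / real n"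
    using p(3) \<beta> \<eta> by (simp add: add_divide_distrib[of 2 8, symmetric])
  ultimately show ?thesis by blast
qed

theorem theorem1p1:
  fixes k :: nat
  assumes "k \<ge> 2"
  shows "\<exists>C::real. C > 0 \<and>
    (\<forall>(\<gamma> :: nat \<Rightarrow> real) (d :: nat \<Rightarrow> nat) (m :: nat \<Rightarrow> nat).
       (\<forall>\<^sub>F n in sequentially.
          d n > 0 \<and> k dvd n * d n \<and>
          C * (root 3 (real (d n) / real n ^ (k - 1) + ln (real n) / real (d n)) + 1 / real n)
            \<le> \<gamma> n \<and> \<gamma> n < 1 \<and>
          real (m n) = (1 - \<gamma> n) * real n * real (d n) / real k)
       \<longrightarrow> (\<exists>p :: nat \<Rightarrow> (nat set set \<times> nat set set) pmf.
             (\<forall>\<^sub>F n in sequentially.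
                map_pmf fst (p n) = G_nm k n (m n) \<and> map_pmf snd (p n) = R_nd k n (d n)) \<and>
             ((\<lambda>n. measure_pmf.prob (p n) {x. fst x \<subseteq> snd x}) \<longlonglongrightarrow> 1)))"
proof -
  define C where "C = 16 * (4 * real k ^ 5 + 3 * real k * fact k * 2 ^ (k - 1) + 2 * (real k)\<^sup>2)
    + 36864 * (real k)\<^sup>2 * (real k + 2) + real k ^ k"
  have C: "C \<ge> 16 * (4 * real k ^ 5 + 3 * real k * fact k * 2 ^ (k - 1) + 2 * (real k)\<^sup>2)"
      "C \<ge> 36864 * (real k)\<^sup>2 * (real k + 2)" "C \<ge> real k ^ k" "C > 0"
    using assms by (simp_all add: C_def add_nonneg_pos)
  show ?thesis
  proof (intro exI[of _ C] conjI allI impI)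
    fix \<gamma> :: "nat \<Rightarrow> real" and d m :: "nat \<Rightarrow> nat"
    assume "\<forall>\<^sub>F n in sequentially.
          d n > 0 \<and> k dvd n * d n \<and>
          C * (root 3 (real (d n) / real n ^ (k - 1) + ln (real n) / real (d n)) + 1 / real n)
            \<le> \<gamma> n \<and> \<gamma> n < 1 \<and>
          real (m n) = (1 - \<gamma> n) * real n * real (d n) / real k"
    hence "\<forall>\<^sub>F n in sequentially. \<exists>p. map_pmf fst p = G_nm k n (m n) \<and> map_pmf snd p = R_nd k n (d n) \<and>
        measure_pmf.prob p {x. fst x \<subseteq> snd x} \<ge> 1 - 10 / real n"
      using eventually_ge_at_top[of 4]
    proof eventually_elim
      case (elim n)
      thus ?case by (intro coupling_G_nm_R_nd[OF assms _ _ _ C(1-3), of n "d n" "\<gamma> n"]) auto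
    qed
    then obtain N where N: "\<And>n. n \<ge> N \<Longrightarrow> \<exists>p. map_pmf fst p = G_nm k n (m n) \<and> map_pmf snd p = R_nd k n (d n) \<and>
        measure_pmf.prob p {x. fst x \<subseteq> snd x} \<ge> 1 - 10 / real n"
      unfolding eventually_sequentially by blast
    \<comment> \<open>The choice needs a witness for every \<open>n\<close>; below \<open>N\<close>
      any distribution will do.\<close>
    hence "\<forall>n. \<exists>p. n \<ge> N \<longrightarrow> map_pmf fst p = G_nm k n (m n) \<and> map_pmf snd p = R_nd k n (d n) \<and>
        measure_pmf.prob p {x. fst x \<subseteq> snd x} \<ge> 1 - 10 / real n" by blast
    from choice[OF this] obtain p where p: "\<And>n. n \<ge> N \<Longrightarrow> map_pmf fst (p n) = G_nm k n (m n) \<and>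
        map_pmf snd (p n) = R_nd k n (d n) \<and> measure_pmf.prob (p n) {x. fst x \<subseteq> snd x} \<ge> 1 - 10 / real n"
      by blast
    have "(\<lambda>n. measure_pmf.prob (p n) {x. fst x \<subseteq> snd x}) \<longlonglongrightarrow> 1"
    proof (rule tendsto_sandwich[OF _ _ _ tendsto_const])
      show "\<forall>\<^sub>F n in sequentially. 1 - 10 / real n \<le> measure_pmf.prob (p n) {x. fst x \<subseteq> snd x}"
        using eventually_ge_at_top[of N] by eventually_elim (use p in blast)
      show "\<forall>\<^sub>F n in sequentially. measure_pmf.prob (p n) {x. fst x \<subseteq> snd x} \<le> 1" by simp
      have "(\<lambda>n. 1 - 10 / real n) \<longlonglongrightarrow> 1 - 0"
        by (intro tendsto_diff tendsto_const lim_const_over_n)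
      thus "(\<lambda>n. 1 - 10 / real n) \<longlonglongrightarrow> 1" by simp
    qed
    moreover have "\<forall>\<^sub>F n in sequentially. map_pmf fst (p n) = G_nm k n (m n) \<and> map_pmf snd (p n) = R_nd k n (d n)"
      using eventually_ge_at_top[of N] by eventually_elim (use p in blast)
    ultimately show "\<exists>p :: nat \<Rightarrow> (nat set set \<times> nat set set) pmf.
             (\<forall>\<^sub>F n in sequentially.
                map_pmf fst (p n) = G_nm k n (m n) \<and> map_pmf snd (p n) = R_nd k n (d n)) \<and>
             ((\<lambda>n. measure_pmf.prob (p n) {x. fst x \<subseteq> snd x}) \<longlonglongrightarrow> 1)" by blast
  qed (rule C(4))
qed

end
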